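(* Let $H$ be a finitary endofunctor of a locally finitely presentable category $\mathcal A$, and let $\mathbb R$ be the rational monad of $H$. Then the category $\mathrm{Elgot}\,H$ of Elgot algebras and solution-preserving morphisms is isomorphic to the Eilenberg--Moore category $\mathcal A^{\mathbb R}$ of $\mathbb R$-algebras.
   Context: $H$ is finitary if it preserves filtered colimits; $X$ is finitely presentable if $\mathcal A(X,-)$ preserves filtered colimits. Coproduct injections are $\mathrm{inl},\mathrm{inr}$. For an $H$-algebra $\alpha:HA\to A$, a finitary flat equation morphism in $A$ is $e:X\to HX+A$ with $X$ finitely presentable; a solution is $e^\dagger:X\to A$ with $e^\dagger=[\alpha,\mathrm{id}_A]\cdot(He^\dagger+\mathrm{id}_A)\cdot e$. An iterative algebra is an $H$-algebra where every finitary flat equation morphism has a unique solution. Free iterative algebras $RY$ exist on every object $Y$ in this setting; the rational monad $\mathbb R=(R,\eta,\mu)$ is the monad arising from the free iterative algebra adjunction. For $e:X\to HX+Y$ and $h:Y\to Z$, $h\bullet e:=(\mathrm{id}_{HX}+h)\cdot e$; for $e:X\to HX+Y$, $f:Y\to HY+A$, $f\oplus e:=(\mathrm{can}+\mathrm{id}_A)\cdot(\mathrm{id}_{HX}+f)\cdot[e,\mathrm{inr}]:X+Y\to H(X+Y)+A$ with $\mathrm{can}=[H\mathrm{inl},H\mathrm{inr}]$. An Elgot algebra is an $H$-algebra with an assignment $e\mapsto e^\dagger$ of a solution to every finitary flat equation morphism that is functorial ($e^\dagger=f^\dagger\cdot h$ whenever $e:X\to HX+A$, $f:Y\to HY+A$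 finitary and $(Hh+\mathrm{id}_A)\cdot e=f\cdot h$) and compositional ($(f^\dagger\bullet e)^\dagger=(f\oplus e)^\dagger\cdot\mathrm{inl}$ for finitary $e:X\to HX+Y$, $f:Y\to HY+A$). A morphism $h:A\to B$ of Elgot algebras $(A,\alpha,(-)^\dagger)$, $(B,\beta,(-)^\ddagger)$ is solution-preserving if $h\cdot e^\dagger=(h\bullet e)^\ddagger$ for all finitary flat equation morphisms $e$ in $A$. *)

theory Defs
  imports Main "HOL-Library.FuncSet"
begin

unbundle cardinal_syntax

section \<open>Categories and functors\<close>

text \<open>Composition is in the usual order: \<open>g \<cdot> f\<close> is ``first \<open>f\<close>, then \<open>g\<close>''.\<close>

record ('o, 'm) cat =
  Ob :: "'o set"
  Ar :: "'m set"
  Dom :: "'m \<Rightarrow> 'o"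
  Cod :: "'m \<Rightarrow> 'o"
  Ident :: "'o \<Rightarrow> 'm"
  Cmp :: "'m \<Rightarrow> 'm \<Rightarrow> 'm" (infixl \<open>\<cdot>\<index>\<close> 70)

definition Hom :: "('o, 'm) cat \<Rightarrow> 'o \<Rightarrow> 'o \<Rightarrow> 'm set" where
  "Hom C X Y = {f \<in> Ar C. Dom C f = X \<and> Cod C f = Y}"

locale category =
  fixes C :: "('o, 'm) cat" (structure)
  assumes Dom_Ob: "f \<in> Ar C \<Longrightarrow> Dom C f \<in> Ob C"
    and Cod_Ob: "f \<in> Ar C \<Longrightarrow> Cod C f \<in> Ob C"
    and Ident_Hom: "X \<in> Ob C \<Longrightarrow> Ident C X \<in> Hom C X X"
    and Cmp_Hom: "f \<in> Hom C X Y \<Longrightarrow> g \<in> Hom C Y Z \<Longrightarrow> g \<cdot> f \<in> Hom C X Z"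
    and Cmp_Ident: "f \<in> Hom C X Y \<Longrightarrow> f \<cdot> Ident C X = f"
    and Ident_Cmp: "f \<in> Hom C X Y \<Longrightarrow> Ident C Y \<cdot> f = f"
    and Cmp_assoc: "f \<in> Hom C W X \<Longrightarrow> g \<in> Hom C X Y \<Longrightarrow> h \<in> Hom C Y Z \<Longrightarrow>
                      (h \<cdot> g) \<cdot> f = h \<cdot> (g \<cdot> f)"

record ('o, 'm, 'p, 'n) func =
  FOb :: "'o \<Rightarrow> 'p"
  FAr :: "'m \<Rightarrow> 'n"

definition is_functor ::
  "('o, 'm) cat \<Rightarrow> ('p, 'n) cat \<Rightarrow> ('o, 'm, 'p, 'n) func \<Rightarrow> bool" where
  "is_functor C D F \<longleftrightarrow> category C \<and> category D \<and>
     (\<forall>X\<in>Ob C. FOb F X \<in> Ob D) \<and>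
     (\<forall>f\<in>Ar C. FAr F f \<in> Hom D (FOb F (Dom C f)) (FOb F (Cod C f))) \<and>
     (\<forall>X\<in>Ob C. FAr F (Ident C X) = Ident D (FOb F X)) \<and>
     (\<forall>f\<in>Ar C. \<forall>g\<in>Ar C. Dom C g = Cod C f \<longrightarrow>
        FAr F (g \<cdot>\<^bsub>C\<^esub> f) = FAr F g \<cdot>\<^bsub>D\<^esub> FAr F f)"

definition func_comp ::
  "('p, 'n, 'q, 'l) func \<Rightarrow> ('o, 'm, 'p, 'n) func \<Rightarrow> ('o, 'm, 'q, 'l) func" where
  "func_comp G F = \<lparr>FOb = FOb G \<circ> FOb F, FAr = FAr G \<circ> FAr F\<rparr>"

definition isomorphic_categories :: "('o, 'm) cat \<Rightarrow> ('p, 'n) cat \<Rightarrow> bool" where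
  "isomorphic_categories C D \<longleftrightarrow>
     (\<exists>(F :: ('o, 'm, 'p, 'n) func) (G :: ('p, 'n, 'o, 'm) func).
        is_functor C D F \<and> is_functor D C G \<and>
        (\<forall>X\<in>Ob C. FOb G (FOb F X) = X) \<and> (\<forall>f\<in>Ar C. FAr G (FAr F f) = f) \<and>
        (\<forall>Y\<in>Ob D. FOb F (FOb G Y) = Y) \<and> (\<forall>g\<in>Ar D. FAr F (FAr G g) = g))"


section \<open>Smallness, colimits and finitary functors\<close>

text \<open>
  ``Small'' means ``of cardinality less than \<open>\<kappa>\<close>'' for a fixed uncountable regular cardinal
  \<open>\<kappa>\<close>. An inaccessible \<open>\<kappa>\<close> gives smallness with respect to a Grothendieck universe; that
  \<open>\<kappa>\<close> is a strong limit is not required. Since a small category is isomorphic to one whose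
  objects and arrows are taken from \<open>Field \<kappa>\<close>, quantifying over shapes of type
  \<open>('k, 'k) cat\<close> covers all small shapes.
\<close>

definition uncountable_regular :: "'k rel \<Rightarrow> bool" where
  "uncountable_regular \<kappa> \<longleftrightarrow> Card_order \<kappa> \<and> natLeq <o \<kappa> \<and> regularCard \<kappa>"

definition small :: "'k rel \<Rightarrow> 'a set \<Rightarrow> bool" where
  "small \<kappa> A \<longleftrightarrow> |A| <o \<kappa>"

definition small_category :: "'k rel \<Rightarrow> ('i, 'j) cat \<Rightarrow> bool" where
  "small_category \<kappa> J \<longleftrightarrow> category J \<and> small \<kappa> (Ob J) \<and> small \<kappa> (Ar J)"

definition filtered :: "('i, 'j) cat \<Rightarrow> bool" where
  "filtered J \<longleftrightarrow> Ob J \<noteq> {} \<and>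
     (\<forall>i\<in>Ob J. \<forall>j\<in>Ob J. \<exists>k\<in>Ob J. Hom J i k \<noteq> {} \<and> Hom J j k \<noteq> {}) \<and>
     (\<forall>u\<in>Ar J. \<forall>v\<in>Ar J. Dom J u = Dom J v \<and> Cod J u = Cod J v \<longrightarrow>
        (\<exists>w\<in>Ar J. Dom J w = Cod J u \<and> w \<cdot>\<^bsub>J\<^esub> u = w \<cdot>\<^bsub>J\<^esub> v))"

definition is_cocone ::
  "('i, 'j) cat \<Rightarrow> ('o, 'm) cat \<Rightarrow> ('i, 'j, 'o, 'm) func \<Rightarrow> 'o \<Rightarrow> ('i \<Rightarrow> 'm) \<Rightarrow> bool" where
  "is_cocone J C D L c \<longleftrightarrow> L \<in> Ob C \<and> (\<forall>i\<in>Ob J. c i \<in> Hom C (FOb D i) L) \<and>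
     (\<forall>u\<in>Ar J. c (Cod J u) \<cdot>\<^bsub>C\<^esub> FAr D u = c (Dom J u))"

definition is_colimit ::
  "('i, 'j) cat \<Rightarrow> ('o, 'm) cat \<Rightarrow> ('i, 'j, 'o, 'm) func \<Rightarrow> 'o \<Rightarrow> ('i \<Rightarrow> 'm) \<Rightarrow> bool" where
  "is_colimit J C D L c \<longleftrightarrow> is_cocone J C D L c \<and>
     (\<forall>L' c'. is_cocone J C D L' c' \<longrightarrow>
        (\<exists>!h. h \<in> Hom C L L' \<and> (\<forall>i\<in>Ob J. h \<cdot>\<^bsub>C\<^esub> c i = c' i)))"

definition cocomplete :: "'k rel \<Rightarrow> ('o, 'm) cat \<Rightarrow> bool" where
  "cocomplete \<kappa> C \<longleftrightarrow>
     (\<forall>(J :: ('k, 'k) cat) D. small_category \<kappa> J \<and> is_functor J C D \<longrightarrow>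
        (\<exists>L c. is_colimit J C D L c))"

definition finitary ::
  "'k rel \<Rightarrow> ('o, 'm) cat \<Rightarrow> ('p, 'n) cat \<Rightarrow> ('o, 'm, 'p, 'n) func \<Rightarrow> bool" where
  "finitary \<kappa> C D F \<longleftrightarrow> is_functor C D F \<and>
     (\<forall>(J :: ('k, 'k) cat) E L c.
        small_category \<kappa> J \<and> filtered J \<and> is_functor J C E \<and> is_colimit J C E L c \<longrightarrow>
        is_colimit J D (func_comp F E) (FOb F L) (\<lambda>i. FAr F (c i)))"

text \<open>
  The category of sets whose elements are taken from the type \<open>'a\<close>. It is the codomain of the
  hom-functors of a category with arrows in \<open>'a\<close>. Restricting to subsets of \<open>'a\<close> does not
  change which cocones of hom-sets are colimits, since maps into sets with at most two elements
  already detect this.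
\<close>

type_synonym 'a set_arrow = "'a set \<times> ('a \<Rightarrow> 'a) \<times> 'a set"

definition Set_cat :: "('a set, 'a set_arrow) cat" where
  "Set_cat =
    \<lparr>Ob = UNIV,
     Ar = {(A, f, B). f \<in> A \<rightarrow>\<^sub>E B},
     Dom = (\<lambda>(A, f, B). A),
     Cod = (\<lambda>(A, f, B). B),
     Ident = (\<lambda>A. (A, restrict id A, A)),
     Cmp = (\<lambda>(_, g, Z) (X, f, _). (X, restrict (g \<circ> f) X, Z))\<rparr>"

definition hom_functor :: "('o, 'm) cat \<Rightarrow> 'o \<Rightarrow> ('o, 'm, 'm set, 'm set_arrow) func" where
  "hom_functor C X =
    \<lparr>FOb = (\<lambda>Y. Hom C X Y),
     FAr = (\<lambda>g. (Hom C X (Dom C g), restrict (\<lambda>f. g \<cdot>\<^bsub>C\<^esub> f) (Hom C X (Dom C g)),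
                 Hom C X (Cod C g)))\<rparr>"

definition finitely_presentable :: "'k rel \<Rightarrow> ('o, 'm) cat \<Rightarrow> 'o \<Rightarrow> bool" where
  "finitely_presentable \<kappa> C X \<longleftrightarrow> X \<in> Ob C \<and> finitary \<kappa> C Set_cat (hom_functor C X)"

text \<open>
  Smallness of the hom-sets is only imposed on the full subcategory spanned by the generating set
  \<open>G\<close>. For locally small categories it follows from smallness of \<open>G\<close>, so the usual notion
  is covered.
\<close>

definition locally_finitely_presentable :: "'k rel \<Rightarrow> ('o, 'm) cat \<Rightarrow> bool" where
  "locally_finitely_presentable \<kappa> C \<longleftrightarrow> category C \<and> cocomplete \<kappa> C \<and>
     (\<exists>G. small \<kappa> G \<and> (\<forall>X\<in>G. \<forall>Y\<in>G. small \<kappa> (Hom C X Y)) \<and>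
        (\<forall>X\<in>G. finitely_presentable \<kappa> C X) \<and>
        (\<forall>A\<in>Ob C. \<exists>(J :: ('k, 'k) cat) D c.
           small_category \<kappa> J \<and> filtered J \<and> is_functor J C D \<and>
           (\<forall>i\<in>Ob J. FOb D i \<in> G) \<and> is_colimit J C D A c))"


section \<open>Chosen binary coproducts\<close>

record ('o, 'm) coproducts =
  cop :: "'o \<Rightarrow> 'o \<Rightarrow> 'o"
  inl :: "'o \<Rightarrow> 'o \<Rightarrow> 'm"
  inr :: "'o \<Rightarrow> 'o \<Rightarrow> 'm"

definition binary_coproducts :: "('o, 'm) cat \<Rightarrow> ('o, 'm) coproducts \<Rightarrow> bool" where
  "binary_coproducts C S \<longleftrightarrow>
     (\<forall>A\<in>Ob C. \<forall>B\<in>Ob C. cop S A B \<in> Ob C \<and>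
        inl S A B \<in> Hom C A (cop S A B) \<and> inr S A B \<in> Hom C B (cop S A B) \<and>
        (\<forall>Z\<in>Ob C. \<forall>f\<in>Hom C A Z. \<forall>g\<in>Hom C B Z.
           \<exists>!h. h \<in> Hom C (cop S A B) Z \<and> h \<cdot>\<^bsub>C\<^esub> inl S A B = f \<and> h \<cdot>\<^bsub>C\<^esub> inr S A B = g))"

text \<open>\<open>copair C S f g\<close> is \<open>[f, g]\<close> and \<open>cplus C S f g\<close> is \<open>f + g\<close>.\<close>

definition copair :: "('o, 'm) cat \<Rightarrow> ('o, 'm) coproducts \<Rightarrow> 'm \<Rightarrow> 'm \<Rightarrow> 'm" where
  "copair C S f g = (THE h. h \<in> Hom C (cop S (Dom C f) (Dom C g)) (Cod C f) \<and>
     h \<cdot>\<^bsub>C\<^esub> inl S (Dom C f) (Dom C g) = f \<and> h \<cdot>\<^bsub>C\<^esub> inr S (Dom C f) (Dom C g) = g)"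

definition cplus :: "('o, 'm) cat \<Rightarrow> ('o, 'm) coproducts \<Rightarrow> 'm \<Rightarrow> 'm \<Rightarrow> 'm" where
  "cplus C S f g = copair C S (inl S (Cod C f) (Cod C g) \<cdot>\<^bsub>C\<^esub> f) (inr S (Cod C f) (Cod C g) \<cdot>\<^bsub>C\<^esub> g)"

definition cassoc :: "('o, 'm) cat \<Rightarrow> ('o, 'm) coproducts \<Rightarrow> 'o \<Rightarrow> 'o \<Rightarrow> 'o \<Rightarrow> 'm" where
  \<comment> \<open>the canonical isomorphism from \<open>X + (Y + Z)\<close> to \<open>(X + Y) + Z\<close>\<close>
  "cassoc C S X Y Z =
     copair C S (inl S (cop S X Y) Z \<cdot>\<^bsub>C\<^esub> inl S X Y)
       (copair C S (inl S (cop S X Y) Z \<cdot>\<^bsub>C\<^esub> inr S X Y) (inr S (cop S X Y) Z))"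


section \<open>Flat equation morphisms and their solutions\<close>

definition flat_equations ::
  "'k rel \<Rightarrow> ('o, 'm) cat \<Rightarrow> ('o, 'm, 'o, 'm) func \<Rightarrow> ('o, 'm) coproducts \<Rightarrow> 'o \<Rightarrow> 'm set" where
  \<comment> \<open>the finitary flat equation morphisms with parameters in \<open>A\<close>; the object \<open>X\<close> of variables
     of \<open>e : X \<rightarrow> HX + A\<close> is recovered as \<open>Dom C e\<close>\<close>
  "flat_equations \<kappa> C H S A =
     {e \<in> Ar C. finitely_presentable \<kappa> C (Dom C e) \<and> Cod C e = cop S (FOb H (Dom C e)) A}"

definition is_solution ::
  "('o, 'm) cat \<Rightarrow> ('o, 'm, 'o, 'm) func \<Rightarrow> ('o, 'm) coproducts \<Rightarrow> 'o \<Rightarrow> 'm \<Rightarrow> 'm \<Rightarrow> 'm \<Rightarrow> bool" where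
  "is_solution C H S A \<alpha> e s \<longleftrightarrow> s \<in> Hom C (Dom C e) A \<and>
     s = copair C S \<alpha> (Ident C A) \<cdot>\<^bsub>C\<^esub> cplus C S (FAr H s) (Ident C A) \<cdot>\<^bsub>C\<^esub> e"

definition bullet ::
  "('o, 'm) cat \<Rightarrow> ('o, 'm, 'o, 'm) func \<Rightarrow> ('o, 'm) coproducts \<Rightarrow> 'm \<Rightarrow> 'm \<Rightarrow> 'm" where
  "bullet C H S h e = cplus C S (Ident C (FOb H (Dom C e))) h \<cdot>\<^bsub>C\<^esub> e"

text \<open>
  \<open>oplus C H S A f e\<close> is \<open>f \<oplus> e\<close> for \<open>e : X \<rightarrow> HX + Y\<close> and \<open>f : Y \<rightarrow> HY + A\<close>. The
  associativity isomorphism, usually left implicit, identifies \<open>HX + (HY + A)\<close> with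
  \<open>(HX + HY) + A\<close>.
\<close>

definition oplus ::
  "('o, 'm) cat \<Rightarrow> ('o, 'm, 'o, 'm) func \<Rightarrow> ('o, 'm) coproducts \<Rightarrow> 'o \<Rightarrow> 'm \<Rightarrow> 'm \<Rightarrow> 'm" where
  "oplus C H S A f e =
     (let X = Dom C e; Y = Dom C f; HX = FOb H X; HY = FOb H Y;
          can = copair C S (FAr H (inl S X Y)) (FAr H (inr S X Y))
      in cplus C S can (Ident C A) \<cdot>\<^bsub>C\<^esub> cassoc C S HX HY A \<cdot>\<^bsub>C\<^esub>
         cplus C S (Ident C HX) f \<cdot>\<^bsub>C\<^esub> copair C S e (inr S HX Y))"


section \<open>Iterative algebras and the rational monad\<close>

definition is_algebra ::
  "('o, 'm) cat \<Rightarrow> ('o, 'm, 'o, 'm) func \<Rightarrow> 'o \<Rightarrow> 'm \<Rightarrow> bool" where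
  "is_algebra C H A \<alpha> \<longleftrightarrow> A \<in> Ob C \<and> \<alpha> \<in> Hom C (FOb H A) A"

definition algebra_homs ::
  "('o, 'm) cat \<Rightarrow> ('o, 'm, 'o, 'm) func \<Rightarrow> 'o \<Rightarrow> 'm \<Rightarrow> 'o \<Rightarrow> 'm \<Rightarrow> 'm set" where
  "algebra_homs C H A \<alpha> B \<beta> = {h \<in> Hom C A B. h \<cdot>\<^bsub>C\<^esub> \<alpha> = \<beta> \<cdot>\<^bsub>C\<^esub> FAr H h}"

definition iterative_algebra ::
  "'k rel \<Rightarrow> ('o, 'm) cat \<Rightarrow> ('o, 'm, 'o, 'm) func \<Rightarrow> ('o, 'm) coproducts \<Rightarrow> 'o \<Rightarrow> 'm \<Rightarrow> bool" where
  "iterative_algebra \<kappa> C H S A \<alpha> \<longleftrightarrow> is_algebra C H A \<alpha> \<and>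
     (\<forall>e\<in>flat_equations \<kappa> C H S A. \<exists>!s. is_solution C H S A \<alpha> e s)"

definition free_iterative_algebra ::
  "'k rel \<Rightarrow> ('o, 'm) cat \<Rightarrow> ('o, 'm, 'o, 'm) func \<Rightarrow> ('o, 'm) coproducts \<Rightarrow>
   'o \<Rightarrow> 'o \<Rightarrow> 'm \<Rightarrow> 'm \<Rightarrow> bool" where
  "free_iterative_algebra \<kappa> C H S Y R \<rho> \<eta> \<longleftrightarrow>
     iterative_algebra \<kappa> C H S R \<rho> \<and> \<eta> \<in> Hom C Y R \<and>
     (\<forall>A \<alpha> f. iterative_algebra \<kappa> C H S A \<alpha> \<and> f \<in> Hom C Y A \<longrightarrow>
        (\<exists>!h. h \<in> algebra_homs C H R \<rho> A \<alpha> \<and> h \<cdot>\<^bsub>C\<^esub> \<eta> = f))"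

record ('o, 'm) monad =
  MFun :: "('o, 'm, 'o, 'm) func"
  unit :: "'o \<Rightarrow> 'm"
  mult :: "'o \<Rightarrow> 'm"

text \<open>
  \<open>M\<close> is the monad of the adjunction given by some choice of free iterative algebras
  \<open>(RY, \<rho> Y)\<close> with universal arrows \<open>\<eta> Y : Y \<rightarrow> RY\<close>: the left adjoint sends \<open>f : Y \<rightarrow> Z\<close> to
  the unique homomorphism \<open>Rf\<close> with \<open>Rf \<cdot> \<eta> Y = \<eta> Z \<cdot> f\<close>, and \<open>\<mu> Y\<close> is the counit at
  \<open>(RY, \<rho> Y)\<close>, that is, the unique homomorphism with \<open>\<mu> Y \<cdot> \<eta> (RY) = id\<close>.
\<close>

definition rational_monad ::
  "'k rel \<Rightarrow> ('o, 'm) cat \<Rightarrow> ('o, 'm, 'o, 'm) func \<Rightarrow> ('o, 'm) coproducts \<Rightarrow>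
   ('o, 'm) monad \<Rightarrow> bool" where
  "rational_monad \<kappa> C H S M \<longleftrightarrow>
     (let R = FOb (MFun M); Rar = FAr (MFun M); \<eta> = unit M; \<mu> = mult M in
      \<exists>\<rho>. (\<forall>Y\<in>Ob C. free_iterative_algebra \<kappa> C H S Y (R Y) (\<rho> Y) (\<eta> Y)) \<and>
          (\<forall>f\<in>Ar C. let Y = Dom C f; Z = Cod C f in
             Rar f \<in> algebra_homs C H (R Y) (\<rho> Y) (R Z) (\<rho> Z) \<and>
             Rar f \<cdot>\<^bsub>C\<^esub> \<eta> Y = \<eta> Z \<cdot>\<^bsub>C\<^esub> f) \<and>
          (\<forall>Y\<in>Ob C. \<mu> Y \<in> algebra_homs C H (R (R Y)) (\<rho> (R Y)) (R Y) (\<rho> Y) \<and>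
             \<mu> Y \<cdot>\<^bsub>C\<^esub> \<eta> (R Y) = Ident C (R Y)))"


section \<open>The categories of Elgot algebras and of Eilenberg--Moore algebras\<close>

text \<open>
  The category of \<open>C\<close>-objects with structure: \<open>U a\<close> is the carrier of the structured object
  \<open>a\<close>. Arrows carry their domain and codomain.
\<close>

definition structured_cat ::
  "('o, 'm) cat \<Rightarrow> 's set \<Rightarrow> ('s \<Rightarrow> 'o) \<Rightarrow> ('s \<Rightarrow> 'm \<Rightarrow> 's \<Rightarrow> bool) \<Rightarrow> ('s, 's \<times> 'm \<times> 's) cat" where
  "structured_cat C Obs U P =
    \<lparr>Ob = Obs,
     Ar = {(a, h, b). a \<in> Obs \<and> b \<in> Obs \<and> h \<in> Hom C (U a) (U b) \<and> P a h b},
     Dom = (\<lambda>(a, h, b). a),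
     Cod = (\<lambda>(a, h, b). b),
     Ident = (\<lambda>a. (a, Ident C (U a), a)),
     Cmp = (\<lambda>(_, g, c) (a, f, _). (a, g \<cdot>\<^bsub>C\<^esub> f, c))\<rparr>"

text \<open>
  The assignment \<open>d\<close> of solutions is a function on the finitary flat equation morphisms in
  \<open>A\<close>, hence the extensionality requirement.
\<close>

definition elgot_algebra ::
  "'k rel \<Rightarrow> ('o, 'm) cat \<Rightarrow> ('o, 'm, 'o, 'm) func \<Rightarrow> ('o, 'm) coproducts \<Rightarrow>
   'o \<Rightarrow> 'm \<Rightarrow> ('m \<Rightarrow> 'm) \<Rightarrow> bool" where
  "elgot_algebra \<kappa> C H S A \<alpha> d \<longleftrightarrow> is_algebra C H A \<alpha> \<and>
     d \<in> extensional (flat_equations \<kappa> C H S A) \<and>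
     (\<forall>e\<in>flat_equations \<kappa> C H S A. is_solution C H S A \<alpha> e (d e)) \<and>
     (\<forall>e\<in>flat_equations \<kappa> C H S A. \<forall>f\<in>flat_equations \<kappa> C H S A. \<forall>h\<in>Hom C (Dom C e) (Dom C f).
        cplus C S (FAr H h) (Ident C A) \<cdot>\<^bsub>C\<^esub> e = f \<cdot>\<^bsub>C\<^esub> h \<longrightarrow> d e = d f \<cdot>\<^bsub>C\<^esub> h) \<and>
     (\<forall>f\<in>flat_equations \<kappa> C H S A. \<forall>e\<in>flat_equations \<kappa> C H S (Dom C f).
        d (bullet C H S (d f) e) = d (oplus C H S A f e) \<cdot>\<^bsub>C\<^esub> inl S (Dom C e) (Dom C f))"

definition Elgot ::
  "'k rel \<Rightarrow> ('o, 'm) cat \<Rightarrow> ('o, 'm, 'o, 'm) func \<Rightarrow> ('o, 'm) coproducts \<Rightarrow>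
   ('o \<times> 'm \<times> ('m \<Rightarrow> 'm), ('o \<times> 'm \<times> ('m \<Rightarrow> 'm)) \<times> 'm \<times> ('o \<times> 'm \<times> ('m \<Rightarrow> 'm))) cat" where
  "Elgot \<kappa> C H S = structured_cat C
     {(A, \<alpha>, d). elgot_algebra \<kappa> C H S A \<alpha> d}
     (\<lambda>(A, \<alpha>, d). A)
     (\<lambda>(A, \<alpha>, d) h (B, \<beta>, d').
        \<forall>e\<in>flat_equations \<kappa> C H S A. h \<cdot>\<^bsub>C\<^esub> d e = d' (bullet C H S h e))"

definition Eilenberg_Moore ::
  "('o, 'm) cat \<Rightarrow> ('o, 'm) monad \<Rightarrow> ('o \<times> 'm, ('o \<times> 'm) \<times> 'm \<times> ('o \<times> 'm)) cat" where
  "Eilenberg_Moore C M = structured_cat C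
     {(A, a). A \<in> Ob C \<and> a \<in> Hom C (FOb (MFun M) A) A \<and>
        a \<cdot>\<^bsub>C\<^esub> unit M A = Ident C A \<and>
        a \<cdot>\<^bsub>C\<^esub> mult M A = a \<cdot>\<^bsub>C\<^esub> FAr (MFun M) a}
     (\<lambda>(A, a). A)
     (\<lambda>(A, a) h (B, b). h \<cdot>\<^bsub>C\<^esub> a = b \<cdot>\<^bsub>C\<^esub> FAr (MFun M) h)"

end

(* For a finitary functor H on a locally finitely presentable category, the equations
   e : X -> HX + Y with X finitely presentable are the coalgebras of the finitary functor
   H(-) + Y carried by finitely presentable objects. They form an essentially small filtered
   category, and the colimit R of their carriers is a fixpoint R = HR + Y: bijectivity of the
   structure is tested on maps out of finitely presentable objects, which factor through a stage
   of the colimit. The colimit injections are the only coalgebra morphisms into R, and every flat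
   equation in R factors as some g : X -> HX + Z followed by the injection of a stage
   e : Z -> HZ + Y, so e (+) g yields its unique solution; hence R is an iterative algebra. By functoriality the solutions in an Elgot algebra A
   of the equations with parameters in Y form a cocone, and compositionality makes the induced map
   R -> A solution-preserving. So R is a free Elgot algebra as well as a free iterative one.
   An Elgot algebra A corresponds to the Eilenberg-Moore algebra a : RA -> A extending the identity;
   conversely a sends the solutions in RA to solutions in A. *)
theory Submission
  imports Defs
begin

section \<open>Calculus in a category with binary coproducts\<close>

text \<open>Iterativity of R alone gives no map into an Elgot algebra A, since solutions in A are
  chosen rather than unique. Hence R is built explicitly as a colimit of equations, so that a map
  out of R can be prescribed by the chosen solutions. The rational monad, however, comes with an
  arbitrary choice of free iterative algebras, unrelated to this colimit; the universal property
  among Elgot algebras is therefore moved along comparison homomorphisms to the algebras of the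
  given monad. Two points of form matter. Morphisms of Elgot algebras are required to preserve
  solutions, not to be homomorphisms, so uniqueness of extensions is stated for all
  solution-preserving maps. And the equations in Y need not literally form a small category:
  carriers are restricted to a small set of representatives of the finitely presentable objects, one
  for each idempotent on a generator that splits through such an object. Solutions are then extended
  along isomorphisms to all equations. The resulting shape lives in its own type and is reindexed
  before cocompleteness, stated for shapes over \<open>'k\<close>, applies.\<close>

lemma Hom_iff: "f \<in> Hom C X Y \<longleftrightarrow> f \<in> Ar C \<and> Dom C f = X \<and> Cod C f = Y"
  by (simp add: Hom_def)

context category
begin

lemma Hom_Ob: "f \<in> Hom C X Y \<Longrightarrow> X \<in> Ob C" "f \<in> Hom C X Y \<Longrightarrow> Y \<in> Ob C"
  using Dom_Ob Cod_Ob by (auto simp: Hom_iff)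

lemma cmp_simps [simp]:
  assumes "f \<in> Ar C" "g \<in> Ar C" "Dom C g = Cod C f"
  shows "g \<cdot> f \<in> Ar C" "Dom C (g \<cdot> f) = Dom C f" "Cod C (g \<cdot> f) = Cod C g"
  using Cmp_Hom[of f "Dom C f" "Cod C f" g "Cod C g"] assms by (auto simp: Hom_iff)

lemma Ident_simps [simp]:
  assumes "X \<in> Ob C"
  shows "Ident C X \<in> Ar C" "Dom C (Ident C X) = X" "Cod C (Ident C X) = X"
  using Ident_Hom[OF assms] by (auto simp: Hom_iff)

lemma cmp_Ident_simps [simp]:
  "f \<in> Ar C \<Longrightarrow> Dom C f = X \<Longrightarrow> f \<cdot> Ident C X = f"
  "f \<in> Ar C \<Longrightarrow> Cod C f = X \<Longrightarrow> Ident C X \<cdot> f = f"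
  using Cmp_Ident Ident_Cmp by (auto simp: Hom_iff)

lemma cmp_assoc [simp]:
  "f \<in> Ar C \<Longrightarrow> g \<in> Ar C \<Longrightarrow> h \<in> Ar C \<Longrightarrow> Dom C g = Cod C f \<Longrightarrow> Dom C h = Cod C g \<Longrightarrow>
   (h \<cdot> g) \<cdot> f = h \<cdot> (g \<cdot> f)"
  by (rule Cmp_assoc) (auto simp: Hom_iff)

lemma Dom_Cod_Ob [simp]: "f \<in> Ar C \<Longrightarrow> Dom C f \<in> Ob C" "f \<in> Ar C \<Longrightarrow> Cod C f \<in> Ob C"
  using Dom_Ob Cod_Ob by auto

text \<open>Identities and associativity are those of \<open>C\<close>, so only closure of
  \<open>P\<close> under identities and composition remains. This serves coalgebras, Elgot algebras
  and Eilenberg-Moore algebras alike.\<close>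

lemma category_structured_cat:
  assumes "\<And>a. a \<in> Obs \<Longrightarrow> U a \<in> Ob C"
    and "\<And>a. a \<in> Obs \<Longrightarrow> P a (Ident C (U a)) a"
    and "\<And>a b c f g. a \<in> Obs \<Longrightarrow> b \<in> Obs \<Longrightarrow> c \<in> Obs \<Longrightarrow> f \<in> Hom C (U a) (U b) \<Longrightarrow>
           g \<in> Hom C (U b) (U c) \<Longrightarrow> P a f b \<Longrightarrow> P b g c \<Longrightarrow> P a (g \<cdot> f) c"
  shows "category (structured_cat C Obs U P)"
proof (unfold_locales, goal_cases)
  case (4 f X Y g Z)
  then show ?case
    using assms(3) by (auto simp: Hom_iff structured_cat_def)
qed (use assms(1,2) in \<open>auto simp: Hom_iff structured_cat_def\<close>)

end

locale coproduct_category = category C for C :: "('o, 'm) cat" (structure) +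
  fixes S :: "('o, 'm) coproducts"
  assumes binary_coproducts: "binary_coproducts C S"
begin

abbreviation copair_syntax (\<open>\<langle>_, _\<rangle>\<close>) where "\<langle>f, g\<rangle> \<equiv> copair C S f g"
text \<open>Here \<open>\<oplus>\<close> forms coproducts of objects; the operation on equations
  customarily written with this sign is \<open>flat_oplus\<close> below.\<close>

abbreviation cop_syntax (infixr \<open>\<oplus>\<close> 65) where "A \<oplus> B \<equiv> cop S A B"
abbreviation cplus_syntax (infixr \<open>\<boxplus>\<close> 75) where "f \<boxplus> g \<equiv> cplus C S f g"

lemma cop_simps [simp]:
  assumes "A \<in> Ob C" "B \<in> Ob C"
  shows "A \<oplus> B \<in> Ob C"
    "inl S A B \<in> Ar C" "Dom C (inl S A B) = A" "Cod C (inl S A B) = A \<oplus> B"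
    "inr S A B \<in> Ar C" "Dom C (inr S A B) = B" "Cod C (inr S A B) = A \<oplus> B"
  using binary_coproducts assms unfolding binary_coproducts_def by (auto simp: Hom_iff)

lemma copair_ex1:
  assumes "f \<in> Ar C" "g \<in> Ar C" "Cod C g = Cod C f"
  shows "\<exists>!h. h \<in> Hom C (Dom C f \<oplus> Dom C g) (Cod C f) \<and>
     h \<cdot> inl S (Dom C f) (Dom C g) = f \<and> h \<cdot> inr S (Dom C f) (Dom C g) = g"
proof -
  have "f \<in> Hom C (Dom C f) (Cod C f)" "g \<in> Hom C (Dom C g) (Cod C f)"
    using assms by (auto simp: Hom_iff)
  then show ?thesis
    using binary_coproducts Dom_Ob[OF assms(1)] Dom_Ob[OF assms(2)] Cod_Ob[OF assms(1)]
    unfolding binary_coproducts_def by blast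
qed

lemma copair_simps [simp]:
  assumes "f \<in> Ar C" "g \<in> Ar C" "Cod C g = Cod C f"
  shows "\<langle>f, g\<rangle> \<in> Ar C" "Dom C \<langle>f, g\<rangle> = Dom C f \<oplus> Dom C g" "Cod C \<langle>f, g\<rangle> = Cod C f"
    "Dom C f = A \<Longrightarrow> Dom C g = B \<Longrightarrow> \<langle>f, g\<rangle> \<cdot> inl S A B = f"
    "Dom C f = A \<Longrightarrow> Dom C g = B \<Longrightarrow> \<langle>f, g\<rangle> \<cdot> inr S A B = g"
  using theI'[OF copair_ex1[OF assms]] unfolding copair_def[symmetric]
  by (auto simp: Hom_iff)

text \<open>\<open>cmp_assoc\<close> nests composites to the right and so hides a copair followed by
  an injection whenever a tail \<open>k\<close> is present; the version with the tail restores the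
  computation.\<close>

lemma copair_inj_assoc [simp]:
  assumes "f \<in> Ar C" "g \<in> Ar C" "Cod C g = Cod C f" "Dom C f = A" "Dom C g = B" "k \<in> Ar C"
  shows "Cod C k = A \<Longrightarrow> \<langle>f, g\<rangle> \<cdot> (inl S A B \<cdot> k) = f \<cdot> k"
    "Cod C k = B \<Longrightarrow> \<langle>f, g\<rangle> \<cdot> (inr S A B \<cdot> k) = g \<cdot> k"
proof -
  have [simp]: "A \<in> Ob C" "B \<in> Ob C" using assms Dom_Ob by auto
  show "Cod C k = A \<Longrightarrow> \<langle>f, g\<rangle> \<cdot> (inl S A B \<cdot> k) = f \<cdot> k"
    using cmp_assoc[of k "inl S A B" "\<langle>f, g\<rangle>"] assms by (simp del: cmp_assoc)
  show "Cod C k = B \<Longrightarrow> \<langle>f, g\<rangle> \<cdot> (inr S A B \<cdot> k) = g \<cdot> k"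
    using cmp_assoc[of k "inr S A B" "\<langle>f, g\<rangle>"] assms by (simp del: cmp_assoc)
qed

lemma cop_eqI:
  assumes "h \<in> Hom C (A \<oplus> B) Z" "h' \<in> Hom C (A \<oplus> B) Z" "A \<in> Ob C" "B \<in> Ob C"
    and "h \<cdot> inl S A B = h' \<cdot> inl S A B" "h \<cdot> inr S A B = h' \<cdot> inr S A B"
  shows "h = h'"
proof -
  have "\<exists>!k. k \<in> Hom C (A \<oplus> B) Z \<and> k \<cdot> inl S A B = h \<cdot> inl S A B \<and> k \<cdot> inr S A B = h \<cdot> inr S A B"
    using copair_ex1[of "h \<cdot> inl S A B" "h \<cdot> inr S A B"] assms by (auto simp: Hom_iff)
  then show ?thesis using assms by metis
qed

lemma copair_eta [simp]:
  assumes "A \<in> Ob C" "B \<in> Ob C"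
  shows "h \<in> Ar C \<Longrightarrow> Dom C h = A \<oplus> B \<Longrightarrow> \<langle>h \<cdot> inl S A B, h \<cdot> inr S A B\<rangle> = h"
    "\<langle>inl S A B, inr S A B\<rangle> = Ident C (A \<oplus> B)"
  by (rule cop_eqI[of _ A B]; use assms in \<open>simp add: Hom_iff\<close>)+

text \<open>Pushing \<open>h\<close> into the copair, together with the eta rule above, brings maps
  out of a coproduct to the form of a copair of composites.\<close>

lemma cmp_copair [simp]:
  assumes "f \<in> Ar C" "g \<in> Ar C" "Cod C g = Cod C f" "h \<in> Ar C" "Dom C h = Cod C f"
  shows "h \<cdot> \<langle>f, g\<rangle> = \<langle>h \<cdot> f, h \<cdot> g\<rangle>"
    "k \<in> Ar C \<Longrightarrow> Cod C k = Dom C f \<oplus> Dom C g \<Longrightarrow> h \<cdot> (\<langle>f, g\<rangle> \<cdot> k) = \<langle>h \<cdot> f, h \<cdot> g\<rangle> \<cdot> k"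
proof -
  show *: "h \<cdot> \<langle>f, g\<rangle> = \<langle>h \<cdot> f, h \<cdot> g\<rangle>"
    by (rule cop_eqI[of _ "Dom C f" "Dom C g" "Cod C h"]) (use assms in \<open>simp_all add: Hom_iff\<close>)
  show "k \<in> Ar C \<Longrightarrow> Cod C k = Dom C f \<oplus> Dom C g \<Longrightarrow> h \<cdot> (\<langle>f, g\<rangle> \<cdot> k) = \<langle>h \<cdot> f, h \<cdot> g\<rangle> \<cdot> k"
    using cmp_assoc[of k "\<langle>f, g\<rangle>" h] assms by (simp add: * del: cmp_assoc)
qed

lemma cplus_simps [simp]:
  assumes "f \<in> Ar C" "g \<in> Ar C"
  shows "f \<boxplus> g \<in> Ar C" "Dom C (f \<boxplus> g) = Dom C f \<oplus> Dom C g" "Cod C (f \<boxplus> g) = Cod C f \<oplus> Cod C g"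
  using assms by (simp_all add: cplus_def)

end

lemma is_functorD:
  assumes "is_functor C D F"
  shows "category C" "category D"
    "X \<in> Ob C \<Longrightarrow> FOb F X \<in> Ob D"
    "f \<in> Ar C \<Longrightarrow> FAr F f \<in> Ar D"
    "f \<in> Ar C \<Longrightarrow> Dom D (FAr F f) = FOb F (Dom C f)"
    "f \<in> Ar C \<Longrightarrow> Cod D (FAr F f) = FOb F (Cod C f)"
    "X \<in> Ob C \<Longrightarrow> FAr F (Ident C X) = Ident D (FOb F X)"
    "f \<in> Ar C \<Longrightarrow> g \<in> Ar C \<Longrightarrow> Dom C g = Cod C f \<Longrightarrow>
       FAr F (g \<cdot>\<^bsub>C\<^esub> f) = FAr F g \<cdot>\<^bsub>D\<^esub> FAr F f"
  using assms unfolding is_functor_def by (auto simp: Hom_iff)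

lemma is_functor_func_comp:
  assumes "is_functor C D F" "is_functor D E G"
  shows "is_functor C E (func_comp G F)"
  unfolding is_functor_def
  using is_functorD[OF assms(1)] is_functorD[OF assms(2)] by (auto simp: func_comp_def Hom_iff)

lemma func_comp_simps [simp]:
  "FOb (func_comp G F) X = FOb G (FOb F X)" "FAr (func_comp G F) f = FAr G (FAr F f)"
  by (simp_all add: func_comp_def)

section \<open>Small shapes\<close>

lemma small_subset: "small \<kappa> B \<Longrightarrow> A \<subseteq> B \<Longrightarrow> small \<kappa> A"
  unfolding small_def using card_of_mono1 ordLeq_ordLess_trans by blast

lemma small_image: "small \<kappa> A \<Longrightarrow> small \<kappa> (f ` A)"
  unfolding small_def using card_of_image ordLeq_ordLess_trans by blast

lemma small_inj_on: "small \<kappa> (f ` A) \<Longrightarrow> inj_on f A \<Longrightarrow> small \<kappa> A"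
  using small_image[of \<kappa> "f ` A" "inv_into A f"] by (simp add: image_image)

text \<open>Regularity of \<open>\<kappa>\<close> enters here; the infinity of
  \<open>\<kappa>\<close> that the cardinal bound also asks for follows from
  \<open>natLeq <o \<kappa>\<close>.\<close>

lemma small_UN:
  assumes "uncountable_regular \<kappa>" "small \<kappa> I" "\<And>i. i \<in> I \<Longrightarrow> small \<kappa> (A i)"
  shows "small \<kappa> (\<Union>i\<in>I. A i)"
proof -
  have "Cinfinite \<kappa>"
    using assms(1) unfolding uncountable_regular_def cinfinite_def
    by (metis Field_natLeq card_of_Field_ordIso card_of_ordLeq_finite infinite_UNIV_nat
        natLeq_Card_order ordIso_iff_ordLeq ordLeq_transitive ordLess_imp_ordLeq)
  then show ?thesis
    using assms regularCard_UNION_bound[of \<kappa> I A] unfolding uncountable_regular_def small_def by blast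
qed

lemma small_finite:
  assumes "uncountable_regular \<kappa>" "finite A"
  shows "small \<kappa> A"
proof -
  have "|A| <o natLeq"
    using assms(2) by (simp add: finite_iff_ordLess_natLeq)
  then show ?thesis
    using assms(1) ordLess_transitive unfolding small_def uncountable_regular_def by blast
qed

lemma small_into_Field:
  fixes \<kappa> :: "'k rel"
  assumes "uncountable_regular \<kappa>" "small \<kappa> A"
  obtains f :: "'a \<Rightarrow> 'k" where "inj_on f A"
proof -
  have "|A| \<le>o \<kappa>"
    using assms(2) ordLess_imp_ordLeq unfolding small_def by blast
  moreover have "\<kappa> =o |Field \<kappa>|"
    using assms(1) card_of_Field_ordIso ordIso_symmetric unfolding uncountable_regular_def by blast
  ultimately have "|A| \<le>o |Field \<kappa>|"
    by (rule ordLeq_ordIso_trans)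
  then obtain f where "inj_on f A" "f ` A \<subseteq> Field \<kappa>"
    unfolding card_of_ordLeq[symmetric] by blast
  then show ?thesis using that by blast
qed

text \<open>Cocones and colimits only see a shape through its graph, so a graph isomorphism suffices to
  reindex them.\<close>

definition reindexing :: "('i, 'j) cat \<Rightarrow> ('p, 'q) cat \<Rightarrow> ('i, 'j, 'p, 'q) func \<Rightarrow> bool" where
  "reindexing J' J F \<longleftrightarrow> is_functor J' J F \<and> bij_betw (FOb F) (Ob J') (Ob J) \<and>
     bij_betw (FAr F) (Ar J') (Ar J)"

text \<open>The structure is transported along injections of objects and arrows into
  \<open>'k\<close>. This is the bridge from the shapes that occur in the proof, for instance those
  whose objects are morphisms of \<open>C\<close>, to the shapes over \<open>'k\<close> for which
  cocompleteness and finitarity are defined.\<close>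

lemma small_reindexing:
  fixes \<kappa> :: "'k rel" and J :: "('i, 'j) cat"
  assumes \<kappa>: "uncountable_regular \<kappa>" and J: "small_category \<kappa> J"
  obtains J' :: "('k, 'k) cat" and F where "small_category \<kappa> J'" "reindexing J' J F"
    "filtered J \<Longrightarrow> filtered J'"
proof -
  obtain f :: "'i \<Rightarrow> 'k" where f: "inj_on f (Ob J)"
    using J small_into_Field[OF \<kappa>, of "Ob J"] by (auto simp: small_category_def)
  obtain g :: "'j \<Rightarrow> 'k" where g: "inj_on g (Ar J)"
    using J small_into_Field[OF \<kappa>, of "Ar J"] by (auto simp: small_category_def)
  note inj = f g
  interpret J: category J using J by (simp add: small_category_def)
  let ?p = "inv_into (Ob J) f" and ?q = "inv_into (Ar J) g"
  define J' :: "('k, 'k) cat" where "J' = \<lparr>Ob = f ` Ob J, Ar = g ` Ar J,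
    Dom = (\<lambda>u. f (Dom J (?q u))), Cod = (\<lambda>u. f (Cod J (?q u))), Ident = (\<lambda>X. g (Ident J (?p X))),
    Cmp = (\<lambda>v u. g (?q v \<cdot>\<^bsub>J\<^esub> ?q u))\<rparr>"
  define F where "F = \<lparr>FOb = ?p, FAr = ?q\<rparr>"
  note inv [simp] = inv_into_f_f[OF inj(1)] inv_into_f_f[OF inj(2)]
    and eq [simp] = inj_on_eq_iff[OF inj(1)] inj_on_eq_iff[OF inj(2)]
  have cat: "category J'"
    by unfold_locales (simp_all add: J'_def Hom_iff image_iff, safe, simp_all)
  have "small_category \<kappa> J'"
    using J cat by (auto simp: small_category_def J'_def small_image)
  moreover have "reindexing J' J F"
  proof -
    have "bij_betw ?p (f ` Ob J) (Ob J)" "bij_betw ?q (g ` Ar J) (Ar J)"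
      using inj by (simp_all add: bij_betw_inv_into inj_on_imp_bij_betw)
    moreover have "is_functor J' J F"
      unfolding is_functor_def using cat J.category_axioms by (simp add: J'_def F_def Hom_iff)
    ultimately show ?thesis by (simp add: reindexing_def J'_def F_def)
  qed
  moreover have "filtered J'" if "filtered J"
  proof -
    have 1: "Ob J \<noteq> {}" using that by (simp add: filtered_def)
    have 2: "\<exists>k\<in>Ob J. Hom J i k \<noteq> {} \<and> Hom J j k \<noteq> {}" if "i \<in> Ob J" "j \<in> Ob J" for i j
      using that \<open>filtered J\<close> by (simp add: filtered_def)
    have 3: "\<exists>w\<in>Ar J. Dom J w = Cod J u \<and> w \<cdot>\<^bsub>J\<^esub> u = w \<cdot>\<^bsub>J\<^esub> v"
      if "u \<in> Ar J" "v \<in> Ar J" "Dom J u = Dom J v" "Cod J u = Cod J v" for u v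
      using that \<open>filtered J\<close> by (simp add: filtered_def)
    have H: "Hom J' (f i) (f k) \<noteq> {}" if ne: "Hom J i k \<noteq> {}" for i k
    proof -
      obtain u where "u \<in> Hom J i k" using ne by blast
      then have "g u \<in> Hom J' (f i) (f k)" by (auto simp: J'_def Hom_iff)
      then show ?thesis by blast
    qed
    have "\<exists>k\<in>Ob J'. Hom J' i k \<noteq> {} \<and> Hom J' j k \<noteq> {}" if "i \<in> Ob J'" "j \<in> Ob J'" for i j
    proof -
      from that obtain i' j' where *: "i' \<in> Ob J" "j' \<in> Ob J" "i = f i'" "j = f j'"
        by (auto simp: J'_def)
      from 2[OF *(1,2)] obtain k where "k \<in> Ob J" "Hom J i' k \<noteq> {}" "Hom J j' k \<noteq> {}" by blast
      then show ?thesis using H * by (intro bexI[of _ "f k"]) (auto simp: J'_def)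
    qed
    moreover have "\<exists>w\<in>Ar J'. Dom J' w = Cod J' u \<and> w \<cdot>\<^bsub>J'\<^esub> u = w \<cdot>\<^bsub>J'\<^esub> v"
      if "u \<in> Ar J'" "v \<in> Ar J'" "Dom J' u = Dom J' v" "Cod J' u = Cod J' v" for u v
    proof -
      from that obtain u' v' where *: "u' \<in> Ar J" "v' \<in> Ar J" "u = g u'" "v = g v'"
        by (auto simp: J'_def)
      then have "Dom J u' = Dom J v'" "Cod J u' = Cod J v'" using that by (auto simp: J'_def)
      from 3[OF *(1,2) this] obtain w where "w \<in> Ar J" "Dom J w = Cod J u'" "w \<cdot>\<^bsub>J\<^esub> u' = w \<cdot>\<^bsub>J\<^esub> v'"
        by blast
      then show ?thesis using * by (intro bexI[of _ "g w"]) (auto simp: J'_def)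
    qed
    ultimately show ?thesis using 1 unfolding filtered_def by (auto simp: J'_def)
  qed
  ultimately show ?thesis using that by blast
qed

lemma is_cocone_cong:
  assumes "category J" "\<And>i. i \<in> Ob J \<Longrightarrow> c i = c' i"
  shows "is_cocone J C D L c \<longleftrightarrow> is_cocone J C D L c'"
  using assms category.Dom_Ob[OF assms(1)] category.Cod_Ob[OF assms(1)] by (auto simp: is_cocone_def)

lemma is_colimit_cong:
  assumes "category J" "\<And>i. i \<in> Ob J \<Longrightarrow> c i = c' i"
  shows "is_colimit J C D L c \<longleftrightarrow> is_colimit J C D L c'"
proof -
  have "is_cocone J C D L c \<longleftrightarrow> is_cocone J C D L c'" by (rule is_cocone_cong[OF assms])
  then show ?thesis using assms(2) unfolding is_colimit_def by simp
qed

lemma is_cocone_reindexing: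
  assumes "reindexing J' J F"
  shows "is_cocone J' C (func_comp D F) L (c \<circ> FOb F) \<longleftrightarrow> is_cocone J C D L c"
proof -
  have "Ob J = FOb F ` Ob J'" "Ar J = FAr F ` Ar J'" "is_functor J' J F"
    using assms by (auto simp: reindexing_def bij_betw_def)
  then show ?thesis
    using is_functorD(5,6)[of J' J F] by (simp add: is_cocone_def)
qed

lemma is_colimit_reindexing:
  assumes F: "reindexing J' J F"
  shows "is_colimit J' C (func_comp D F) L (c \<circ> FOb F) \<longleftrightarrow> is_colimit J C D L c"
proof -
  have J': "category J'" and Ob: "Ob J = FOb F ` Ob J'" and inj: "inj_on (FOb F) (Ob J')"
    using F is_functorD(1) by (auto simp: reindexing_def bij_betw_def)
  have *: "(\<forall>c'. is_cocone J' C (func_comp D F) L' c' \<longrightarrow>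
        (\<exists>!h. h \<in> Hom C L L' \<and> (\<forall>i\<in>Ob J'. h \<cdot>\<^bsub>C\<^esub> (c \<circ> FOb F) i = c' i))) \<longleftrightarrow>
     (\<forall>c'. is_cocone J C D L' c' \<longrightarrow>
        (\<exists>!h. h \<in> Hom C L L' \<and> (\<forall>i\<in>Ob J. h \<cdot>\<^bsub>C\<^esub> c i = c' i)))" (is "?A \<longleftrightarrow> ?B") for L'
  proof
    assume A: ?A
    show ?B
    proof (intro allI impI)
      fix c' assume "is_cocone J C D L' c'"
      then have "is_cocone J' C (func_comp D F) L' (c' \<circ> FOb F)"
        by (simp add: is_cocone_reindexing[OF F])
      from A[rule_format, OF this] show "\<exists>!h. h \<in> Hom C L L' \<and> (\<forall>i\<in>Ob J. h \<cdot>\<^bsub>C\<^esub> c i = c' i)"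
        by (simp add: Ob)
    qed
  next
    assume B: ?B
    show ?A
    proof (intro allI impI)
      fix c' assume c': "is_cocone J' C (func_comp D F) L' c'"
      \<comment> \<open>The cocone is carried over to \<open>J\<close> by the inverse of the
        bijection on objects. It matches \<open>c'\<close> only on \<open>Ob J'\<close>, whence the
        appeal to \<open>is_cocone_cong\<close>.\<close>
      define c'' where "c'' = c' \<circ> inv_into (Ob J') (FOb F)"
      have eq: "(c'' \<circ> FOb F) i = c' i" if "i \<in> Ob J'" for i
        using that inj by (simp add: c''_def)
      have "is_cocone J C D L' c''"
        proof -
        have "is_cocone J' C (func_comp D F) L' (c'' \<circ> FOb F)"
          by (rule iffD2[OF is_cocone_cong[OF J' eq] c'])
        then show ?thesis by (simp only: is_cocone_reindexing[OF F])
      qed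
      from B[rule_format, OF this] show "\<exists>!h. h \<in> Hom C L L' \<and> (\<forall>i\<in>Ob J'. h \<cdot>\<^bsub>C\<^esub> (c \<circ> FOb F) i = c' i)"
        using eq by (simp add: Ob)
    qed
  qed
  show ?thesis
    unfolding is_colimit_def is_cocone_reindexing[OF F] by (simp only: *)
qed

lemma cocomplete_colimit:
  fixes \<kappa> :: "'k rel"
  assumes "uncountable_regular \<kappa>" "cocomplete \<kappa> C" "small_category \<kappa> J" "is_functor J C D"
  obtains L c where "is_colimit J C D L c"
proof -
  obtain J' :: "('k, 'k) cat" and F where J': "small_category \<kappa> J'" "reindexing J' J F"
    using small_reindexing[OF assms(1,3)] by blast
  then have "is_functor J' C (func_comp D F)"
    using assms(4) is_functor_func_comp by (auto simp: reindexing_def)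
  then obtain L c where L: "is_colimit J' C (func_comp D F) L c"
    using assms(2) J'(1) unfolding cocomplete_def by blast
  let ?c = "c \<circ> inv_into (Ob J') (FOb F)"
  have inj: "inj_on (FOb F) (Ob J')" and cat: "category J'"
    using J' by (auto simp: reindexing_def bij_betw_def small_category_def)
  have eq: "(?c \<circ> FOb F) i = c i" if "i \<in> Ob J'" for i using that inj by simp
  have "is_colimit J' C (func_comp D F) L (?c \<circ> FOb F)"
    by (rule iffD2[OF is_colimit_cong[OF cat eq] L])
  then show ?thesis by (intro that) (simp only: is_colimit_reindexing[OF J'(2)])
qed

lemma finitaryD:
  fixes \<kappa> :: "'k rel" and J :: "('k, 'k) cat"
  assumes "finitary \<kappa> C D F" "small_category \<kappa> J" "filtered J"
    "is_functor J C E" "is_colimit J C E L c"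
  shows "is_colimit J D (func_comp F E) (FOb F L) (\<lambda>i. FAr F (c i))"
  using assms(1)[unfolded finitary_def, THEN conjunct2, rule_format, of J E L c] assms(2-) by simp

lemma finitary_colimit:
  fixes \<kappa> :: "'k rel"
  assumes "uncountable_regular \<kappa>" "finitary \<kappa> C D F" "small_category \<kappa> J" "filtered J"
    "is_functor J C E" "is_colimit J C E L c"
  shows "is_colimit J D (func_comp F E) (FOb F L) (\<lambda>i. FAr F (c i))"
proof -
  obtain J' :: "('k, 'k) cat" and K where J': "small_category \<kappa> J'" "reindexing J' J K" "filtered J'"
    using small_reindexing[OF assms(1,3)] assms(4) by blast
  then have "is_functor J' C (func_comp E K)"
    using assms(5) is_functor_func_comp by (auto simp: reindexing_def)
  moreover have "is_colimit J' C (func_comp E K) L (c \<circ> FOb K)"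
    using assms(6) by (simp only: is_colimit_reindexing[OF J'(2)])
  ultimately have "is_colimit J' D (func_comp F (func_comp E K)) (FOb F L) (\<lambda>i. FAr F ((c \<circ> FOb K) i))"
    by (rule finitaryD[OF assms(2) J'(1,3)])
  then have "is_colimit J' D (func_comp (func_comp F E) K) (FOb F L) ((\<lambda>i. FAr F (c i)) \<circ> FOb K)"
    by (simp add: func_comp_def comp_def)
  then show ?thesis by (simp only: is_colimit_reindexing[OF J'(2)])
qed

section \<open>Filtered colimits of sets and of hom-sets\<close>

lemma filtered_upper_bound:
  assumes "filtered J" "i \<in> Ob J" "j \<in> Ob J"
  obtains u v where "u \<in> Ar J" "v \<in> Ar J" "Dom J u = i" "Dom J v = j" "Cod J v = Cod J u"
proof -
  obtain k where "Hom J i k \<noteq> {}" "Hom J j k \<noteq> {}"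
    using assms unfolding filtered_def by blast
  then obtain u v where "u \<in> Hom J i k" "v \<in> Hom J j k" by blast
  then show ?thesis using that by (auto simp: Hom_iff)
qed

lemma filtered_coequalize:
  assumes "filtered J" "u \<in> Ar J" "v \<in> Ar J" "Dom J u = Dom J v" "Cod J u = Cod J v"
  obtains w where "w \<in> Ar J" "Dom J w = Cod J u" "w \<cdot>\<^bsub>J\<^esub> u = w \<cdot>\<^bsub>J\<^esub> v"
  using assms unfolding filtered_def by blast

text \<open>An upper bound of the two targets gives a parallel pair out of the common source;
  coequalizing that pair makes the square commute.\<close>

lemma filtered_complete_span:
  assumes "category J" "filtered J" "u \<in> Ar J" "v \<in> Ar J" "Dom J u = Dom J v"
  obtains u' v' where "u' \<in> Ar J" "v' \<in> Ar J" "Dom J u' = Cod J u" "Dom J v' = Cod J v"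
    "Cod J v' = Cod J u'" "u' \<cdot>\<^bsub>J\<^esub> u = v' \<cdot>\<^bsub>J\<^esub> v"
proof -
  interpret J: category J by fact
  obtain a b where ab: "a \<in> Ar J" "b \<in> Ar J" "Dom J a = Cod J u" "Dom J b = Cod J v" "Cod J b = Cod J a"
    using filtered_upper_bound[OF assms(2), of "Cod J u" "Cod J v"] assms(3,4) by auto
  obtain w where "w \<in> Ar J" "Dom J w = Cod J a" "w \<cdot>\<^bsub>J\<^esub> (a \<cdot>\<^bsub>J\<^esub> u) = w \<cdot>\<^bsub>J\<^esub> (b \<cdot>\<^bsub>J\<^esub> v)"
    using filtered_coequalize[OF assms(2), of "a \<cdot>\<^bsub>J\<^esub> u" "b \<cdot>\<^bsub>J\<^esub> v"] assms(3-5) ab by auto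
  then show ?thesis
    using that[of "w \<cdot>\<^bsub>J\<^esub> a" "w \<cdot>\<^bsub>J\<^esub> b"] ab assms(3-5) by simp
qed

lemma is_coconeD:
  assumes "is_cocone J C D L c"
  shows "L \<in> Ob C" "i \<in> Ob J \<Longrightarrow> c i \<in> Ar C" "i \<in> Ob J \<Longrightarrow> Dom C (c i) = FOb D i"
    "i \<in> Ob J \<Longrightarrow> Cod C (c i) = L" "u \<in> Ar J \<Longrightarrow> c (Cod J u) \<cdot>\<^bsub>C\<^esub> FAr D u = c (Dom J u)"
  using assms unfolding is_cocone_def by (auto simp: Hom_iff)

lemma is_colimit_cocone: "is_colimit J C D L c \<Longrightarrow> is_cocone J C D L c"
  by (simp add: is_colimit_def)

lemma is_colimit_ex1:
  assumes "is_colimit J C D L c" "is_cocone J C D L' c'"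
  shows "\<exists>!h. h \<in> Hom C L L' \<and> (\<forall>i\<in>Ob J. h \<cdot>\<^bsub>C\<^esub> c i = c' i)"
  using assms unfolding is_colimit_def by blast

lemma is_cocone_cmp:
  assumes "category C" "is_functor J C D" "is_cocone J C D L c" "h \<in> Hom C L L'"
  shows "is_cocone J C D L' (\<lambda>i. h \<cdot>\<^bsub>C\<^esub> c i)"
proof -
  interpret C: category C by fact
  interpret J: category J using assms(2) by (rule is_functorD)
  show ?thesis
    unfolding is_cocone_def using is_coconeD[OF assms(3)] is_functorD[OF assms(2)] assms(4) C.Hom_Ob(2)[OF assms(4)]
    by (auto simp: Hom_iff)
qed

lemma is_colimit_eqI:
  assumes "category C" "is_functor J C D" "is_colimit J C D L c"
    "h \<in> Hom C L L'" "h' \<in> Hom C L L'" "\<And>i. i \<in> Ob J \<Longrightarrow> h \<cdot>\<^bsub>C\<^esub> c i = h' \<cdot>\<^bsub>C\<^esub> c i"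
  shows "h = h'"
proof -
  have "\<exists>!k. k \<in> Hom C L L' \<and> (\<forall>i\<in>Ob J. k \<cdot>\<^bsub>C\<^esub> c i = h' \<cdot>\<^bsub>C\<^esub> c i)"
    using is_colimit_ex1[OF assms(3) is_cocone_cmp[OF assms(1,2) is_colimit_cocone[OF assms(3)] assms(5)]] .
  then show ?thesis using assms(4-6) by blast
qed

section \<open>Evaluation and extensionality for arrows between sets\<close>

definition ap :: "'a set_arrow \<Rightarrow> 'a \<Rightarrow> 'a" where
  "ap a = fst (snd a)"

definition set_fun :: "'a set \<Rightarrow> ('a \<Rightarrow> 'a) \<Rightarrow> 'a set \<Rightarrow> 'a set_arrow" where
  "set_fun A f B = (A, restrict f A, B)"

lemma Hom_Set_cat: "a \<in> Hom Set_cat A B \<longleftrightarrow> (\<exists>f. a = (A, f, B) \<and> f \<in> A \<rightarrow>\<^sub>E B)"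
  by (cases a) (auto simp: Hom_iff Set_cat_def)

lemma Set_cat_simps [simp]:
  "Ob Set_cat = UNIV" "Ident Set_cat A = (A, restrict id A, A)"
  "(Y', g, Z) \<cdot>\<^bsub>Set_cat\<^esub> (X, f, Y) = (X, restrict (g \<circ> f) X, Z)"
  by (simp_all add: Set_cat_def)

lemma ap_in: "a \<in> Hom Set_cat A B \<Longrightarrow> x \<in> A \<Longrightarrow> ap a x \<in> B"
  by (auto simp: Hom_Set_cat ap_def)

lemma ap_Cmp: "a \<in> Hom Set_cat A B \<Longrightarrow> b \<in> Hom Set_cat B B' \<Longrightarrow> x \<in> A \<Longrightarrow>
    ap (b \<cdot>\<^bsub>Set_cat\<^esub> a) x = ap b (ap a x)"
  by (auto simp: Hom_Set_cat ap_def)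

lemma ap_Ident [simp]: "x \<in> A \<Longrightarrow> ap (A, restrict id A, A) x = x"
  by (auto simp: ap_def)

lemma set_arrow_eqI:
  assumes "a \<in> Hom Set_cat A B" "b \<in> Hom Set_cat A B" "\<And>x. x \<in> A \<Longrightarrow> ap a x = ap b x"
  shows "a = b"
proof -
  obtain f g where "a = (A, f, B)" "b = (A, g, B)" "f \<in> A \<rightarrow>\<^sub>E B" "g \<in> A \<rightarrow>\<^sub>E B"
    using assms(1,2) by (auto simp: Hom_Set_cat)
  then show ?thesis using assms(3) PiE_ext[of f A "\<lambda>_. B" g] by (simp add: ap_def)
qed

lemma set_fun_Hom: "(\<And>x. x \<in> A \<Longrightarrow> f x \<in> B) \<Longrightarrow> set_fun A f B \<in> Hom Set_cat A B"
  by (auto simp: Hom_Set_cat set_fun_def)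

lemma ap_set_fun [simp]: "x \<in> A \<Longrightarrow> ap (set_fun A f B) x = f x"
  by (simp add: ap_def set_fun_def)

lemma category_Set_cat: "category Set_cat"
proof
  fix f g h :: "'a set_arrow" and W X Y Z
  assume "f \<in> Hom Set_cat X Y" "g \<in> Hom Set_cat Y Z"
  then show "g \<cdot>\<^bsub>Set_cat\<^esub> f \<in> Hom Set_cat X Z"
    by (auto simp: Hom_Set_cat PiE_iff)
next
  fix f :: "'a set_arrow" and X Y
  assume f: "f \<in> Hom Set_cat X Y"
  then obtain f' where f': "f = (X, f', Y)" "f' \<in> X \<rightarrow>\<^sub>E Y" by (auto simp: Hom_Set_cat)
  show "f \<cdot>\<^bsub>Set_cat\<^esub> Ident Set_cat X = f"
    using f' by (simp add: fun_eq_iff PiE_iff extensional_def)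
  show "Ident Set_cat Y \<cdot>\<^bsub>Set_cat\<^esub> f = f"
    using f' by (simp add: fun_eq_iff PiE_iff extensional_def)
next
  fix f g h :: "'a set_arrow" and W X Y Z
  assume "f \<in> Hom Set_cat W X" "g \<in> Hom Set_cat X Y" "h \<in> Hom Set_cat Y Z"
  then show "(h \<cdot>\<^bsub>Set_cat\<^esub> g) \<cdot>\<^bsub>Set_cat\<^esub> f = h \<cdot>\<^bsub>Set_cat\<^esub> (g \<cdot>\<^bsub>Set_cat\<^esub> f)"
    by (auto simp: Hom_Set_cat fun_eq_iff)
next
  fix A :: "'a set"
  show "Ident Set_cat A \<in> Hom Set_cat A A" by (auto simp: Hom_Set_cat)
qed (auto simp: Set_cat_def)

lemma is_functor_Hom: "is_functor C D F \<Longrightarrow> f \<in> Ar C \<Longrightarrow> FAr F f \<in> Hom D (FOb F (Dom C f)) (FOb F (Cod C f))"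
  by (simp add: is_functor_def)

context
  fixes J :: "('i, 'j) cat" and E :: "('i, 'j, 'a set, 'a set_arrow) func"
  assumes E: "is_functor J Set_cat E" and filtered: "filtered J"
begin

interpretation J: category J using E by (rule is_functorD)

lemma ap_functor_Cmp:
  assumes "u \<in> Ar J" "v \<in> Ar J" "Dom J v = Cod J u" "x \<in> FOb E (Dom J u)"
  shows "ap (FAr E (v \<cdot>\<^bsub>J\<^esub> u)) x = ap (FAr E v) (ap (FAr E u) x)"
  using assms is_functorD(8)[OF E assms(1,2,3)] ap_Cmp[OF is_functor_Hom[OF E assms(1)]]
    is_functor_Hom[OF E assms(2)] by simp

lemma ap_functor_in: "u \<in> Ar J \<Longrightarrow> x \<in> FOb E (Dom J u) \<Longrightarrow> ap (FAr E u) x \<in> FOb E (Cod J u)"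
  using ap_in[OF is_functor_Hom[OF E]] .

lemma ap_cocone:
  assumes "is_cocone J Set_cat E L c" "u \<in> Ar J" "x \<in> FOb E (Dom J u)"
  shows "ap (c (Cod J u)) (ap (FAr E u) x) = ap (c (Dom J u)) x"
proof -
  have "c (Cod J u) \<in> Hom Set_cat (FOb E (Cod J u)) L"
    using assms(1,2) unfolding is_cocone_def by auto
  from ap_Cmp[OF is_functor_Hom[OF E assms(2)] this assms(3)] show ?thesis
    using is_coconeD(5)[OF assms(1,2)] by simp
qed

text \<open>The images of the stages form a subset \<open>U\<close> of \<open>L\<close>, and the
  cocone corestricts to \<open>U\<close>. The induced map from \<open>L\<close> to \<open>U\<close>,
  followed by the inclusion, agrees with the identity on all legs and hence is the identity, so
  \<open>U\<close> is all of \<open>L\<close>.\<close>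

lemma set_colimit_surjective:
  assumes colim: "is_colimit J Set_cat E L c" and y: "y \<in> L"
  shows "\<exists>i\<in>Ob J. \<exists>x\<in>FOb E i. ap (c i) x = y"
proof -
  note cocone = is_colimit_cocone[OF colim]
  have c: "c i \<in> Hom Set_cat (FOb E i) L" if "i \<in> Ob J" for i
    using cocone that unfolding is_cocone_def by auto
  define U where "U = {ap (c i) x |i x. i \<in> Ob J \<and> x \<in> FOb E i}"
  have UL: "U \<subseteq> L" using ap_in[OF c] by (auto simp: U_def)
  define c' where "c' i = set_fun (FOb E i) (ap (c i)) U" for i
  have c': "c' i \<in> Hom Set_cat (FOb E i) U" if "i \<in> Ob J" for i
    unfolding c'_def using that by (intro set_fun_Hom) (auto simp: U_def)
  have "is_cocone J Set_cat E U c'"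
    unfolding is_cocone_def
  proof (intro conjI ballI)
    fix u assume u: "u \<in> Ar J"
    show "c' (Cod J u) \<cdot>\<^bsub>Set_cat\<^esub> FAr E u = c' (Dom J u)"
    proof (rule set_arrow_eqI)
      show "c' (Cod J u) \<cdot>\<^bsub>Set_cat\<^esub> FAr E u \<in> Hom Set_cat (FOb E (Dom J u)) U"
        using category.Cmp_Hom[OF category_Set_cat is_functor_Hom[OF E u] c'] u by simp
      show "c' (Dom J u) \<in> Hom Set_cat (FOb E (Dom J u)) U" using c' u by simp
      show "ap (c' (Cod J u) \<cdot>\<^bsub>Set_cat\<^esub> FAr E u) x = ap (c' (Dom J u)) x" if "x \<in> FOb E (Dom J u)" for x
        using ap_Cmp[OF is_functor_Hom[OF E u] c' that] u that ap_functor_in[OF u that]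
          ap_cocone[OF cocone u that] by (simp add: c'_def)
    qed
  qed (use c' in auto)
  from is_colimit_ex1[OF colim this] obtain h where h: "h \<in> Hom Set_cat L U"
    "\<And>i. i \<in> Ob J \<Longrightarrow> h \<cdot>\<^bsub>Set_cat\<^esub> c i = c' i" by auto
  define k where "k = set_fun L (ap h) L"
  have k: "k \<in> Hom Set_cat L L"
    unfolding k_def using ap_in[OF h(1)] UL by (intro set_fun_Hom) auto
  have "k = Ident Set_cat L"
  proof (rule is_colimit_eqI[OF category_Set_cat E colim k])
    show id: "Ident Set_cat L \<in> Hom Set_cat L L"
      using category.Ident_Hom[OF category_Set_cat] by auto
    fix i assume i: "i \<in> Ob J"
    show "k \<cdot>\<^bsub>Set_cat\<^esub> c i = Ident Set_cat L \<cdot>\<^bsub>Set_cat\<^esub> c i"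
    proof (rule set_arrow_eqI)
      show "k \<cdot>\<^bsub>Set_cat\<^esub> c i \<in> Hom Set_cat (FOb E i) L" "Ident Set_cat L \<cdot>\<^bsub>Set_cat\<^esub> c i \<in> Hom Set_cat (FOb E i) L"
        using category.Cmp_Hom[OF category_Set_cat c[OF i]] k id by auto
      fix x assume x: "x \<in> FOb E i"
      have cx: "ap (c i) x \<in> L" using ap_in[OF c[OF i] x] .
      have "ap h (ap (c i) x) = ap (c i) x"
        using ap_Cmp[OF c[OF i] h(1) x] h(2)[OF i] x by (simp add: c'_def)
      then show "ap (k \<cdot>\<^bsub>Set_cat\<^esub> c i) x = ap (Ident Set_cat L \<cdot>\<^bsub>Set_cat\<^esub> c i) x"
        using ap_Cmp[OF c[OF i] k x] ap_Cmp[OF c[OF i] id x] cx by (simp add: k_def ap_Ident)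
    qed
  qed
  then have "ap h y = y" using y ap_Ident[OF y] ap_set_fun[OF y, of "ap h" L] by (simp add: k_def)
  then have "y \<in> U" using ap_in[OF h(1) y] by simp
  then show ?thesis by (auto simp: U_def)
qed

text \<open>The test set consists of the two elements \<open>x\<close> and \<open>y\<close> themselves: the element type need
  not contain any others.\<close>

lemma set_colimit_merge:
  assumes colim: "is_colimit J Set_cat E L c"
    and i: "i \<in> Ob J" "x \<in> FOb E i" "y \<in> FOb E i" and eq: "ap (c i) x = ap (c i) y"
  shows "\<exists>u\<in>Ar J. Dom J u = i \<and> ap (FAr E u) x = ap (FAr E u) y"
proof (cases "x = y")
  case True
  then show ?thesis using i by (intro bexI[of _ "Ident J i"]) auto
next
  case False
  \<comment> \<open>\<open>p j z\<close> says that \<open>z\<close> at stage \<open>j\<close> and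
    \<open>x\<close> at stage \<open>i\<close> become equal at some later stage. The test cocone
    sends the elements satisfying \<open>p\<close> to \<open>x\<close> and all others to
    \<open>y\<close>.\<close>
  define p where "p j z \<longleftrightarrow> (\<exists>u\<in>Ar J. \<exists>v\<in>Ar J. Dom J u = i \<and> Dom J v = j \<and> Cod J u = Cod J v \<and>
    ap (FAr E u) x = ap (FAr E v) z)" for j z
  define c' where "c' j = set_fun (FOb E j) (\<lambda>z. if p j z then x else y) {x, y}" for j
  have c': "c' j \<in> Hom Set_cat (FOb E j) {x, y}" for j
    unfolding c'_def by (intro set_fun_Hom) auto
  \<comment> \<open>Invariance along \<open>w\<close>: backwards, the witness \<open>v\<close> is
    composed with \<open>w\<close>; forwards, the span of \<open>v\<close> and \<open>w\<close> has
    to be completed, which is where filteredness is used.\<close>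
  have p: "p (Cod J w) (ap (FAr E w) z) \<longleftrightarrow> p (Dom J w) z" if w: "w \<in> Ar J" and z: "z \<in> FOb E (Dom J w)" for w z
  proof
    assume "p (Cod J w) (ap (FAr E w) z)"
    then obtain u v where uv: "u \<in> Ar J" "v \<in> Ar J" "Dom J u = i" "Dom J v = Cod J w" "Cod J u = Cod J v"
      "ap (FAr E u) x = ap (FAr E v) (ap (FAr E w) z)" unfolding p_def by blast
    then show "p (Dom J w) z"
      unfolding p_def using w z ap_functor_Cmp[OF w uv(2)]
      by (intro bexI[of _ u] bexI[of _ "v \<cdot>\<^bsub>J\<^esub> w"]) auto
  next
    assume "p (Dom J w) z"
    then obtain u v where uv: "u \<in> Ar J" "v \<in> Ar J" "Dom J u = i" "Dom J v = Dom J w" "Cod J u = Cod J v"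
      "ap (FAr E u) x = ap (FAr E v) z" unfolding p_def by blast
    obtain v' w' where vw: "v' \<in> Ar J" "w' \<in> Ar J" "Dom J v' = Cod J v" "Dom J w' = Cod J w"
      "Cod J w' = Cod J v'" "v' \<cdot>\<^bsub>J\<^esub> v = w' \<cdot>\<^bsub>J\<^esub> w"
      using filtered_complete_span[OF J.category_axioms filtered uv(2) w uv(4)] by metis
    have "ap (FAr E (v' \<cdot>\<^bsub>J\<^esub> u)) x = ap (FAr E v') (ap (FAr E v) z)"
      using ap_functor_Cmp[OF uv(1) vw(1)] uv vw i by simp
    also have "\<dots> = ap (FAr E (w' \<cdot>\<^bsub>J\<^esub> w)) z"
      using ap_functor_Cmp[OF uv(2) vw(1)] uv vw z by simp
    also have "\<dots> = ap (FAr E w') (ap (FAr E w) z)"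
      using ap_functor_Cmp[OF w vw(2)] vw z by simp
    finally show "p (Cod J w) (ap (FAr E w) z)"
      unfolding p_def using uv vw by (intro bexI[of _ "v' \<cdot>\<^bsub>J\<^esub> u"] bexI[of _ w']) auto
  qed
  have "is_cocone J Set_cat E {x, y} c'"
    unfolding is_cocone_def
  proof (intro conjI ballI)
    fix u assume u: "u \<in> Ar J"
    show "c' (Cod J u) \<cdot>\<^bsub>Set_cat\<^esub> FAr E u = c' (Dom J u)"
    proof (rule set_arrow_eqI)
      show "c' (Cod J u) \<cdot>\<^bsub>Set_cat\<^esub> FAr E u \<in> Hom Set_cat (FOb E (Dom J u)) {x, y}"
        using category.Cmp_Hom[OF category_Set_cat is_functor_Hom[OF E u] c'] .
      show "ap (c' (Cod J u) \<cdot>\<^bsub>Set_cat\<^esub> FAr E u) z = ap (c' (Dom J u)) z" if "z \<in> FOb E (Dom J u)" for z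
        using ap_Cmp[OF is_functor_Hom[OF E u] c' that] that ap_functor_in[OF u that] p[OF u that]
        by (simp add: c'_def)
    qed (rule c')
  qed (use c' in auto)
  from is_colimit_ex1[OF colim this] obtain h where h: "h \<in> Hom Set_cat L {x, y}"
    "\<And>i. i \<in> Ob J \<Longrightarrow> h \<cdot>\<^bsub>Set_cat\<^esub> c i = c' i" by auto
  have c: "c i \<in> Hom Set_cat (FOb E i) L"
    using is_colimit_cocone[OF colim] i unfolding is_cocone_def by auto
  have "ap (c' i) x = ap (c' i) y"
    using ap_Cmp[OF c h(1) i(2)] ap_Cmp[OF c h(1) i(3)] h(2)[OF i(1)] eq by simp
  moreover have "p i x"
    unfolding p_def using i by (intro bexI[of _ "Ident J i"]) auto
  ultimately have "p i y" using i False by (auto simp: c'_def split: if_splits)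
  then obtain u v where uv: "u \<in> Ar J" "v \<in> Ar J" "Dom J u = i" "Dom J v = i" "Cod J u = Cod J v"
      "ap (FAr E u) x = ap (FAr E v) y" unfolding p_def by blast
  \<comment> \<open>The arrows \<open>u\<close> and \<open>v\<close> are parallel but may differ;
    coequalizing them yields one arrow that identifies \<open>x\<close> and
    \<open>y\<close>.\<close>
  then obtain w where w: "w \<in> Ar J" "Dom J w = Cod J u" "w \<cdot>\<^bsub>J\<^esub> u = w \<cdot>\<^bsub>J\<^esub> v"
    using filtered_coequalize[OF filtered, of u v] by metis
  have "ap (FAr E (w \<cdot>\<^bsub>J\<^esub> u)) x = ap (FAr E (w \<cdot>\<^bsub>J\<^esub> u)) y"
    using ap_functor_Cmp[OF uv(1) w(1)] ap_functor_Cmp[OF uv(2) w(1)] uv w i by simp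
  then show ?thesis using w uv by (intro bexI[of _ "w \<cdot>\<^bsub>J\<^esub> u"]) auto
qed

text \<open>By \<open>surj\<close> every element of \<open>L\<close> has a representative at some
  stage, which prescribes the value of the induced map. Two representatives of one element are moved
  to a common stage and identified further on by \<open>merge\<close>, so the value is well
  defined.\<close>

lemma set_colimitI:
  assumes cocone: "is_cocone J Set_cat E L c"
    and surj: "\<And>y. y \<in> L \<Longrightarrow> \<exists>i\<in>Ob J. \<exists>x\<in>FOb E i. ap (c i) x = y"
    and merge: "\<And>i x y. i \<in> Ob J \<Longrightarrow> x \<in> FOb E i \<Longrightarrow> y \<in> FOb E i \<Longrightarrow> ap (c i) x = ap (c i) y \<Longrightarrow>
      \<exists>u\<in>Ar J. Dom J u = i \<and> ap (FAr E u) x = ap (FAr E u) y"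
  shows "is_colimit J Set_cat E L c"
  unfolding is_colimit_def
proof (intro conjI allI impI)
  fix L' c' assume cocone': "is_cocone J Set_cat E L' c'"
  have c: "c i \<in> Hom Set_cat (FOb E i) L" "c' i \<in> Hom Set_cat (FOb E i) L'" if "i \<in> Ob J" for i
    using cocone cocone' that unfolding is_cocone_def by auto
  have well_defined: "ap (c' i) x = ap (c' j) y"
    if ij: "i \<in> Ob J" "j \<in> Ob J" "x \<in> FOb E i" "y \<in> FOb E j" "ap (c i) x = ap (c j) y" for i j x y
  proof -
    obtain u v where uv: "u \<in> Ar J" "v \<in> Ar J" "Dom J u = i" "Dom J v = j" "Cod J v = Cod J u"
      using filtered_upper_bound[OF filtered ij(1,2)] by metis
    let ?x = "ap (FAr E u) x" and ?y = "ap (FAr E v) y"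
    have xy: "?x \<in> FOb E (Cod J u)" "?y \<in> FOb E (Cod J u)"
      using ap_functor_in[of u x] ap_functor_in[of v y] uv ij by auto
    have "ap (c (Cod J u)) ?x = ap (c (Cod J u)) ?y"
      using ap_cocone[OF cocone, of u x] ap_cocone[OF cocone, of v y] uv ij by simp
    then obtain w where w: "w \<in> Ar J" "Dom J w = Cod J u" "ap (FAr E w) ?x = ap (FAr E w) ?y"
      using merge[of "Cod J u" ?x ?y] xy uv by auto
    then have "ap (c' (Cod J u)) ?x = ap (c' (Cod J u)) ?y"
      using ap_cocone[OF cocone', of w ?x] ap_cocone[OF cocone', of w ?y] xy by simp
    then show ?thesis
      using ap_cocone[OF cocone', of u x] ap_cocone[OF cocone', of v y] uv ij by simp
  qed
  define g where "g y = (SOME z. \<exists>i\<in>Ob J. \<exists>x\<in>FOb E i. ap (c i) x = y \<and> z = ap (c' i) x)" for y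
  have g: "g (ap (c i) x) = ap (c' i) x" if "i \<in> Ob J" "x \<in> FOb E i" for i x
    unfolding g_def by (rule some_equality) (use that well_defined in \<open>blast+\<close>)
  have gL: "g y \<in> L'" if "y \<in> L" for y
    using surj[OF that] g ap_in[OF c(2)] by auto
  define h where "h = set_fun L g L'"
  have h: "h \<in> Hom Set_cat L L'" unfolding h_def using gL by (rule set_fun_Hom)
  have hc: "h \<cdot>\<^bsub>Set_cat\<^esub> c i = c' i" if i: "i \<in> Ob J" for i
  proof (rule set_arrow_eqI[OF category.Cmp_Hom[OF category_Set_cat c(1)[OF i] h] c(2)[OF i]])
    show "ap (h \<cdot>\<^bsub>Set_cat\<^esub> c i) x = ap (c' i) x" if x: "x \<in> FOb E i" for x
      using ap_Cmp[OF c(1)[OF i] h x] g[OF i x] ap_in[OF c(1)[OF i] x] by (simp add: h_def)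
  qed
  show "\<exists>!h. h \<in> Hom Set_cat L L' \<and> (\<forall>i\<in>Ob J. h \<cdot>\<^bsub>Set_cat\<^esub> c i = c' i)"
  proof (rule ex1I[of _ h])
    fix k assume k: "k \<in> Hom Set_cat L L' \<and> (\<forall>i\<in>Ob J. k \<cdot>\<^bsub>Set_cat\<^esub> c i = c' i)"
    show "k = h"
    proof (rule set_arrow_eqI[OF _ h])
      fix y assume "y \<in> L"
      then obtain i x where i: "i \<in> Ob J" "x \<in> FOb E i" "ap (c i) x = y" using surj by blast
      then show "ap k y = ap h y"
        using ap_Cmp[OF c(1)[OF i(1)] h i(2)] ap_Cmp[OF c(1)[OF i(1)] conjunct1[OF k] i(2)] hc[OF i(1)] k by simp
    qed (use k in blast)
  qed (use h hc in blast)
qed (rule cocone)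

end

text \<open>Preservation of the colimit by the hom-functor of \<open>P\<close> in elementary form:
  factorizations through a stage exist and are essentially unique. For filtered shapes
  \<open>hom_preserves_iff\<close> gives the equivalence, and arguments about finitely presentable
  objects work with this form.\<close>

definition hom_preserves :: "('i, 'j) cat \<Rightarrow> ('o, 'm) cat \<Rightarrow> ('i, 'j, 'o, 'm) func \<Rightarrow> 'o \<Rightarrow> ('i \<Rightarrow> 'm) \<Rightarrow> 'o \<Rightarrow> bool"
  where "hom_preserves J C D L c P \<longleftrightarrow>
    (\<forall>f\<in>Hom C P L. \<exists>i\<in>Ob J. \<exists>f'\<in>Hom C P (FOb D i). c i \<cdot>\<^bsub>C\<^esub> f' = f) \<and>
    (\<forall>i\<in>Ob J. \<forall>f\<in>Hom C P (FOb D i). \<forall>g\<in>Hom C P (FOb D i). c i \<cdot>\<^bsub>C\<^esub> f = c i \<cdot>\<^bsub>C\<^esub> g \<longrightarrow>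
       (\<exists>u\<in>Ar J. Dom J u = i \<and> FAr D u \<cdot>\<^bsub>C\<^esub> f = FAr D u \<cdot>\<^bsub>C\<^esub> g))"

context category
begin

lemma FOb_hom_functor [simp]: "FOb (hom_functor C P) X = Hom C P X"
  by (simp add: hom_functor_def)

lemma ap_hom_functor: "f \<in> Hom C P X \<Longrightarrow> g \<in> Hom C X Y \<Longrightarrow> ap (FAr (hom_functor C P) g) f = g \<cdot> f"
  by (auto simp: hom_functor_def ap_def Hom_iff)

lemma hom_functor_Hom: "g \<in> Hom C X Y \<Longrightarrow> FAr (hom_functor C P) g \<in> Hom Set_cat (Hom C P X) (Hom C P Y)"
  using Cmp_Hom by (auto simp: hom_functor_def Hom_Set_cat Hom_iff[of g])

lemma is_functor_hom_functor: "is_functor C Set_cat (hom_functor C P)"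
  unfolding is_functor_def
proof (intro conjI ballI impI)
  fix f assume "f \<in> Ar C"
  then show "FAr (hom_functor C P) f \<in> Hom Set_cat (FOb (hom_functor C P) (Dom C f)) (FOb (hom_functor C P) (Cod C f))"
    using hom_functor_Hom[of f "Dom C f" "Cod C f"] by (simp add: Hom_iff)
next
  fix X assume "X \<in> Ob C"
  then show "FAr (hom_functor C P) (Ident C X) = Ident Set_cat (FOb (hom_functor C P) X)"
    by (auto simp: hom_functor_def fun_eq_iff Hom_iff)
next
  fix f g assume fg: "f \<in> Ar C" "g \<in> Ar C" "Dom C g = Cod C f"
  then show "FAr (hom_functor C P) (g \<cdot> f) = FAr (hom_functor C P) g \<cdot>\<^bsub>Set_cat\<^esub> FAr (hom_functor C P) f"
    by (auto simp: hom_functor_def fun_eq_iff Hom_iff)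
qed (auto simp: category_axioms category_Set_cat)

lemma hom_preserves_iff:
  assumes D: "is_functor J C D" and J: "filtered J" and cocone: "is_cocone J C D L c"
  shows "is_colimit J Set_cat (func_comp (hom_functor C P) D) (Hom C P L) (\<lambda>i. FAr (hom_functor C P) (c i))
    \<longleftrightarrow> hom_preserves J C D L c P" (is "?A \<longleftrightarrow> _")
proof -
  let ?E = "func_comp (hom_functor C P) D" and ?c = "\<lambda>i. FAr (hom_functor C P) (c i)"
  have E: "is_functor J Set_cat ?E" using is_functor_func_comp[OF D is_functor_hom_functor] .
  have c: "c i \<in> Hom C (FOb D i) L" if "i \<in> Ob J" for i using cocone that by (auto simp: is_cocone_def)
  note d = is_functor_Hom[OF D]
  have apc: "ap (?c i) f = c i \<cdot> f" if "i \<in> Ob J" "f \<in> Hom C P (FOb D i)" for i f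
    using ap_hom_functor[OF that(2) c[OF that(1)]] .
  have apd: "ap (FAr ?E u) f = FAr D u \<cdot> f" if "u \<in> Ar J" "f \<in> Hom C P (FOb D (Dom J u))" for u f
    using ap_hom_functor[OF that(2) d[OF that(1)]] by simp
  have cocone': "is_cocone J Set_cat ?E (Hom C P L) ?c"
    unfolding is_cocone_def
  proof (intro conjI ballI)
    fix i assume "i \<in> Ob J"
    then show "?c i \<in> Hom Set_cat (FOb ?E i) (Hom C P L)" using hom_functor_Hom[OF c] by simp
  next
    fix u assume u: "u \<in> Ar J"
    interpret J: category J using D by (rule is_functorD)
    show "?c (Cod J u) \<cdot>\<^bsub>Set_cat\<^esub> FAr ?E u = ?c (Dom J u)"
      using is_functorD(8)[OF is_functor_hom_functor[of P], of "FAr D u" "c (Cod J u)"] is_coconeD[OF cocone] u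
        is_functorD[OF D] by simp
  qed simp
  show ?thesis
  proof
    assume A: ?A
    show "hom_preserves J C D L c P"
      unfolding hom_preserves_def
    proof (intro conjI ballI impI)
      fix f assume "f \<in> Hom C P L"
      from set_colimit_surjective[OF E J A this] show "\<exists>i\<in>Ob J. \<exists>f'\<in>Hom C P (FOb D i). c i \<cdot> f' = f"
        using apc by fastforce
    next
      fix i f g assume i: "i \<in> Ob J" "f \<in> Hom C P (FOb D i)" "g \<in> Hom C P (FOb D i)" "c i \<cdot> f = c i \<cdot> g"
      then obtain u where "u \<in> Ar J" "Dom J u = i" "ap (FAr ?E u) f = ap (FAr ?E u) g"
        using set_colimit_merge[OF E J A, of i f g] apc by auto
      then show "\<exists>u\<in>Ar J. Dom J u = i \<and> FAr D u \<cdot> f = FAr D u \<cdot> g"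
        using apd i by (intro bexI[of _ u]) auto
    qed
  next
    assume P: "hom_preserves J C D L c P"
    show ?A
    proof (rule set_colimitI[OF E J cocone'])
      fix f assume "f \<in> Hom C P L"
      then show "\<exists>i\<in>Ob J. \<exists>x\<in>FOb ?E i. ap (?c i) x = f"
        using P apc unfolding hom_preserves_def by fastforce
    next
      fix i f g assume i: "i \<in> Ob J" "f \<in> FOb ?E i" "g \<in> FOb ?E i" "ap (?c i) f = ap (?c i) g"
      then obtain u where "u \<in> Ar J" "Dom J u = i" "FAr D u \<cdot> f = FAr D u \<cdot> g"
        using P apc unfolding hom_preserves_def by fastforce
      then show "\<exists>u\<in>Ar J. Dom J u = i \<and> ap (FAr ?E u) f = ap (FAr ?E u) g"
        using apd i by (intro bexI[of _ u]) auto
    qed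
  qed
qed

lemma finitely_presentable_hom_preserves:
  assumes "uncountable_regular \<kappa>" "finitely_presentable \<kappa> C P" "small_category \<kappa> J" "filtered J"
    "is_functor J C D" "is_colimit J C D L c"
  shows "hom_preserves J C D L c P"
  using finitary_colimit[OF assms(1) _ assms(3-6), of Set_cat "hom_functor C P"] assms(2)
    hom_preserves_iff[OF assms(5,4) is_colimit_cocone[OF assms(6)]]
  by (simp add: finitely_presentable_def)

lemma finitely_presentableI:
  fixes \<kappa> :: "'k rel"
  assumes "P \<in> Ob C"
    and "\<And>(J :: ('k, 'k) cat) D L c. small_category \<kappa> J \<Longrightarrow> filtered J \<Longrightarrow> is_functor J C D \<Longrightarrow>
      is_colimit J C D L c \<Longrightarrow> hom_preserves J C D L c P"
  shows "finitely_presentable \<kappa> C P"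
  unfolding finitely_presentable_def finitary_def
proof (intro conjI allI impI is_functor_hom_functor)
  fix J :: "('k, 'k) cat" and D L c
  assume J: "small_category \<kappa> J \<and> filtered J \<and> is_functor J C D \<and> is_colimit J C D L c"
  then show "is_colimit J Set_cat (func_comp (hom_functor C P) D) (FOb (hom_functor C P) L)
      (\<lambda>i. FAr (hom_functor C P) (c i))"
    using hom_preserves_iff[of J D L c P] is_colimit_cocone[of J C D L c] assms(2)[of J D L c] by simp
qed (rule assms(1))

end

section \<open>Finitely presentable objects\<close>

lemma is_cocone_cmp_assoc:
  assumes "category C" "is_functor J C D" "is_cocone J C D L c" "u \<in> Ar J" "f \<in> Hom C P (FOb D (Dom J u))"
  shows "c (Cod J u) \<cdot>\<^bsub>C\<^esub> (FAr D u \<cdot>\<^bsub>C\<^esub> f) = c (Dom J u) \<cdot>\<^bsub>C\<^esub> f"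
proof -
  interpret C: category C by fact
  interpret J: category J using assms(2) by (rule is_functorD)
  show ?thesis
    using C.cmp_assoc[of f "FAr D u" "c (Cod J u)"] is_coconeD[OF assms(3)] is_functorD[OF assms(2)] assms(4,5)
    by (simp add: Hom_iff)
qed

definition is_initial :: "('o, 'm) cat \<Rightarrow> 'o \<Rightarrow> bool" where
  "is_initial C I \<longleftrightarrow> I \<in> Ob C \<and> (\<forall>Z\<in>Ob C. \<exists>!h. h \<in> Hom C I Z)"

definition is_coequalizer :: "('o, 'm) cat \<Rightarrow> 'm \<Rightarrow> 'm \<Rightarrow> 'm \<Rightarrow> bool" where
  "is_coequalizer C p q k \<longleftrightarrow> k \<in> Ar C \<and> Dom C k = Cod C p \<and> k \<cdot>\<^bsub>C\<^esub> p = k \<cdot>\<^bsub>C\<^esub> q \<and>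
    (\<forall>f\<in>Ar C. Dom C f = Cod C p \<and> f \<cdot>\<^bsub>C\<^esub> p = f \<cdot>\<^bsub>C\<^esub> q \<longrightarrow>
       (\<exists>!h. h \<in> Hom C (Cod C k) (Cod C f) \<and> h \<cdot>\<^bsub>C\<^esub> k = f))"

text \<open>An arrow is a triple of source, target and flag, the flag separating the two arrows from
  \<open>False\<close> to \<open>True\<close>. Identities have flag \<open>False\<close>, so
  disjunction of flags is the right composition.\<close>

definition parallel_pair :: "(bool, bool \<times> bool \<times> bool) cat" where
  "parallel_pair = \<lparr>Ob = UNIV, Ar = {(False, False, False), (True, True, False), (False, True, False), (False, True, True)},
     Dom = fst, Cod = fst \<circ> snd, Ident = (\<lambda>x. (x, x, False)),
     Cmp = (\<lambda>(_, z, b') (x, _, b). (x, z, b \<or> b'))\<rparr>"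

locale lfp_category = coproduct_category C S for C :: "('o, 'm) cat" (structure) and S +
  fixes \<kappa> :: "'k rel"
  assumes \<kappa>: "uncountable_regular \<kappa>"
    and lfp: "locally_finitely_presentable \<kappa> C"
begin

abbreviation "fp \<equiv> finitely_presentable \<kappa> C"

lemma fp_Ob [simp]: "fp P \<Longrightarrow> P \<in> Ob C"
  by (simp add: finitely_presentable_def)

lemma cocomplete: "cocomplete \<kappa> C"
  using lfp by (simp add: locally_finitely_presentable_def)

lemma hom_preserves_factor:
  assumes "hom_preserves J C D L c P" "f \<in> Hom C P L"
  obtains i f' where "i \<in> Ob J" "f' \<in> Hom C P (FOb D i)" "c i \<cdot> f' = f"
  using assms unfolding hom_preserves_def by blast

lemma hom_preserves_merge:
  assumes "hom_preserves J C D L c P" "i \<in> Ob J" "f \<in> Hom C P (FOb D i)" "g \<in> Hom C P (FOb D i)"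
    "c i \<cdot> f = c i \<cdot> g"
  obtains u where "u \<in> Ar J" "Dom J u = i" "FAr D u \<cdot> f = FAr D u \<cdot> g"
  using assms unfolding hom_preserves_def by blast

text \<open>Maps out of \<open>X \<oplus> Y\<close> are pairs of maps, and each component is handled
  at its own stage; filteredness brings the stages together. This is the commutation of filtered
  colimits with binary products, applied to hom-sets.\<close>

lemma fp_cop:
  assumes "fp X" "fp Y"
  shows "fp (X \<oplus> Y)"
proof (rule finitely_presentableI)
  fix J :: "('k, 'k) cat" and D L c
  assume J: "small_category \<kappa> J" "filtered J" and D: "is_functor J C D" and colim: "is_colimit J C D L c"
  note cocone = is_colimit_cocone[OF colim]
  note pX = finitely_presentable_hom_preserves[OF \<kappa> assms(1) J D colim]
    and pY = finitely_presentable_hom_preserves[OF \<kappa> assms(2) J D colim]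
  have XY [simp]: "X \<in> Ob C" "Y \<in> Ob C" using assms by auto
  interpret J: category J using D by (rule is_functorD)
  note [simp] = is_coconeD[OF cocone] is_functorD(3-)[OF D]
  show "hom_preserves J C D L c (X \<oplus> Y)"
    unfolding hom_preserves_def
  proof (intro conjI ballI impI)
    fix f assume f: "f \<in> Hom C (X \<oplus> Y) L"
    then have "f \<cdot> inl S X Y \<in> Hom C X L" "f \<cdot> inr S X Y \<in> Hom C Y L" by (auto simp: Hom_iff)
    then obtain i f1 j f2 where 1: "i \<in> Ob J" "f1 \<in> Hom C X (FOb D i)" "c i \<cdot> f1 = f \<cdot> inl S X Y"
      and 2: "j \<in> Ob J" "f2 \<in> Hom C Y (FOb D j)" "c j \<cdot> f2 = f \<cdot> inr S X Y"
      using hom_preserves_factor[OF pX] hom_preserves_factor[OF pY] by metis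
    obtain u v where uv: "u \<in> Ar J" "v \<in> Ar J" "Dom J u = i" "Dom J v = j" "Cod J v = Cod J u"
      using filtered_upper_bound[OF J(2) 1(1) 2(1)] by metis
    have "c (Cod J u) \<cdot> (FAr D u \<cdot> f1) = f \<cdot> inl S X Y"
      using is_cocone_cmp_assoc[OF category_axioms D cocone uv(1), of f1 X] 1 uv by simp
    moreover have "c (Cod J u) \<cdot> (FAr D v \<cdot> f2) = f \<cdot> inr S X Y"
      using is_cocone_cmp_assoc[OF category_axioms D cocone uv(2), of f2 Y] 2 uv by simp
    ultimately show "\<exists>i\<in>Ob J. \<exists>f'\<in>Hom C (X \<oplus> Y) (FOb D i). c i \<cdot> f' = f"
      using 1 2 uv f
      by (intro bexI[of _ "Cod J u"] bexI[of _ "\<langle>FAr D u \<cdot> f1, FAr D v \<cdot> f2\<rangle>"]) (simp_all add: Hom_iff)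
  next
    fix i f g assume i: "i \<in> Ob J" and f: "f \<in> Hom C (X \<oplus> Y) (FOb D i)" and g: "g \<in> Hom C (X \<oplus> Y) (FOb D i)"
      and eq: "c i \<cdot> f = c i \<cdot> g"
    have e: "c i \<cdot> (f \<cdot> h) = c i \<cdot> (g \<cdot> h)" if "h \<in> Ar C" "Cod C h = X \<oplus> Y" for h
      using arg_cong[OF eq, of "\<lambda>k. k \<cdot> h"] that i f g by (simp add: Hom_iff)
    have m: "f \<cdot> inl S X Y \<in> Hom C X (FOb D i)" "g \<cdot> inl S X Y \<in> Hom C X (FOb D i)"
      "f \<cdot> inr S X Y \<in> Hom C Y (FOb D i)" "g \<cdot> inr S X Y \<in> Hom C Y (FOb D i)"
      using f g by (auto simp: Hom_iff)
    obtain u where u: "u \<in> Ar J" "Dom J u = i" "FAr D u \<cdot> (f \<cdot> inl S X Y) = FAr D u \<cdot> (g \<cdot> inl S X Y)"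
      using hom_preserves_merge[OF pX i m(1,2)] e[of "inl S X Y"] by auto
    obtain v where v: "v \<in> Ar J" "Dom J v = i" "FAr D v \<cdot> (f \<cdot> inr S X Y) = FAr D v \<cdot> (g \<cdot> inr S X Y)"
      using hom_preserves_merge[OF pY i m(3,4)] e[of "inr S X Y"] by auto
    \<comment> \<open>The arrows \<open>u\<close> and \<open>v\<close> each equalize one component;
      completing their span gives a single arrow that equalizes both.\<close>
    obtain u' v' where uv: "u' \<in> Ar J" "v' \<in> Ar J" "Dom J u' = Cod J u" "Dom J v' = Cod J v"
      "Cod J v' = Cod J u'" "u' \<cdot>\<^bsub>J\<^esub> u = v' \<cdot>\<^bsub>J\<^esub> v"
      using filtered_complete_span[OF J.category_axioms J(2) u(1) v(1)] u(2) v(2) by metis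
    have *: "FAr D u' \<cdot> FAr D u = FAr D v' \<cdot> FAr D v"
      using uv u v is_functorD(8)[OF D, of u u'] is_functorD(8)[OF D, of v v'] by metis
    have d: "FAr D u' \<cdot> (FAr D u \<cdot> k) = FAr D v' \<cdot> (FAr D v \<cdot> k)" if "k \<in> Ar C" "Cod C k = FOb D i" for k
    proof -
      have "FAr D u' \<cdot> (FAr D u \<cdot> k) = (FAr D u' \<cdot> FAr D u) \<cdot> k" using that uv(1-5) u(1,2) by simp
      also have "\<dots> = (FAr D v' \<cdot> FAr D v) \<cdot> k" using * by simp
      finally show ?thesis using that uv(1-5) v(1,2) by simp
    qed
    have "FAr D (u' \<cdot>\<^bsub>J\<^esub> u) \<cdot> f = FAr D (u' \<cdot>\<^bsub>J\<^esub> u) \<cdot> g"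
    proof (rule cop_eqI)
      show "FAr D (u' \<cdot>\<^bsub>J\<^esub> u) \<cdot> f \<in> Hom C (X \<oplus> Y) (FOb D (Cod J u'))"
        "FAr D (u' \<cdot>\<^bsub>J\<^esub> u) \<cdot> g \<in> Hom C (X \<oplus> Y) (FOb D (Cod J u'))"
        using f g u uv(1-5) by (auto simp: Hom_iff)
      show "(FAr D (u' \<cdot>\<^bsub>J\<^esub> u) \<cdot> f) \<cdot> inl S X Y = (FAr D (u' \<cdot>\<^bsub>J\<^esub> u) \<cdot> g) \<cdot> inl S X Y"
        using f g u uv(1-5) by (simp add: Hom_iff)
      show "(FAr D (u' \<cdot>\<^bsub>J\<^esub> u) \<cdot> f) \<cdot> inr S X Y = (FAr D (u' \<cdot>\<^bsub>J\<^esub> u) \<cdot> g) \<cdot> inr S X Y"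
        using f g u v uv(1-5) by (simp add: Hom_iff d)
    qed simp_all
    then show "\<exists>u\<in>Ar J. Dom J u = i \<and> FAr D u \<cdot> f = FAr D u \<cdot> g"
      using u uv(1-5) by (intro bexI[of _ "u' \<cdot>\<^bsub>J\<^esub> u"]) auto
  qed
qed (use assms in simp)

text \<open>Hom-sets out of \<open>I\<close> are singletons, so a factorization needs just one
  stage, and a filtered shape has one because it is nonempty.\<close>

lemma fp_initial:
  assumes I: "is_initial C I"
  shows "fp I"
proof (rule finitely_presentableI)
  fix J :: "('k, 'k) cat" and D L c
  assume J: "small_category \<kappa> J" "filtered J" and D: "is_functor J C D" and colim: "is_colimit J C D L c"
  note cocone = is_colimit_cocone[OF colim]
  have uniq: "f = g" if "f \<in> Hom C I Z" "g \<in> Hom C I Z" for f g Z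
    using I Hom_Ob(2)[OF that(1)] that unfolding is_initial_def by blast
  show "hom_preserves J C D L c I"
    unfolding hom_preserves_def
  proof (intro conjI ballI impI)
    fix f assume f: "f \<in> Hom C I L"
    obtain i where i: "i \<in> Ob J" using J(2) by (auto simp: filtered_def)
    then obtain f' where f': "f' \<in> Hom C I (FOb D i)"
      using I is_functorD(3)[OF D i] unfolding is_initial_def by blast
    have "c i \<cdot> f' = f"
      by (rule uniq[OF _ f]) (use f' i is_coconeD[OF cocone] in \<open>auto simp: Hom_iff\<close>)
    then show "\<exists>i\<in>Ob J. \<exists>f'\<in>Hom C I (FOb D i). c i \<cdot> f' = f" using i f' by blast
  next
    fix i f g assume i: "i \<in> Ob J" and f: "f \<in> Hom C I (FOb D i)" and g: "g \<in> Hom C I (FOb D i)"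
    interpret J: category J using D by (rule is_functorD)
    show "\<exists>u\<in>Ar J. Dom J u = i \<and> FAr D u \<cdot> f = FAr D u \<cdot> g"
      using uniq[OF f g] i by (intro bexI[of _ "Ident J i"]) auto
  qed
qed (use I in \<open>simp add: is_initial_def\<close>)

text \<open>A map out of the coequalizer is a map out of \<open>X\<close> that equalizes
  \<open>p\<close> and \<open>q\<close>. Its factorization \<open>g\<close> through a stage may fail
  to equalize them, but finite presentability of \<open>P\<close> repairs this at a later stage,
  where the map descends to the coequalizer.\<close>

lemma fp_coequalizer:
  assumes "fp X" "fp P" and p: "p \<in> Hom C P X" and q: "q \<in> Hom C P X" and k: "is_coequalizer C p q k"
  shows "fp (Cod C k)"
proof (rule finitely_presentableI)
  have k1: "k \<in> Ar C" "Dom C k = X" "k \<cdot> p = k \<cdot> q"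
    and k2: "\<And>f. f \<in> Ar C \<Longrightarrow> Dom C f = X \<Longrightarrow> f \<cdot> p = f \<cdot> q \<Longrightarrow>
       \<exists>!h. h \<in> Hom C (Cod C k) (Cod C f) \<and> h \<cdot> k = f"
    using k p unfolding is_coequalizer_def by (auto simp: Hom_iff)
  then show "Cod C k \<in> Ob C" by simp
  fix J :: "('k, 'k) cat" and D L c
  assume J: "small_category \<kappa> J" "filtered J" and D: "is_functor J C D" and colim: "is_colimit J C D L c"
  note cocone = is_colimit_cocone[OF colim]
  note pX = finitely_presentable_hom_preserves[OF \<kappa> assms(1) J D colim]
    and pP = finitely_presentable_hom_preserves[OF \<kappa> assms(2) J D colim]
  interpret J: category J using D by (rule is_functorD)
  note [simp] = is_coconeD[OF cocone] is_functorD(3-)[OF D] k1(1,2)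
  have epi: "f = g" if "f \<in> Hom C (Cod C k) Z" "g \<in> Hom C (Cod C k) Z" "f \<cdot> k = g \<cdot> k" for f g Z
    using k2[of "g \<cdot> k"] that k1(3) p q by (auto simp: Hom_iff)
  show "hom_preserves J C D L c (Cod C k)"
    unfolding hom_preserves_def
  proof (intro conjI ballI impI)
    fix f assume f: "f \<in> Hom C (Cod C k) L"
    then have fk: "f \<cdot> k \<in> Hom C X L" by (auto simp: Hom_iff)
    obtain i g where i: "i \<in> Ob J" "g \<in> Hom C X (FOb D i)" "c i \<cdot> g = f \<cdot> k"
      using hom_preserves_factor[OF pX fk] by metis
    have "c i \<cdot> (g \<cdot> p) = c i \<cdot> (g \<cdot> q)"
    proof -
      have "c i \<cdot> (g \<cdot> p) = (c i \<cdot> g) \<cdot> p" "c i \<cdot> (g \<cdot> q) = (c i \<cdot> g) \<cdot> q"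
        using i(1,2) p q by (simp_all add: Hom_iff)
      then show ?thesis using i(3) k1(3) f p q by (simp add: Hom_iff)
    qed
    moreover have "g \<cdot> p \<in> Hom C P (FOb D i)" "g \<cdot> q \<in> Hom C P (FOb D i)"
      using i p q by (auto simp: Hom_iff)
    ultimately obtain u where u: "u \<in> Ar J" "Dom J u = i" "FAr D u \<cdot> (g \<cdot> p) = FAr D u \<cdot> (g \<cdot> q)"
      using hom_preserves_merge[OF pP i(1)] by metis
    then obtain h where h: "h \<in> Hom C (Cod C k) (FOb D (Cod J u))" "h \<cdot> k = FAr D u \<cdot> g"
      using k2[of "FAr D u \<cdot> g"] i p q by (auto simp: Hom_iff)
    have "c (Cod J u) \<cdot> h = f"
    proof (rule epi)
      show "(c (Cod J u) \<cdot> h) \<cdot> k = f \<cdot> k"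
        using is_cocone_cmp_assoc[OF category_axioms D cocone u(1), of g X] i u h by (simp add: Hom_iff)
    qed (use h u f in \<open>auto simp: Hom_iff\<close>)
    then show "\<exists>i\<in>Ob J. \<exists>f'\<in>Hom C (Cod C k) (FOb D i). c i \<cdot> f' = f"
      using h u by (intro bexI[of _ "Cod J u"] bexI[of _ h]) auto
  next
    fix i f g assume i: "i \<in> Ob J" and f: "f \<in> Hom C (Cod C k) (FOb D i)" and g: "g \<in> Hom C (Cod C k) (FOb D i)"
      and eq: "c i \<cdot> f = c i \<cdot> g"
    have "c i \<cdot> (f \<cdot> k) = c i \<cdot> (g \<cdot> k)"
      using arg_cong[OF eq, of "\<lambda>h. h \<cdot> k"] i f g by (simp add: Hom_iff)
    moreover have "f \<cdot> k \<in> Hom C X (FOb D i)" "g \<cdot> k \<in> Hom C X (FOb D i)"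
      using f g by (auto simp: Hom_iff)
    ultimately obtain u where u: "u \<in> Ar J" "Dom J u = i" "FAr D u \<cdot> (f \<cdot> k) = FAr D u \<cdot> (g \<cdot> k)"
      using hom_preserves_merge[OF pX i] by metis
    have "FAr D u \<cdot> f = FAr D u \<cdot> g"
      by (rule epi) (use u f g in \<open>auto simp: Hom_iff\<close>)
    then show "\<exists>u\<in>Ar J. Dom J u = i \<and> FAr D u \<cdot> f = FAr D u \<cdot> g" using u by blast
  qed
qed

section \<open>Finite colimits obtained from cocompleteness\<close>

lemma ex_initial: "\<exists>I. is_initial C I"
proof -
  define J :: "(unit, unit) cat" where "J = \<lparr>Ob = {}, Ar = {}, Dom = id, Cod = id, Ident = id, Cmp = (\<lambda>_ _. ())\<rparr>"
  define D :: "(unit, unit, 'o, 'm) func" where "D = \<lparr>FOb = (\<lambda>_. undefined), FAr = (\<lambda>_. undefined)\<rparr>"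
  have "category J" by unfold_locales (auto simp: J_def Hom_iff)
  then have J: "small_category \<kappa> J" "is_functor J C D"
    using category_axioms by (simp_all add: small_category_def is_functor_def J_def small_finite[OF \<kappa>])
  obtain L c where colim: "is_colimit J C D L c"
    by (rule cocomplete_colimit[OF \<kappa> cocomplete J])
  have "is_cocone J C D Z c'" if "Z \<in> Ob C" for Z c' using that by (simp add: is_cocone_def J_def)
  then have "\<exists>!h. h \<in> Hom C L Z" if "Z \<in> Ob C" for Z
    using is_colimit_ex1[OF colim, of Z] that by (simp add: J_def)
  then have "is_initial C L"
    using is_coconeD(1)[OF is_colimit_cocone[OF colim]] by (simp add: is_initial_def)
  then show ?thesis ..
qed

lemma ex_coequalizer:
  assumes p: "p \<in> Hom C P X" and q: "q \<in> Hom C P X"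
  shows "\<exists>k. is_coequalizer C p q k"
proof -
  let ?J = parallel_pair
  define D where "D = \<lparr>FOb = (\<lambda>x. if x then X else P),
    FAr = (\<lambda>(x, y, b). if x then Ident C X else if \<not> y then Ident C P else if b then p else q)\<rparr>"
  have [simp]: "P \<in> Ob C" "X \<in> Ob C" using Hom_Ob[OF p] by auto
  have cat: "category ?J"
    by unfold_locales (simp_all add: parallel_pair_def Hom_iff, auto)
  have D: "is_functor ?J C D"
    unfolding is_functor_def using cat category_axioms p q
    by (simp add: D_def parallel_pair_def Hom_iff)
  have J: "small_category \<kappa> ?J"
    by (simp add: small_category_def cat small_finite[OF \<kappa>])
  obtain K c where colim: "is_colimit ?J C D K c"
    by (rule cocomplete_colimit[OF \<kappa> cocomplete J D])
  note cocone = is_colimit_cocone[OF colim]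
  have J [simp]: "Ob ?J = UNIV" "(False, True, b) \<in> Ar ?J" "Dom ?J (x, y, b) = x" "Cod ?J (x, y, b) = y" for x y b
    by (auto simp: parallel_pair_def)
  have c: "c True \<in> Hom C X K" "c False = c True \<cdot> p" "c False = c True \<cdot> q"
    using is_coconeD(2-4)[OF cocone, of True] is_coconeD(5)[OF cocone, of "(False, True, True)"]
      is_coconeD(5)[OF cocone, of "(False, True, False)"] by (auto simp: D_def Hom_iff)
  have "\<exists>!h. h \<in> Hom C K (Cod C f) \<and> h \<cdot> c True = f" if f: "f \<in> Ar C" "Dom C f = X" "f \<cdot> p = f \<cdot> q" for f
  proof -
    have "is_cocone ?J C D (Cod C f) (\<lambda>x. if x then f else f \<cdot> p)"
      unfolding is_cocone_def using f p q by (simp add: D_def Hom_iff parallel_pair_def)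
    from is_colimit_ex1[OF colim this] have "\<exists>!h. h \<in> Hom C K (Cod C f) \<and> h \<cdot> c True = f \<and> h \<cdot> c False = f \<cdot> p"
      by (simp add: all_bool_eq conj_commute)
    \<comment> \<open>The leg at \<open>False\<close> is determined by the leg at
      \<open>True\<close>, so the universal property of the colimit reduces to that of the
      coequalizer.\<close>
    moreover have "h \<cdot> c False = f \<cdot> p" if "h \<in> Hom C K (Cod C f)" "h \<cdot> c True = f" for h
      using that c(1,2) p cmp_assoc[of p "c True" h] by (simp add: Hom_iff)
    ultimately show ?thesis by blast
  qed
  then have "is_coequalizer C p q (c True)"
    unfolding is_coequalizer_def using c p by (auto simp: Hom_iff)
  then show ?thesis ..
qed

section \<open>Essential smallness of the finitely presentable objects\<close>

lemma generator:
  obtains G where "small \<kappa> G" "\<And>X Y. X \<in> G \<Longrightarrow> Y \<in> G \<Longrightarrow> small \<kappa> (Hom C X Y)" "\<And>X. X \<in> G \<Longrightarrow> fp X"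
    "\<And>A. A \<in> Ob C \<Longrightarrow> \<exists>(J :: ('k, 'k) cat) D c. small_category \<kappa> J \<and> filtered J \<and> is_functor J C D \<and>
       (\<forall>i\<in>Ob J. FOb D i \<in> G) \<and> is_colimit J C D A c"
  using lfp unfolding locally_finitely_presentable_def by blast

text \<open>\<open>P\<close> is a filtered colimit of generators, and its identity factors through a
  stage: the factorization is the section, the leg of the colimit is the retraction.\<close>

lemma fp_retract_of_generator:
  assumes G: "\<And>A. A \<in> Ob C \<Longrightarrow> \<exists>(J :: ('k, 'k) cat) D c. small_category \<kappa> J \<and> filtered J \<and> is_functor J C D \<and>
       (\<forall>i\<in>Ob J. FOb D i \<in> G) \<and> is_colimit J C D A c"
    and "fp P"
  obtains Q s r where "Q \<in> G" "s \<in> Hom C P Q" "r \<in> Hom C Q P" "r \<cdot> s = Ident C P"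
proof -
  obtain J :: "('k, 'k) cat" and D c where J: "small_category \<kappa> J" "filtered J" "is_functor J C D"
    "\<forall>i\<in>Ob J. FOb D i \<in> G" "is_colimit J C D P c"
    using G[of P] assms(2) by auto
  have "Ident C P \<in> Hom C P P" using assms(2) by (simp add: Hom_iff)
  then obtain i s where "i \<in> Ob J" "s \<in> Hom C P (FOb D i)" "c i \<cdot> s = Ident C P"
    using hom_preserves_factor[OF finitely_presentable_hom_preserves[OF \<kappa> assms(2) J(1,2,3,5)]] by metis
  then show ?thesis
    using that[of "FOb D i" s "c i"] J(4) is_coconeD[OF is_colimit_cocone[OF J(5)]] by (auto simp: Hom_iff)
qed

text \<open>Smallness is given only between generators. In the first argument, composition with the
  retraction \<open>r\<close> embeds \<open>Hom C P Y\<close> into \<open>Hom C Q Y\<close>; in the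
  second, every map into \<open>A\<close> factors through one of a small number of stages.\<close>

lemma small_Hom:
  assumes P: "fp P" and A: "A \<in> Ob C"
  shows "small \<kappa> (Hom C P A)"
proof -
  obtain G where G: "\<And>X Y. X \<in> G \<Longrightarrow> Y \<in> G \<Longrightarrow> small \<kappa> (Hom C X Y)"
    "\<And>A. A \<in> Ob C \<Longrightarrow> \<exists>(J :: ('k, 'k) cat) D c. small_category \<kappa> J \<and> filtered J \<and> is_functor J C D \<and>
       (\<forall>i\<in>Ob J. FOb D i \<in> G) \<and> is_colimit J C D A c"
    by (rule generator) blast
  obtain Q s r where Q: "Q \<in> G" "s \<in> Hom C P Q" "r \<in> Hom C Q P" "r \<cdot> s = Ident C P"
    using fp_retract_of_generator[OF G(2) P] by metis
  have PQ: "small \<kappa> (Hom C P Y)" if "Y \<in> G" for Y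
  proof (rule small_inj_on)
    have "(\<lambda>f. f \<cdot> r) ` Hom C P Y \<subseteq> Hom C Q Y" using Q(3) by (auto simp: Hom_iff)
    then show "small \<kappa> ((\<lambda>f. f \<cdot> r) ` Hom C P Y)" by (rule small_subset[OF G(1)[OF Q(1) that]])
    show "inj_on (\<lambda>f. f \<cdot> r) (Hom C P Y)"
    proof (rule inj_onI)
      fix f g assume fg: "f \<in> Hom C P Y" "g \<in> Hom C P Y" "f \<cdot> r = g \<cdot> r"
      show "f = g"
        using arg_cong[OF fg(3), of "\<lambda>h. h \<cdot> s"] fg(1,2) Q(2-4) by (simp add: Hom_iff)
    qed
  qed
  obtain J :: "('k, 'k) cat" and D c where J: "small_category \<kappa> J" "filtered J" "is_functor J C D"
    "\<forall>i\<in>Ob J. FOb D i \<in> G" "is_colimit J C D A c"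
    using G(2)[OF A] by auto
  have "Hom C P A \<subseteq> (\<Union>i\<in>Ob J. (\<lambda>f. c i \<cdot> f) ` Hom C P (FOb D i))"
  proof
    fix f assume "f \<in> Hom C P A"
    then obtain i f' where "i \<in> Ob J" "f' \<in> Hom C P (FOb D i)" "c i \<cdot> f' = f"
      using hom_preserves_factor[OF finitely_presentable_hom_preserves[OF \<kappa> P J(1,2,3,5)]] by metis
    then show "f \<in> (\<Union>i\<in>Ob J. (\<lambda>f. c i \<cdot> f) ` Hom C P (FOb D i))" by blast
  qed
  moreover have "small \<kappa> (\<Union>i\<in>Ob J. (\<lambda>f. c i \<cdot> f) ` Hom C P (FOb D i))"
    using J by (intro small_UN[OF \<kappa>] small_image PQ) (auto simp: small_category_def)
  ultimately show ?thesis by (rule small_subset[rotated])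
qed

text \<open>An idempotent of a generator splits through at most one object up to isomorphism.\<close>

lemma fp_skeleton:
  obtains PP where "small \<kappa> PP" "\<And>P. P \<in> PP \<Longrightarrow> fp P"
    "\<And>X. fp X \<Longrightarrow> \<exists>P\<in>PP. \<exists>\<phi>\<in>Hom C X P. \<exists>\<psi>\<in>Hom C P X. \<psi> \<cdot> \<phi> = Ident C X \<and> \<phi> \<cdot> \<psi> = Ident C P"
proof -
  obtain G where G: "small \<kappa> G" "\<And>X Y. X \<in> G \<Longrightarrow> Y \<in> G \<Longrightarrow> small \<kappa> (Hom C X Y)" "\<And>X. X \<in> G \<Longrightarrow> fp X"
    "\<And>A. A \<in> Ob C \<Longrightarrow> \<exists>(J :: ('k, 'k) cat) D c. small_category \<kappa> J \<and> filtered J \<and> is_functor J C D \<and>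
       (\<forall>i\<in>Ob J. FOb D i \<in> G) \<and> is_colimit J C D A c"
    by (rule generator) blast
  define splits where "splits X \<epsilon> \<longleftrightarrow> fp X \<and> (\<exists>Q\<in>G. \<exists>s\<in>Hom C X Q. \<exists>r\<in>Hom C Q X.
     r \<cdot> s = Ident C X \<and> s \<cdot> r = \<epsilon>)" for X \<epsilon>
  define E where "E = {\<epsilon>. \<exists>X. splits X \<epsilon>}"
  \<comment> \<open>One splitting object is chosen for each idempotent, so \<open>PP\<close> is no
    larger than the set \<open>E\<close> of idempotents, which consists of endomorphisms of
    generators.\<close>
  define PP where "PP = (\<lambda>\<epsilon>. SOME X. splits X \<epsilon>) ` E"
  have PP: "splits (SOME X. splits X \<epsilon>) \<epsilon>" if "\<epsilon> \<in> E" for \<epsilon>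
    using that someI_ex[of "\<lambda>X. splits X \<epsilon>"] by (simp add: E_def)
  show ?thesis
  proof (rule that[of PP])
    have "E \<subseteq> (\<Union>Q\<in>G. Hom C Q Q)"
      unfolding E_def splits_def by (auto simp: Hom_iff)
    moreover have "small \<kappa> (\<Union>Q\<in>G. Hom C Q Q)" using G(1,2) by (intro small_UN[OF \<kappa>]) auto
    ultimately show "small \<kappa> PP" unfolding PP_def by (intro small_image) (rule small_subset)
    show "fp P" if "P \<in> PP" for P using that PP by (auto simp: PP_def splits_def)
    fix X assume X: "fp X"
    obtain Q s r where Q: "Q \<in> G" "s \<in> Hom C X Q" "r \<in> Hom C Q X" "r \<cdot> s = Ident C X"
      using fp_retract_of_generator[OF G(4) X] by metis
    then have "splits X (s \<cdot> r)" using X by (auto simp: splits_def)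
    then have E: "s \<cdot> r \<in> E" by (auto simp: E_def)
    define P where "P = (SOME X. splits X (s \<cdot> r))"
    have P: "splits P (s \<cdot> r)" using PP[OF E] by (simp add: P_def)
    obtain Q' s' r' where Q': "Q' \<in> G" "s' \<in> Hom C P Q'" "r' \<in> Hom C Q' P" "r' \<cdot> s' = Ident C P" "s' \<cdot> r' = s \<cdot> r"
      using P unfolding splits_def by auto
    \<comment> \<open>Both composites are the same arrow, and an arrow has only one domain, so the
      two splittings pass through the same generator. Then \<open>r' \<cdot> s\<close> and
      \<open>r \<cdot> s'\<close> are mutually inverse.\<close>
    have QQ: "Q' = Q" using Q(2,3) Q'(2,3,5) cmp_simps(2)[of r s] cmp_simps(2)[of r' s'] by (simp add: Hom_iff)
    have "(r \<cdot> s') \<cdot> (r' \<cdot> s) = r \<cdot> ((s' \<cdot> r') \<cdot> s)"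
      using Q(2,3) Q'(2,3) QQ by (simp add: Hom_iff)
    also have "\<dots> = (r \<cdot> s) \<cdot> (r \<cdot> s)"
      unfolding Q'(5) using Q(2,3) by (simp add: Hom_iff)
    also have "\<dots> = Ident C X" using Q X by simp
    finally have 1: "(r \<cdot> s') \<cdot> (r' \<cdot> s) = Ident C X" .
    have "(r' \<cdot> s) \<cdot> (r \<cdot> s') = r' \<cdot> ((s \<cdot> r) \<cdot> s')"
      using Q(2,3) Q'(2,3) QQ by (simp add: Hom_iff)
    also have "\<dots> = (r' \<cdot> s') \<cdot> (r' \<cdot> s')"
      unfolding Q'(5)[symmetric] using Q'(2,3) by (simp add: Hom_iff)
    also have "\<dots> = Ident C P" using Q' Hom_Ob(1)[OF Q'(2)] by simp
    finally have 2: "(r' \<cdot> s) \<cdot> (r \<cdot> s') = Ident C P" .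
    show "\<exists>P\<in>PP. \<exists>\<phi>\<in>Hom C X P. \<exists>\<psi>\<in>Hom C P X. \<psi> \<cdot> \<phi> = Ident C X \<and> \<phi> \<cdot> \<psi> = Ident C P"
      using 1 2 Q(2,3) Q'(2,3) QQ E
      by (intro bexI[of _ P] bexI[of _ "r' \<cdot> s"] bexI[of _ "r \<cdot> s'"]) (auto simp: Hom_iff PP_def P_def)
  qed
qed

text \<open>Both objects are filtered colimits of finitely presentable ones. The lifts through
  \<open>i\<close> of the legs into \<open>B\<close> form a cocone by uniqueness of lifts, and the
  induced \<open>j\<close> is a right inverse of \<open>i\<close>. That it is also a left inverse is
  tested on the legs into \<open>A\<close>, where \<open>i\<close> can be cancelled.\<close>

lemma iso_if_bijective_on_fp:
  assumes i: "i \<in> Hom C A B"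
    and bij: "\<And>P q. fp P \<Longrightarrow> q \<in> Hom C P B \<Longrightarrow> \<exists>!p. p \<in> Hom C P A \<and> i \<cdot> p = q"
  shows "\<exists>j\<in>Hom C B A. i \<cdot> j = Ident C B \<and> j \<cdot> i = Ident C A"
proof -
  obtain G where G: "\<And>X. X \<in> G \<Longrightarrow> fp X"
    "\<And>A. A \<in> Ob C \<Longrightarrow> \<exists>(J :: ('k, 'k) cat) D c. small_category \<kappa> J \<and> filtered J \<and> is_functor J C D \<and>
       (\<forall>i\<in>Ob J. FOb D i \<in> G) \<and> is_colimit J C D A c"
    by (rule generator) blast
  note [simp] = Hom_Ob[OF i]
  obtain J :: "('k, 'k) cat" and D c where J: "is_functor J C D" "\<forall>i\<in>Ob J. FOb D i \<in> G" "is_colimit J C D B c"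
    using G(2)[of B] by auto
  interpret J: category J using J(1) by (rule is_functorD)
  note cocone = is_colimit_cocone[OF J(3)]
  note [simp] = is_coconeD[OF cocone] is_functorD(3-)[OF J(1)]
  define p where "p k = (THE p. p \<in> Hom C (FOb D k) A \<and> i \<cdot> p = c k)" for k
  have p: "p k \<in> Hom C (FOb D k) A" "i \<cdot> p k = c k" if "k \<in> Ob J" for k
    using theI'[OF bij[of "FOb D k" "c k"]] that G(1) J(2) unfolding p_def by (auto simp: Hom_iff)
  have "is_cocone J C D A p"
    unfolding is_cocone_def
  proof (intro conjI ballI)
    fix u assume u: "u \<in> Ar J"
    have "fp (FOb D (Dom J u))" using u J(2) G(1) by simp
    from bij[OF this, of "c (Dom J u)"] u
    have uniq: "x = p (Dom J u)" if "x \<in> Hom C (FOb D (Dom J u)) A" "i \<cdot> x = c (Dom J u)" for x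
      using that p[of "Dom J u"] by (auto simp: Hom_iff)
    show "p (Cod J u) \<cdot> FAr D u = p (Dom J u)"
      using u p[of "Cod J u"] i cmp_assoc[of "FAr D u" "p (Cod J u)" i]
      by (intro uniq) (auto simp: Hom_iff)
  qed (use p in auto)
  then obtain j where j: "j \<in> Hom C B A" "\<And>k. k \<in> Ob J \<Longrightarrow> j \<cdot> c k = p k"
    using is_colimit_ex1[OF J(3)] by blast
  have ij: "i \<cdot> j = Ident C B"
    by (rule is_colimit_eqI[OF category_axioms J(1,3), of _ B]) (use i j p in \<open>auto simp: Hom_iff\<close>)
  obtain J' :: "('k, 'k) cat" and D' c' where J': "is_functor J' C D'" "\<forall>i\<in>Ob J'. FOb D' i \<in> G" "is_colimit J' C D' A c'"
    using G(2)[of A] by auto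
  note c' = is_coconeD[OF is_colimit_cocone[OF J'(3)]]
  have "j \<cdot> i = Ident C A"
  proof (rule is_colimit_eqI[OF category_axioms J'(1,3)])
    fix k assume k: "k \<in> Ob J'"
    have "\<exists>!x. x \<in> Hom C (FOb D' k) A \<and> i \<cdot> x = i \<cdot> c' k"
      by (rule bij) (use k i J'(2) G(1) c' in \<open>auto simp: Hom_iff\<close>)
    moreover have "i \<cdot> (j \<cdot> (i \<cdot> c' k)) = i \<cdot> c' k"
    proof -
      have "i \<cdot> (j \<cdot> (i \<cdot> c' k)) = (i \<cdot> j) \<cdot> (i \<cdot> c' k)" using i j(1) c' k by (simp add: Hom_iff)
      also have "\<dots> = i \<cdot> c' k" unfolding ij using i c' k by (simp add: Hom_iff)
      finally show ?thesis .
    qed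
    moreover have "j \<cdot> (i \<cdot> c' k) \<in> Hom C (FOb D' k) A" "c' k \<in> Hom C (FOb D' k) A"
      using k i j(1) c' by (simp_all add: Hom_iff)
    ultimately have "j \<cdot> (i \<cdot> c' k) = c' k" by blast
    then show "(j \<cdot> i) \<cdot> c' k = Ident C A \<cdot> c' k" using i j(1) c' k by (simp add: Hom_iff)
  next
    show "j \<cdot> i \<in> Hom C A A" "Ident C A \<in> Hom C A A" using i j(1) by (simp_all add: Hom_iff)
  qed
  then show ?thesis using j(1) ij by blast
qed

end

section \<open>The rational fixpoint of a finitary endofunctor\<close>

text \<open>Makes an equation for \<open>a \<cdot> b\<close> applicable inside a composite nested to
  the right.\<close>

lemma (in category) cmp_reassoc:
  "a \<cdot> b = c \<Longrightarrow> a \<in> Ar C \<Longrightarrow> b \<in> Ar C \<Longrightarrow> Dom C a = Cod C b \<Longrightarrow> x \<in> Ar C \<Longrightarrow> Cod C x = Dom C b \<Longrightarrow>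
   a \<cdot> (b \<cdot> x) = c \<cdot> x"
  using cmp_assoc[of x b a] by (simp del: cmp_assoc)

text \<open>The functor \<open>T\<close> is kept abstract; the instance of interest is
  \<open>H(-) + Y\<close>, whose coalgebras are the flat equations with parameters in
  \<open>Y\<close>.\<close>

locale finitary_endofunctor = lfp_category C S \<kappa> for C :: "('o, 'm) cat" (structure) and S and \<kappa> :: "'k rel" +
  fixes T :: "('o, 'm, 'o, 'm) func"
  assumes finitary: "finitary \<kappa> C C T"
begin

lemma T_functor: "is_functor C C T"
  using finitary by (simp add: finitary_def)

lemmas T_simps [simp] = is_functorD(3-)[OF T_functor]

definition coalgebra :: "'m \<Rightarrow> bool" where
  "coalgebra e \<longleftrightarrow> e \<in> Ar C \<and> fp (Dom C e) \<and> Cod C e = FOb T (Dom C e)"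

definition coalgebra_hom :: "'m \<Rightarrow> 'm \<Rightarrow> 'm \<Rightarrow> bool" where
  "coalgebra_hom e f h \<longleftrightarrow> h \<in> Ar C \<and> Dom C h = Dom C e \<and> Cod C h = Dom C f \<and> FAr T h \<cdot> e = f \<cdot> h"

lemma coalgebraI: "e \<in> Ar C \<Longrightarrow> fp (Dom C e) \<Longrightarrow> Cod C e = FOb T (Dom C e) \<Longrightarrow> coalgebra e"
  by (simp add: coalgebra_def)

lemma coalgebraD [simp]:
  assumes "coalgebra e"
  shows "e \<in> Ar C" "fp (Dom C e)" "Cod C e = FOb T (Dom C e)"
  using assms by (auto simp: coalgebra_def)

lemma coalgebra_homD:
  assumes "coalgebra_hom e f h"
  shows "h \<in> Ar C" "Dom C h = Dom C e" "Cod C h = Dom C f" "FAr T h \<cdot> e = f \<cdot> h"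
  using assms by (auto simp: coalgebra_hom_def)

lemma coalgebra_hom_cmp:
  assumes "coalgebra e" "coalgebra f" "coalgebra g" "coalgebra_hom e f h" "coalgebra_hom f g k"
  shows "coalgebra_hom e g (k \<cdot> h)"
proof -
  note [simp] = coalgebra_homD(1-3)[OF assms(4)] coalgebra_homD(1-3)[OF assms(5)]
  have "FAr T (k \<cdot> h) \<cdot> e = FAr T k \<cdot> (f \<cdot> h)"
    using assms(1-3) by (simp add: coalgebra_homD(4)[OF assms(4)])
  also have "\<dots> = g \<cdot> (k \<cdot> h)"
    using assms(1-3) cmp_reassoc[OF coalgebra_homD(4)[OF assms(5)], of h] by simp
  finally show ?thesis by (simp add: coalgebra_hom_def)
qed

text \<open>Condition \<open>eq\<close> makes \<open>FAr T k \<cdot> f\<close> compatible with the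
  coequalizer \<open>k\<close> of \<open>p\<close> and \<open>q\<close>, whose codomain thus
  inherits a coalgebra structure. The condition is phrased for all \<open>k\<close> so as to cover
  two cases: \<open>p\<close> and \<open>q\<close> are coalgebra morphisms from a common source, or
  \<open>f\<close> already identifies them.\<close>

lemma coalgebra_coequalizer:
  assumes f: "coalgebra f" and P: "fp P" and p: "p \<in> Hom C P (Dom C f)" and q: "q \<in> Hom C P (Dom C f)"
    and eq: "\<And>k. k \<in> Ar C \<Longrightarrow> Dom C k = Dom C f \<Longrightarrow> k \<cdot> p = k \<cdot> q \<Longrightarrow> FAr T k \<cdot> (f \<cdot> p) = FAr T k \<cdot> (f \<cdot> q)"
  obtains g k where "coalgebra g" "coalgebra_hom f g k" "k \<cdot> p = k \<cdot> q"
proof -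
  obtain k where k: "is_coequalizer C p q k" using ex_coequalizer[OF p q] by blast
  then have k1: "k \<in> Ar C" "Dom C k = Dom C f" "k \<cdot> p = k \<cdot> q"
    using p by (auto simp: is_coequalizer_def Hom_iff)
  have "(FAr T k \<cdot> f) \<cdot> p = (FAr T k \<cdot> f) \<cdot> q"
    using eq[OF k1] f p q k1(1,2) by (simp add: Hom_iff)
  moreover have "FAr T k \<cdot> f \<in> Ar C" "Dom C (FAr T k \<cdot> f) = Cod C p" "Cod C (FAr T k \<cdot> f) = FOb T (Cod C k)"
    using f p k1(1,2) by (simp_all add: Hom_iff)
  ultimately have "\<exists>!g. g \<in> Hom C (Cod C k) (Cod C (FAr T k \<cdot> f)) \<and> g \<cdot> k = FAr T k \<cdot> f"
    using k unfolding is_coequalizer_def by blast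
  then obtain g where g: "g \<in> Hom C (Cod C k) (FOb T (Cod C k))" "g \<cdot> k = FAr T k \<cdot> f"
    using f k1(1,2) by auto
  have "fp (Cod C k)" by (rule fp_coequalizer[OF coalgebraD(2)[OF f] P p q k])
  then have "coalgebra g" using g(1) by (intro coalgebraI) (simp_all add: Hom_iff)
  moreover have "coalgebra_hom f g k" using g k1 by (simp add: coalgebra_hom_def Hom_iff)
  ultimately show ?thesis using that k1(3) by blast
qed

end

section \<open>A small filtered category of coalgebras\<close>

locale coalgebra_skeleton = finitary_endofunctor C S \<kappa> T
  for C :: "('o, 'm) cat" (structure) and S and \<kappa> :: "'k rel" and T +
  fixes PP :: "'o set"
  assumes small_PP: "small \<kappa> PP" and fp_PP: "P \<in> PP \<Longrightarrow> fp P"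
    and PP_dense: "fp X \<Longrightarrow> \<exists>P\<in>PP. \<exists>\<phi>\<in>Hom C X P. \<exists>\<psi>\<in>Hom C P X. \<psi> \<cdot> \<phi> = Ident C X \<and> \<phi> \<cdot> \<psi> = Ident C P"
begin

text \<open>Restricting carriers to the representatives \<open>PP\<close> makes the category small.
  A coalgebra is recovered from its structure map, so the structure maps themselves serve as
  objects.\<close>

definition EQ :: "('m, 'm \<times> 'm \<times> 'm) cat" where
  "EQ = structured_cat C {e. coalgebra e \<and> Dom C e \<in> PP} (Dom C) (\<lambda>e h f. FAr T h \<cdot> e = f \<cdot> h)"

definition carrier :: "('m, 'm \<times> 'm \<times> 'm, 'o, 'm) func" where
  "carrier = \<lparr>FOb = Dom C, FAr = fst \<circ> snd\<rparr>"

lemma carrier_simps [simp]: "FOb carrier = Dom C" "FAr carrier (e, h, f) = h"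
  by (simp_all add: carrier_def)

lemma EQ_simps [simp]:
  "e \<in> Ob EQ \<longleftrightarrow> coalgebra e \<and> Dom C e \<in> PP"
  "(e, h, f) \<in> Ar EQ \<longleftrightarrow> e \<in> Ob EQ \<and> f \<in> Ob EQ \<and> coalgebra_hom e f h"
  "Dom EQ (e, h, f) = e" "Cod EQ (e, h, f) = f" "Ident EQ e = (e, Ident C (Dom C e), e)"
  "(f', g, z) \<cdot>\<^bsub>EQ\<^esub> (x, h, f) = (x, g \<cdot> h, z)"
  by (auto simp: EQ_def structured_cat_def coalgebra_hom_def Hom_iff)

lemma category_EQ: "category EQ"
  unfolding EQ_def
proof (rule category_structured_cat)
  fix e f g h k
  assume *: "e \<in> {e. coalgebra e \<and> Dom C e \<in> PP}" "f \<in> {e. coalgebra e \<and> Dom C e \<in> PP}"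
    "g \<in> {e. coalgebra e \<and> Dom C e \<in> PP}" "h \<in> Hom C (Dom C e) (Dom C f)" "k \<in> Hom C (Dom C f) (Dom C g)"
    "FAr T h \<cdot> e = f \<cdot> h" "FAr T k \<cdot> f = g \<cdot> k"
  have "coalgebra_hom e g (k \<cdot> h)"
    using * by (intro coalgebra_hom_cmp[of e f g]) (auto simp: coalgebra_hom_def Hom_iff)
  then show "FAr T (k \<cdot> h) \<cdot> e = g \<cdot> (k \<cdot> h)" by (rule coalgebra_homD)
qed auto

lemma functor_carrier: "is_functor EQ C carrier"
  unfolding is_functor_def
  using category_EQ category_axioms by (auto simp: Hom_iff coalgebra_hom_def)

lemma small_EQ: "small_category \<kappa> EQ"
proof -
  have "Ob EQ \<subseteq> (\<Union>P\<in>PP. Hom C P (FOb T P))"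
    by (auto simp: Hom_iff)
  moreover have "small \<kappa> (\<Union>P\<in>PP. Hom C P (FOb T P))"
    using small_PP fp_PP by (intro small_UN[OF \<kappa>] small_Hom) auto
  ultimately have Ob: "small \<kappa> (Ob EQ)" by (rule small_subset[rotated])
  have "Ar EQ \<subseteq> (\<Union>e\<in>Ob EQ. \<Union>f\<in>Ob EQ. (\<lambda>h. (e, h, f)) ` Hom C (Dom C e) (Dom C f))"
  proof
    fix u assume u: "u \<in> Ar EQ"
    obtain e h f where ehf: "u = (e, h, f)" by (cases u)
    then have "e \<in> Ob EQ" "f \<in> Ob EQ" "h \<in> Hom C (Dom C e) (Dom C f)"
      using u by (simp_all add: Hom_iff coalgebra_hom_def)
    then show "u \<in> (\<Union>e\<in>Ob EQ. \<Union>f\<in>Ob EQ. (\<lambda>h. (e, h, f)) ` Hom C (Dom C e) (Dom C f))"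
      using ehf by blast
  qed
  moreover have "small \<kappa> (\<Union>e\<in>Ob EQ. \<Union>f\<in>Ob EQ. (\<lambda>h. (e, h, f)) ` Hom C (Dom C e) (Dom C f))"
    using Ob by (intro small_UN[OF \<kappa>] small_image small_Hom) auto
  ultimately have "small \<kappa> (Ar EQ)" by (rule small_subset[rotated])
  then show ?thesis using Ob category_EQ by (simp add: small_category_def)
qed

text \<open>The structure map is conjugated by an isomorphism onto a representative carrier, which
  then is an isomorphism of coalgebras.\<close>

lemma ex_representative:
  assumes w: "coalgebra w"
  shows "\<exists>w' \<phi> \<psi>. w' \<in> Ob EQ \<and> coalgebra_hom w w' \<phi> \<and> coalgebra_hom w' w \<psi> \<and>
    \<psi> \<cdot> \<phi> = Ident C (Dom C w) \<and> \<phi> \<cdot> \<psi> = Ident C (Dom C w')"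
proof -
  obtain P \<phi> \<psi> where P: "P \<in> PP" "\<phi> \<in> Hom C (Dom C w) P" "\<psi> \<in> Hom C P (Dom C w)"
    "\<psi> \<cdot> \<phi> = Ident C (Dom C w)" "\<phi> \<cdot> \<psi> = Ident C P"
    using PP_dense[of "Dom C w"] w by auto
  let ?w = "FAr T \<phi> \<cdot> (w \<cdot> \<psi>)"
  have "coalgebra ?w"
    using w P(1-3) fp_PP by (intro coalgebraI) (simp_all add: Hom_iff)
  moreover have "Dom C ?w = P"
    using w P(1-3) by (simp add: Hom_iff)
  moreover have "coalgebra_hom w ?w \<phi>"
    using w P(2-4) by (simp add: coalgebra_hom_def Hom_iff)
  moreover have "coalgebra_hom ?w w \<psi>"
  proof -
    have "FAr T \<psi> \<cdot> ?w = FAr T (\<psi> \<cdot> \<phi>) \<cdot> (w \<cdot> \<psi>)" using w P(2,3) by (simp add: Hom_iff)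
    also have "\<dots> = w \<cdot> \<psi>" unfolding P(4) using w P(2,3) by (simp add: Hom_iff)
    finally show ?thesis using w P(2,3) by (simp add: coalgebra_hom_def Hom_iff)
  qed
  ultimately show ?thesis using P(1,4,5) by (intro exI[of _ ?w] exI[of _ \<phi>] exI[of _ \<psi>]) simp
qed

text \<open>Initial objects, binary coproducts and coequalizers of finitely presentable objects are
  finitely presentable, and each of these constructions lifts to coalgebras. The lifted carrier may
  lie outside \<open>PP\<close>, so a coalgebra morphism into a representative is appended.\<close>

lemma filtered_EQ: "filtered EQ"
  unfolding filtered_def
proof (intro conjI ballI impI)
  obtain I where I: "is_initial C I" using ex_initial by blast
  then have "FOb T I \<in> Ob C" by (simp add: is_initial_def)
  then obtain w where "w \<in> Hom C I (FOb T I)" using I unfolding is_initial_def by blast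
  then have "coalgebra w" using fp_initial[OF I] by (intro coalgebraI) (simp_all add: Hom_iff)
  then show "Ob EQ \<noteq> {}" using ex_representative by blast
next
  fix e f assume ef: "e \<in> Ob EQ" "f \<in> Ob EQ"
  let ?X = "Dom C e" and ?Y = "Dom C f"
  have XY [simp]: "?X \<in> Ob C" "?Y \<in> Ob C" "coalgebra e" "coalgebra f" using ef by auto
  \<comment> \<open>The coproduct of the two coalgebras; both injections are coalgebra morphisms
    into it.\<close>
  let ?g = "\<langle>FAr T (inl S ?X ?Y) \<cdot> e, FAr T (inr S ?X ?Y) \<cdot> f\<rangle>"
  have g: "coalgebra ?g" using fp_cop[of ?X ?Y] by (intro coalgebraI) simp_all
  have h: "coalgebra_hom e ?g (inl S ?X ?Y)" "coalgebra_hom f ?g (inr S ?X ?Y)"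
    by (simp_all add: coalgebra_hom_def)
  obtain g' \<phi> where g': "g' \<in> Ob EQ" "coalgebra_hom ?g g' \<phi>" using ex_representative[OF g] by blast
  have "coalgebra_hom e g' (\<phi> \<cdot> inl S ?X ?Y)" "coalgebra_hom f g' (\<phi> \<cdot> inr S ?X ?Y)"
    using g' g h by (auto intro!: coalgebra_hom_cmp[of _ ?g])
  then have "(e, \<phi> \<cdot> inl S ?X ?Y, g') \<in> Hom EQ e g'" "(f, \<phi> \<cdot> inr S ?X ?Y, g') \<in> Hom EQ f g'"
    using ef g' by (simp_all add: Hom_iff)
  then show "\<exists>k\<in>Ob EQ. Hom EQ e k \<noteq> {} \<and> Hom EQ f k \<noteq> {}" using g'(1) by blast
next
  fix u v assume uv: "u \<in> Ar EQ" "v \<in> Ar EQ" "Dom EQ u = Dom EQ v \<and> Cod EQ u = Cod EQ v"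
  obtain e p f where u: "u = (e, p, f)" by (cases u)
  obtain q where v: "v = (e, q, f)" using uv u by (cases v) auto
  have ef: "coalgebra e" "coalgebra f" "coalgebra_hom e f p" "coalgebra_hom e f q" "f \<in> Ob EQ"
    using uv by (auto simp: u v)
  note [simp] = ef(1,2) coalgebra_homD(1-3)[OF ef(3)] coalgebra_homD(1-3)[OF ef(4)]
  have pq: "p \<in> Hom C (Dom C e) (Dom C f)" "q \<in> Hom C (Dom C e) (Dom C f)" by (simp_all add: Hom_iff)
  have "FAr T k \<cdot> (f \<cdot> p) = FAr T k \<cdot> (f \<cdot> q)" if k: "k \<in> Ar C" "Dom C k = Dom C f" "k \<cdot> p = k \<cdot> q" for k
  proof -
    have "FAr T k \<cdot> (f \<cdot> p) = FAr T (k \<cdot> p) \<cdot> e"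
      unfolding coalgebra_homD(4)[OF ef(3), symmetric] using k(1,2) by simp
    also have "\<dots> = FAr T (k \<cdot> q) \<cdot> e" unfolding k(3) ..
    also have "\<dots> = FAr T k \<cdot> (f \<cdot> q)"
      unfolding coalgebra_homD(4)[OF ef(4), symmetric] using k(1,2) by simp
    finally show ?thesis .
  qed
  then obtain g k where g: "coalgebra g" "coalgebra_hom f g k" "k \<cdot> p = k \<cdot> q"
    using coalgebra_coequalizer[OF ef(2) _ pq] by auto
  note [simp] = coalgebra_homD(1-3)[OF g(2)]
  obtain g' \<phi> where g': "g' \<in> Ob EQ" "coalgebra_hom g g' \<phi>" using ex_representative[OF g(1)] by blast
  note [simp] = coalgebra_homD(1-3)[OF g'(2)]
  have "coalgebra_hom f g' (\<phi> \<cdot> k)" using coalgebra_hom_cmp[OF _ g(1) _ g(2) g'(2)] g' by simp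
  then show "\<exists>w\<in>Ar EQ. Dom EQ w = Cod EQ u \<and> w \<cdot>\<^bsub>EQ\<^esub> u = w \<cdot>\<^bsub>EQ\<^esub> v"
    using g' ef(5) g(3) by (intro bexI[of _ "(f, \<phi> \<cdot> k, g')"]) (simp_all add: u v)
qed

end

section \<open>The colimit of the coalgebras and its fixpoint structure\<close>

locale coalgebra_colimit = coalgebra_skeleton C S \<kappa> T PP
  for C :: "('o, 'm) cat" (structure) and S and \<kappa> :: "'k rel" and T PP +
  fixes R :: 'o and c :: "'m \<Rightarrow> 'm"
  assumes colimit: "is_colimit EQ C carrier R c"
begin

lemmas cocone = is_colimit_cocone[OF colimit]

lemma R_Ob [simp]: "R \<in> Ob C"
  using is_coconeD(1)[OF cocone] .

lemma c_simps [simp]: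
  assumes "coalgebra e" "Dom C e \<in> PP"
  shows "c e \<in> Ar C" "Dom C (c e) = Dom C e" "Cod C (c e) = R"
  using is_coconeD(2-4)[OF cocone, of e] assms by auto

lemma c_nat:
  assumes "e \<in> Ob EQ" "f \<in> Ob EQ" "coalgebra_hom e f h"
  shows "c f \<cdot> h = c e"
  using is_coconeD(5)[OF cocone, of "(e, h, f)"] assms by simp

definition representative :: "'m \<Rightarrow> 'm \<times> 'm \<times> 'm" where
  "representative w = (SOME (w', \<phi>, \<psi>). w' \<in> Ob EQ \<and> coalgebra_hom w w' \<phi> \<and> coalgebra_hom w' w \<psi> \<and>
    \<psi> \<cdot> \<phi> = Ident C (Dom C w) \<and> \<phi> \<cdot> \<psi> = Ident C (Dom C w'))"

text \<open>The colimit cocone \<open>c\<close> is indexed by \<open>EQ\<close> only; composing with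
  the isomorphism to a representative extends it to all coalgebras. By \<open>sol_unique\<close> the
  result is the only coalgebra morphism into \<open>R\<close>.\<close>

definition sol :: "'m \<Rightarrow> 'm" where
  "sol w = (case representative w of (w', \<phi>, \<psi>) \<Rightarrow> c w' \<cdot> \<phi>)"

lemma sol_representative:
  assumes "coalgebra w"
  obtains w' \<phi> \<psi> where "w' \<in> Ob EQ" "coalgebra_hom w w' \<phi>" "coalgebra_hom w' w \<psi>"
    "\<psi> \<cdot> \<phi> = Ident C (Dom C w)" "sol w = c w' \<cdot> \<phi>"
proof -
  have "case representative w of (w', \<phi>, \<psi>) \<Rightarrow> w' \<in> Ob EQ \<and> coalgebra_hom w w' \<phi> \<and> coalgebra_hom w' w \<psi> \<and>
    \<psi> \<cdot> \<phi> = Ident C (Dom C w) \<and> \<phi> \<cdot> \<psi> = Ident C (Dom C w')"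
    unfolding representative_def using ex_representative[OF assms] by (rule_tac someI_ex) auto
  then show ?thesis using that by (auto simp: sol_def)
qed

lemma sol_simps [simp]:
  assumes "coalgebra w"
  shows "sol w \<in> Ar C" "Dom C (sol w) = Dom C w" "Cod C (sol w) = R"
  by (rule sol_representative[OF assms]; simp add: coalgebra_hom_def)+

lemma sol_nat:
  assumes wv: "coalgebra w" "coalgebra v" and h: "coalgebra_hom w v h"
  shows "sol v \<cdot> h = sol w"
proof -
  obtain w' \<phi> \<psi> where w': "w' \<in> Ob EQ" "coalgebra_hom w w' \<phi>" "coalgebra_hom w' w \<psi>"
    "\<psi> \<cdot> \<phi> = Ident C (Dom C w)" "sol w = c w' \<cdot> \<phi>" by (rule sol_representative[OF wv(1)])
  obtain v' \<theta> where v': "v' \<in> Ob EQ" "coalgebra_hom v v' \<theta>" "sol v = c v' \<cdot> \<theta>"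
    by (rule sol_representative[OF wv(2)])
  note [simp] = wv coalgebra_homD(1-3)[OF h] coalgebra_homD(1-3)[OF w'(2)] coalgebra_homD(1-3)[OF w'(3)]
    coalgebra_homD(1-3)[OF v'(2)]
  have [simp]: "coalgebra w'" "coalgebra v'" "Dom C v' \<in> PP" "Dom C w' \<in> PP" using w' v' by auto
  \<comment> \<open>Conjugated by the representatives, \<open>h\<close> becomes an arrow of
    \<open>EQ\<close>, along which the cocone \<open>c\<close> is natural.\<close>
  have "coalgebra_hom w' v' (\<theta> \<cdot> (h \<cdot> \<psi>))"
    by (intro coalgebra_hom_cmp[of w' v v'] coalgebra_hom_cmp[of w' w v] h w' v') simp_all
  from c_nat[OF w'(1) v'(1) this] have "c w' \<cdot> \<phi> = (c v' \<cdot> (\<theta> \<cdot> (h \<cdot> \<psi>))) \<cdot> \<phi>" by simp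
  also have "\<dots> = c v' \<cdot> (\<theta> \<cdot> (h \<cdot> (\<psi> \<cdot> \<phi>)))" by simp
  also have "\<dots> = c v' \<cdot> (\<theta> \<cdot> h)" unfolding w'(4) by simp
  finally show ?thesis by (simp add: w' v')
qed

lemma sol_eq_c:
  assumes "e \<in> Ob EQ"
  shows "sol e = c e"
proof -
  have "coalgebra e" using assms by simp
  then obtain w' \<phi> where "w' \<in> Ob EQ" "coalgebra_hom e w' \<phi>" "sol e = c w' \<cdot> \<phi>"
    by (rule sol_representative)
  then show ?thesis using c_nat[OF assms] by simp
qed

text \<open>Naturality determines the leg at any coalgebra from the leg at its representative, so
  the universal property can be stated over all coalgebras, without the skeleton.\<close>

lemma universal:
  assumes Z: "Z \<in> Ob C" and s: "\<And>e. coalgebra e \<Longrightarrow> s e \<in> Hom C (Dom C e) Z"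
    and nat: "\<And>e f h. coalgebra e \<Longrightarrow> coalgebra f \<Longrightarrow> coalgebra_hom e f h \<Longrightarrow> s f \<cdot> h = s e"
  shows "\<exists>!k. k \<in> Hom C R Z \<and> (\<forall>e. coalgebra e \<longrightarrow> k \<cdot> sol e = s e)"
proof -
  have "is_cocone EQ C carrier Z s"
    unfolding is_cocone_def using Z s nat by auto
  from is_colimit_ex1[OF colimit this]
  have ex1: "\<exists>!k. k \<in> Hom C R Z \<and> (\<forall>e\<in>Ob EQ. k \<cdot> c e = s e)" .
  have eq: "(\<forall>e\<in>Ob EQ. k \<cdot> c e = s e) \<longleftrightarrow> (\<forall>e. coalgebra e \<longrightarrow> k \<cdot> sol e = s e)" if k: "k \<in> Hom C R Z" for k
  proof
    assume *: "\<forall>e\<in>Ob EQ. k \<cdot> c e = s e"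
    show "\<forall>e. coalgebra e \<longrightarrow> k \<cdot> sol e = s e"
    proof (intro allI impI)
      fix w assume w: "coalgebra w"
      obtain w' \<phi> where w': "w' \<in> Ob EQ" "coalgebra_hom w w' \<phi>" "sol w = c w' \<cdot> \<phi>"
        by (rule sol_representative[OF w])
      have "coalgebra w'" using w' by simp
      have "k \<cdot> sol w = (k \<cdot> c w') \<cdot> \<phi>"
        using w' k coalgebra_homD(1-3)[OF w'(2)] by (simp add: Hom_iff)
      then show "k \<cdot> sol w = s w" using * w' nat[OF w \<open>coalgebra w'\<close> w'(2)] by simp
    qed
  next
    assume *: "\<forall>e. coalgebra e \<longrightarrow> k \<cdot> sol e = s e"
    then show "\<forall>e\<in>Ob EQ. k \<cdot> c e = s e" using sol_eq_c by auto
  qed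
  show ?thesis using ex1 by (simp only: eq cong: conj_cong)
qed

lemma fp_factor:
  assumes "fp P" "p \<in> Hom C P R"
  obtains e p' where "e \<in> Ob EQ" "p' \<in> Hom C P (Dom C e)" "sol e \<cdot> p' = p"
proof -
  note * = finitely_presentable_hom_preserves[OF \<kappa> assms(1) small_EQ filtered_EQ functor_carrier colimit]
  show ?thesis
    by (rule hom_preserves_factor[OF * assms(2)]) (use that sol_eq_c in simp)
qed

text \<open>Finitarity of \<open>T\<close> enters here: it lets maps from a finitely presentable
  object into \<open>FOb T R\<close> be factored through a stage and compared there, as in the next
  three lemmas.\<close>

lemma T_colimit: "is_colimit EQ C (func_comp T carrier) (FOb T R) (\<lambda>e. FAr T (c e))"
  by (rule finitary_colimit[OF \<kappa> finitary small_EQ filtered_EQ functor_carrier colimit])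

lemma T_hom_preserves:
  assumes "fp P"
  shows "hom_preserves EQ C (func_comp T carrier) (FOb T R) (\<lambda>e. FAr T (c e)) P"
  by (rule finitely_presentable_hom_preserves[OF \<kappa> assms small_EQ filtered_EQ
        is_functor_func_comp[OF functor_carrier T_functor] T_colimit])

lemma T_factor:
  assumes "fp P" "q \<in> Hom C P (FOb T R)"
  obtains e q' where "e \<in> Ob EQ" "q' \<in> Hom C P (FOb T (Dom C e))" "FAr T (sol e) \<cdot> q' = q"
  by (rule hom_preserves_factor[OF T_hom_preserves[OF assms(1)] assms(2)]) (use that sol_eq_c in simp)

lemma T_merge:
  assumes "fp P" "e \<in> Ob EQ" "p \<in> Hom C P (FOb T (Dom C e))" "q \<in> Hom C P (FOb T (Dom C e))"
    "FAr T (sol e) \<cdot> p = FAr T (sol e) \<cdot> q"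
  obtains f h where "f \<in> Ob EQ" "coalgebra_hom e f h" "FAr T h \<cdot> p = FAr T h \<cdot> q"
proof (rule hom_preserves_merge[OF T_hom_preserves[OF assms(1)] assms(2), of p q])
  fix u assume u: "u \<in> Ar EQ" "Dom EQ u = e" "FAr (func_comp T carrier) u \<cdot> p = FAr (func_comp T carrier) u \<cdot> q"
  obtain e' h f where "u = (e', h, f)" by (cases u)
  then show ?thesis using that[of f h] u by simp
qed (use assms sol_eq_c[OF assms(2)] in auto)

lemma ex_structure: "\<exists>i\<in>Hom C R (FOb T R). \<forall>e. coalgebra e \<longrightarrow> i \<cdot> sol e = FAr T (sol e) \<cdot> e"
proof -
  have "\<exists>!k. k \<in> Hom C R (FOb T R) \<and> (\<forall>e. coalgebra e \<longrightarrow> k \<cdot> sol e = FAr T (sol e) \<cdot> e)"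
  proof (rule universal)
    fix e f h assume ef: "coalgebra e" "coalgebra f" and h: "coalgebra_hom e f h"
    note [simp] = ef coalgebra_homD(1-3)[OF h]
    have "(FAr T (sol f) \<cdot> f) \<cdot> h = FAr T (sol f \<cdot> h) \<cdot> e"
      using coalgebra_homD(4)[OF h] by simp
    then show "(FAr T (sol f) \<cdot> f) \<cdot> h = FAr T (sol e) \<cdot> e" by (simp only: sol_nat[OF ef h])
  qed (auto simp: Hom_iff)
  then show ?thesis by blast
qed

definition struct :: 'm where
  "struct = (SOME i. i \<in> Hom C R (FOb T R) \<and> (\<forall>e. coalgebra e \<longrightarrow> i \<cdot> sol e = FAr T (sol e) \<cdot> e))"

lemma struct:
  "struct \<in> Hom C R (FOb T R)" "coalgebra e \<Longrightarrow> struct \<cdot> sol e = FAr T (sol e) \<cdot> e"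
proof -
  have "struct \<in> Hom C R (FOb T R) \<and> (\<forall>e. coalgebra e \<longrightarrow> struct \<cdot> sol e = FAr T (sol e) \<cdot> e)"
    unfolding struct_def by (rule someI_ex) (use ex_structure in blast)
  then show "struct \<in> Hom C R (FOb T R)" "coalgebra e \<Longrightarrow> struct \<cdot> sol e = FAr T (sol e) \<cdot> e" by auto
qed

lemma struct_simps [simp]: "struct \<in> Ar C" "Dom C struct = R" "Cod C struct = FOb T R"
  using struct(1) by (auto simp: Hom_iff)

lemma struct_sol_assoc:
  assumes "coalgebra e" "x \<in> Ar C" "Cod C x = Dom C e"
  shows "struct \<cdot> (sol e \<cdot> x) = FAr T (sol e) \<cdot> (e \<cdot> x)"
  using cmp_reassoc[OF struct(2)[OF assms(1)], of x] assms by simp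

text \<open>A factorization \<open>t'\<close> of \<open>t\<close> through a stage \<open>e\<close>
  need not be a coalgebra morphism, but the two sides of that condition agree after
  \<open>FAr T (sol e)\<close>. As \<open>Dom C w\<close> is finitely presentable, they agree
  already at a later stage \<open>f\<close>; there \<open>h \<cdot> t'\<close> is a coalgebra
  morphism and naturality of \<open>sol\<close> applies.\<close>

lemma sol_unique:
  assumes w: "coalgebra w" and t: "t \<in> Hom C (Dom C w) R" and eq: "struct \<cdot> t = FAr T t \<cdot> w"
  shows "t = sol w"
proof -
  obtain e t' where e: "e \<in> Ob EQ" "t' \<in> Hom C (Dom C w) (Dom C e)" "sol e \<cdot> t' = t"
    using fp_factor[OF _ t] w by auto
  have [simp]: "coalgebra e" "t' \<in> Ar C" "Dom C t' = Dom C w" "Cod C t' = Dom C e" "coalgebra w"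
    using e w by (auto simp: Hom_iff)
  have "FAr T (sol e) \<cdot> (e \<cdot> t') = struct \<cdot> (sol e \<cdot> t')" by (simp add: struct_sol_assoc)
  also have "\<dots> = FAr T (sol e \<cdot> t') \<cdot> w" using eq e(3) by simp
  also have "\<dots> = FAr T (sol e) \<cdot> (FAr T t' \<cdot> w)" by simp
  finally have *: "FAr T (sol e) \<cdot> (e \<cdot> t') = FAr T (sol e) \<cdot> (FAr T t' \<cdot> w)" .
  have "fp (Dom C w)" by simp
  from T_merge[OF this e(1) _ _ *] obtain f h where f: "f \<in> Ob EQ" "coalgebra_hom e f h"
    "FAr T h \<cdot> (e \<cdot> t') = FAr T h \<cdot> (FAr T t' \<cdot> w)" by (auto simp: Hom_iff)
  have [simp]: "coalgebra f" using f by simp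
  note [simp] = coalgebra_homD(1-3)[OF f(2)]
  have "FAr T (h \<cdot> t') \<cdot> w = f \<cdot> (h \<cdot> t')"
    using f(3) cmp_reassoc[OF coalgebra_homD(4)[OF f(2)], of t'] by simp
  then have "coalgebra_hom w f (h \<cdot> t')" by (simp add: coalgebra_hom_def)
  then have "sol w = sol f \<cdot> (h \<cdot> t')" using sol_nat[of w f] by simp
  also have "\<dots> = sol e \<cdot> t'" using cmp_reassoc[OF sol_nat[OF _ _ f(2)], of t'] by simp
  finally show ?thesis using e(3) by simp
qed

text \<open>For existence, \<open>P\<close> is adjoined to a stage as an object of new variables.
  For uniqueness, two maps with the same image under \<open>struct\<close> are collapsed by passing
  to a quotient of a later stage.\<close>

lemma struct_bijective_on_fp:
  assumes P: "fp P" and q: "q \<in> Hom C P (FOb T R)"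
  shows "\<exists>!p. p \<in> Hom C P R \<and> struct \<cdot> p = q"
proof (rule ex_ex1I)
  note [simp] = fp_Ob[OF P]
  obtain e q' where e: "e \<in> Ob EQ" "q' \<in> Hom C P (FOb T (Dom C e))" "FAr T (sol e) \<cdot> q' = q"
    by (rule T_factor[OF P q])
  have [simp]: "coalgebra e" "Dom C e \<in> Ob C" "q' \<in> Ar C" "Dom C q' = P" "Cod C q' = FOb T (Dom C e)"
    using e by (auto simp: Hom_iff)
  let ?l = "inl S P (Dom C e)" and ?r = "inr S P (Dom C e)"
  \<comment> \<open>A coalgebra on the coproduct of \<open>P\<close> and \<open>Dom C e\<close>: on
    \<open>P\<close> it is the lift \<open>q'\<close>, on \<open>Dom C e\<close> it is
    \<open>e\<close>, both landing in the second summand. Its solution restricted to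
    \<open>P\<close> is the required preimage of \<open>q\<close>.\<close>
  let ?g = "\<langle>FAr T ?r \<cdot> q', FAr T ?r \<cdot> e\<rangle>"
  have g: "coalgebra ?g" using fp_cop[OF P] by (intro coalgebraI) simp_all
  note [simp] = sol_simps[OF g]
  have "coalgebra_hom e ?g ?r" by (simp add: coalgebra_hom_def)
  then have r: "sol ?g \<cdot> ?r = sol e" using sol_nat[OF _ g] by simp
  have "struct \<cdot> (sol ?g \<cdot> ?l) = FAr T (sol ?g) \<cdot> (?g \<cdot> ?l)"
    by (rule struct_sol_assoc[OF g]) simp_all
  also have "\<dots> = FAr T (sol ?g \<cdot> ?r) \<cdot> q'" by simp
  also have "\<dots> = q" unfolding r by (rule e(3))
  finally have "struct \<cdot> (sol ?g \<cdot> ?l) = q" .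
  then show "\<exists>p. p \<in> Hom C P R \<and> struct \<cdot> p = q"
    by (intro exI[of _ "sol ?g \<cdot> ?l"]) (simp add: Hom_iff)
next
  fix p p' assume p: "p \<in> Hom C P R \<and> struct \<cdot> p = q" and p': "p' \<in> Hom C P R \<and> struct \<cdot> p' = q"
  obtain e1 p1 where 1: "e1 \<in> Ob EQ" "p1 \<in> Hom C P (Dom C e1)" "sol e1 \<cdot> p1 = p"
    using fp_factor[OF P] p by metis
  obtain e2 p2 where 2: "e2 \<in> Ob EQ" "p2 \<in> Hom C P (Dom C e2)" "sol e2 \<cdot> p2 = p'"
    using fp_factor[OF P] p' by metis
  obtain u v where uv: "u \<in> Ar EQ" "v \<in> Ar EQ" "Dom EQ u = e1" "Dom EQ v = e2" "Cod EQ v = Cod EQ u"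
    using filtered_upper_bound[OF filtered_EQ 1(1) 2(1)] by metis
  obtain a e where u: "u = (e1, a, e)" using uv by (cases u) auto
  obtain b where v: "v = (e2, b, e)" using uv u by (cases v) auto
  have ab: "coalgebra_hom e1 e a" "coalgebra_hom e2 e b" "e \<in> Ob EQ" using uv by (auto simp: u v)
  have [simp]: "coalgebra e1" "coalgebra e2" "coalgebra e" using ab 1 2 by auto
  note [simp] = coalgebra_homD(1-3)[OF ab(1)] coalgebra_homD(1-3)[OF ab(2)]
  have [simp]: "p1 \<in> Ar C" "Dom C p1 = P" "Cod C p1 = Dom C e1" "p2 \<in> Ar C" "Dom C p2 = P" "Cod C p2 = Dom C e2"
    using 1 2 by (auto simp: Hom_iff)
  define x where "x = a \<cdot> p1"
  define y where "y = b \<cdot> p2"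
  have [simp]: "x \<in> Ar C" "Dom C x = P" "Cod C x = Dom C e" "y \<in> Ar C" "Dom C y = P" "Cod C y = Dom C e"
    by (simp_all add: x_def y_def)
  have x: "sol e \<cdot> x = p" unfolding x_def using cmp_reassoc[OF sol_nat[OF _ _ ab(1)], of p1] 1 by simp
  have y: "sol e \<cdot> y = p'" unfolding y_def using cmp_reassoc[OF sol_nat[OF _ _ ab(2)], of p2] 2 by simp
  have "FAr T (sol e) \<cdot> (e \<cdot> x) = FAr T (sol e) \<cdot> (e \<cdot> y)"
    using struct_sol_assoc[of e x] struct_sol_assoc[of e y] x y p p' by simp
  then obtain f h where f: "f \<in> Ob EQ" "coalgebra_hom e f h" "FAr T h \<cdot> (e \<cdot> x) = FAr T h \<cdot> (e \<cdot> y)"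
    using T_merge[OF P ab(3), of "e \<cdot> x" "e \<cdot> y"] by (auto simp: Hom_iff)
  have [simp]: "coalgebra f" using f by simp
  note [simp] = coalgebra_homD(1-3)[OF f(2)]
  have fh: "f \<cdot> (h \<cdot> x) = f \<cdot> (h \<cdot> y)"
    using f(3) cmp_reassoc[OF coalgebra_homD(4)[OF f(2)], of x] cmp_reassoc[OF coalgebra_homD(4)[OF f(2)], of y]
    by simp
  have hxy: "h \<cdot> x \<in> Hom C P (Dom C f)" "h \<cdot> y \<in> Hom C P (Dom C f)" by (simp_all add: Hom_iff)
  \<comment> \<open>Since \<open>f\<close> identifies \<open>h \<cdot> x\<close> and
    \<open>h \<cdot> y\<close>, their coequalizer carries a coalgebra structure. Hence
    \<open>sol f\<close>, which factors through \<open>k\<close>, identifies them too.\<close>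
  obtain g k where g: "coalgebra g" "coalgebra_hom f g k" "k \<cdot> (h \<cdot> x) = k \<cdot> (h \<cdot> y)"
    by (rule coalgebra_coequalizer[OF \<open>coalgebra f\<close> P hxy]) (use fh in auto)
  note [simp] = coalgebra_homD(1-3)[OF g(2)] g(1)
  have *: "sol e \<cdot> z = sol g \<cdot> (k \<cdot> (h \<cdot> z))" if "z \<in> Ar C" "Cod C z = Dom C e" for z
  proof -
    have "sol e \<cdot> z = sol f \<cdot> (h \<cdot> z)" using cmp_reassoc[OF sol_nat[OF _ _ f(2)], of z] that by simp
    also have "\<dots> = sol g \<cdot> (k \<cdot> (h \<cdot> z))" using cmp_reassoc[OF sol_nat[OF _ _ g(2)], of "h \<cdot> z"] that by simp
    finally show ?thesis .
  qed
  have "sol e \<cdot> x = sol e \<cdot> y" unfolding *[of x, simplified] *[of y, simplified] g(3) ..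
  then show "p = p'" by (simp add: x y)
qed

lemma struct_iso: "\<exists>j\<in>Hom C (FOb T R) R. struct \<cdot> j = Ident C (FOb T R) \<and> j \<cdot> struct = Ident C R"
  using struct(1) struct_bijective_on_fp by (rule iso_if_bijective_on_fp)

end

context finitary_endofunctor
begin

text \<open>Collects the properties of the fixpoint without reference to representatives. The
  clauses on \<open>J\<close> and \<open>D\<close> present \<open>R\<close> as a small filtered
  colimit of carriers, so that maps into objects such as \<open>B + R\<close> can later be factored
  through a stage.\<close>

definition rational_fixpoint ::
  "('m, 'm \<times> 'm \<times> 'm) cat \<Rightarrow> ('m, 'm \<times> 'm \<times> 'm, 'o, 'm) func \<Rightarrow> 'o \<Rightarrow> 'm \<Rightarrow> 'm \<Rightarrow> ('m \<Rightarrow> 'm) \<Rightarrow> bool" where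
  "rational_fixpoint J D R i j sol \<longleftrightarrow>
     i \<in> Hom C R (FOb T R) \<and> j \<in> Hom C (FOb T R) R \<and> i \<cdot> j = Ident C (FOb T R) \<and> j \<cdot> i = Ident C R \<and>
     (\<forall>w. coalgebra w \<longrightarrow> sol w \<in> Hom C (Dom C w) R \<and> i \<cdot> sol w = FAr T (sol w) \<cdot> w \<and>
        (\<forall>t\<in>Hom C (Dom C w) R. i \<cdot> t = FAr T t \<cdot> w \<longrightarrow> t = sol w)) \<and>
     (\<forall>Z\<in>Ob C. \<forall>s. (\<forall>e. coalgebra e \<longrightarrow> s e \<in> Hom C (Dom C e) Z) \<and>
        (\<forall>e f h. coalgebra e \<and> coalgebra f \<and> coalgebra_hom e f h \<longrightarrow> s f \<cdot> h = s e) \<longrightarrow>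
        (\<exists>!k. k \<in> Hom C R Z \<and> (\<forall>e. coalgebra e \<longrightarrow> k \<cdot> sol e = s e))) \<and>
     small_category \<kappa> J \<and> filtered J \<and> is_functor J C D \<and> is_colimit J C D R sol \<and>
     (\<forall>w\<in>Ob J. coalgebra w \<and> FOb D w = Dom C w)"

theorem ex_rational_fixpoint: "\<exists>J D R i j sol. rational_fixpoint J D R i j sol"
proof -
  obtain PP where "small \<kappa> PP" "\<And>P. P \<in> PP \<Longrightarrow> fp P"
    "\<And>X. fp X \<Longrightarrow> \<exists>P\<in>PP. \<exists>\<phi>\<in>Hom C X P. \<exists>\<psi>\<in>Hom C P X. \<psi> \<cdot> \<phi> = Ident C X \<and> \<phi> \<cdot> \<psi> = Ident C P"
    by (rule fp_skeleton) blast
  then interpret coalgebra_skeleton C S \<kappa> T PP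
    by unfold_locales
  obtain R c where "is_colimit EQ C carrier R c"
    by (rule cocomplete_colimit[OF \<kappa> cocomplete small_EQ functor_carrier])
  then interpret coalgebra_colimit C S \<kappa> T PP R c
    by unfold_locales
  obtain j where j: "j \<in> Hom C (FOb T R) R" "struct \<cdot> j = Ident C (FOb T R)" "j \<cdot> struct = Ident C R"
    using struct_iso by blast
  have "is_colimit EQ C carrier R sol"
    by (rule iffD2[OF is_colimit_cong[OF category_EQ sol_eq_c] colimit])
  then have "rational_fixpoint EQ carrier R struct j sol"
    unfolding rational_fixpoint_def
    using struct j sol_unique universal small_EQ filtered_EQ functor_carrier
    by (simp add: Hom_iff)
  then show ?thesis by blast
qed

end

section \<open>Filtered colimits of coproducts\<close>

definition const_func :: "'p \<Rightarrow> 'n \<Rightarrow> ('o, 'm, 'p, 'n) func" where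
  "const_func A a = \<lparr>FOb = (\<lambda>_. A), FAr = (\<lambda>_. a)\<rparr>"

lemma const_func_simps [simp]: "FOb (const_func A a) X = A" "FAr (const_func A a) f = a"
  by (simp_all add: const_func_def)

context coproduct_category
begin

lemma is_functor_const_func: "category J \<Longrightarrow> A \<in> Ob C \<Longrightarrow> is_functor J C (const_func A (Ident C A))"
  using category_axioms by (simp add: is_functor_def Hom_iff)

text \<open>A filtered shape is nonempty and connected, so all legs of a cocone over a constant
  diagram are one and the same map.\<close>

lemma is_colimit_const_func:
  assumes J: "category J" "filtered J" and A: "A \<in> Ob C"
  shows "is_colimit J C (const_func A (Ident C A)) A (\<lambda>_. Ident C A)"
  unfolding is_colimit_def
proof (intro conjI allI impI)
  show "is_cocone J C (const_func A (Ident C A)) A (\<lambda>_. Ident C A)"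
    using A by (simp add: is_cocone_def Hom_iff)
  fix Z c assume cocone: "is_cocone J C (const_func A (Ident C A)) Z c"
  obtain i0 where i0: "i0 \<in> Ob J" using J(2) by (auto simp: filtered_def)
  have step: "c (Cod J u) = c (Dom J u)" if "u \<in> Ar J" for u
    using is_coconeD(5)[OF cocone that] is_coconeD(2,3)[OF cocone, of "Cod J u"] that category.Cod_Ob[OF J(1)]
    by simp
  have c: "c i = c i0" if i: "i \<in> Ob J" for i
  proof -
    obtain u v where "u \<in> Ar J" "v \<in> Ar J" "Dom J u = i" "Dom J v = i0" "Cod J v = Cod J u"
      by (rule filtered_upper_bound[OF J(2) i i0])
    then show ?thesis using step[of u] step[of v] by simp
  qed
  show "\<exists>!h. h \<in> Hom C A Z \<and> (\<forall>i\<in>Ob J. h \<cdot> Ident C A = c i)"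
  proof (rule ex1I)
    show "c i0 \<in> Hom C A Z \<and> (\<forall>i\<in>Ob J. c i0 \<cdot> Ident C A = c i)"
      using c is_coconeD(2-4)[OF cocone i0] by (simp add: Hom_iff)
    show "h = c i0" if "h \<in> Hom C A Z \<and> (\<forall>i\<in>Ob J. h \<cdot> Ident C A = c i)" for h
      using that i0 by (auto simp: Hom_iff)
  qed
qed

definition sum_func :: "('i, 'j, 'o, 'm) func \<Rightarrow> ('i, 'j, 'o, 'm) func \<Rightarrow> ('i, 'j, 'o, 'm) func" where
  "sum_func F G = \<lparr>FOb = (\<lambda>X. FOb F X \<oplus> FOb G X), FAr = (\<lambda>f. FAr F f \<boxplus> FAr G f)\<rparr>"

lemma sum_func_simps [simp]:
  "FOb (sum_func F G) X = FOb F X \<oplus> FOb G X" "FAr (sum_func F G) f = FAr F f \<boxplus> FAr G f"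
  by (simp_all add: sum_func_def)

lemma is_functor_sum_func:
  assumes F: "is_functor J C F" and G: "is_functor J C G"
  shows "is_functor J C (sum_func F G)"
  unfolding is_functor_def
  using is_functorD[OF F] is_functorD(3-)[OF G]
  by (simp add: Hom_iff cplus_def category.Dom_Cod_Ob category.Ident_simps category.cmp_simps)

text \<open>Colimits commute with coproducts: a cocone on the sum restricts to cocones on the
  summands, and the maps these induce are copaired.\<close>

lemma is_colimit_sum_func:
  assumes D1: "is_functor J C D1" "is_colimit J C D1 L1 c1" and D2: "is_functor J C D2" "is_colimit J C D2 L2 c2"
  shows "is_colimit J C (sum_func D1 D2) (L1 \<oplus> L2) (\<lambda>i. c1 i \<boxplus> c2 i)"
  unfolding is_colimit_def
proof (intro conjI allI impI)
  interpret J: category J using D1(1) by (rule is_functorD)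
  note cocone1 = is_colimit_cocone[OF D1(2)] and cocone2 = is_colimit_cocone[OF D2(2)]
  note [simp] = is_coconeD[OF cocone1] is_coconeD[OF cocone2] is_functorD(3-)[OF D1(1)] is_functorD(3-)[OF D2(1)]
  show "is_cocone J C (sum_func D1 D2) (L1 \<oplus> L2) (\<lambda>i. c1 i \<boxplus> c2 i)"
    by (simp add: is_cocone_def Hom_iff cplus_def)
  fix Z c assume cocone: "is_cocone J C (sum_func D1 D2) Z c"
  note c = is_coconeD[OF cocone]
  have [simp]: "c i \<in> Ar C" "Dom C (c i) = FOb D1 i \<oplus> FOb D2 i" "Cod C (c i) = Z" if "i \<in> Ob J" for i
    using c(2-4)[OF that] by auto
  have nat: "c (Dom J u) = c (Cod J u) \<cdot> (FAr D1 u \<boxplus> FAr D2 u)" if "u \<in> Ar J" for u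
    using c(5)[OF that] by simp
  have "is_cocone J C D1 Z (\<lambda>i. c i \<cdot> inl S (FOb D1 i) (FOb D2 i))"
    unfolding is_cocone_def using c(1) by (simp add: Hom_iff nat cplus_def)
  from is_colimit_ex1[OF D1(2) this] obtain h1 where
    h1: "h1 \<in> Hom C L1 Z" "\<And>i. i \<in> Ob J \<Longrightarrow> h1 \<cdot> c1 i = c i \<cdot> inl S (FOb D1 i) (FOb D2 i)" by auto
  have "is_cocone J C D2 Z (\<lambda>i. c i \<cdot> inr S (FOb D1 i) (FOb D2 i))"
    unfolding is_cocone_def using c(1) by (simp add: Hom_iff nat cplus_def)
  from is_colimit_ex1[OF D2(2) this] obtain h2 where
    h2: "h2 \<in> Hom C L2 Z" "\<And>i. i \<in> Ob J \<Longrightarrow> h2 \<cdot> c2 i = c i \<cdot> inr S (FOb D1 i) (FOb D2 i)" by auto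
  show "\<exists>!h. h \<in> Hom C (L1 \<oplus> L2) Z \<and> (\<forall>i\<in>Ob J. h \<cdot> (c1 i \<boxplus> c2 i) = c i)"
  proof (rule ex1I)
    show "\<langle>h1, h2\<rangle> \<in> Hom C (L1 \<oplus> L2) Z \<and> (\<forall>i\<in>Ob J. \<langle>h1, h2\<rangle> \<cdot> (c1 i \<boxplus> c2 i) = c i)"
      using h1 h2 by (simp add: Hom_iff cplus_def)
    fix h assume "h \<in> Hom C (L1 \<oplus> L2) Z \<and> (\<forall>i\<in>Ob J. h \<cdot> (c1 i \<boxplus> c2 i) = c i)"
    then have h: "h \<in> Ar C" "Dom C h = L1 \<oplus> L2" "Cod C h = Z" and hc: "\<And>i. i \<in> Ob J \<Longrightarrow> h \<cdot> (c1 i \<boxplus> c2 i) = c i"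
      by (auto simp: Hom_iff)
    have "h \<cdot> inl S L1 L2 = h1"
    proof (rule is_colimit_eqI[OF category_axioms D1])
      show "(h \<cdot> inl S L1 L2) \<cdot> c1 i = h1 \<cdot> c1 i" if "i \<in> Ob J" for i
        unfolding h1(2)[OF that] hc[OF that, symmetric] using h that by (simp add: cplus_def)
    qed (use h h1(1) in \<open>auto simp: Hom_iff\<close>)
    moreover have "h \<cdot> inr S L1 L2 = h2"
    proof (rule is_colimit_eqI[OF category_axioms D2])
      show "(h \<cdot> inr S L1 L2) \<cdot> c2 i = h2 \<cdot> c2 i" if "i \<in> Ob J" for i
        unfolding h2(2)[OF that] hc[OF that, symmetric] using h that by (simp add: cplus_def)
    qed (use h h2(1) in \<open>auto simp: Hom_iff\<close>)
    ultimately show "h = \<langle>h1, h2\<rangle>"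
      using copair_eta(1)[of L1 L2 h] h by simp
  qed
qed

end

section \<open>Flat equations\<close>

locale elgot_setting = lfp_category C S \<kappa> for C :: "('o, 'm) cat" (structure) and S and \<kappa> :: "'k rel" +
  fixes H :: "('o, 'm, 'o, 'm) func"
  assumes finitary_H: "finitary \<kappa> C C H"
begin

abbreviation "flat \<equiv> flat_equations \<kappa> C H S"
abbreviation "solves \<equiv> is_solution C H S"
abbreviation bullet_syntax (infixr \<open>\<bullet>\<close> 72) where "h \<bullet> e \<equiv> bullet C H S h e"
abbreviation "flat_oplus \<equiv> oplus C H S"
abbreviation "iterative \<equiv> iterative_algebra \<kappa> C H S"
abbreviation "elgot \<equiv> elgot_algebra \<kappa> C H S"

lemma H_functor: "is_functor C C H"
  using finitary_H by (simp add: finitary_def)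

lemmas H_simps [simp] = is_functorD(3-)[OF H_functor]

lemma flatI: "e \<in> Ar C \<Longrightarrow> fp (Dom C e) \<Longrightarrow> Cod C e = FOb H (Dom C e) \<oplus> A \<Longrightarrow> e \<in> flat A"
  by (simp add: flat_equations_def)

lemma flatD [simp]:
  assumes "e \<in> flat A"
  shows "e \<in> Ar C" "fp (Dom C e)" "Cod C e = FOb H (Dom C e) \<oplus> A"
  using assms by (auto simp: flat_equations_def)

text \<open>Copair form of the solution equation, to which the rewrite rules for copairs apply
  directly; the computations below start from it.\<close>

lemma solves_iff:
  assumes "e \<in> flat A" "\<alpha> \<in> Hom C (FOb H A) A"
  shows "solves A \<alpha> e s \<longleftrightarrow> s \<in> Hom C (Dom C e) A \<and> s = \<langle>\<alpha> \<cdot> FAr H s, Ident C A\<rangle> \<cdot> e"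
proof (cases "s \<in> Hom C (Dom C e) A")
  case True
  have [simp]: "A \<in> Ob C" using Hom_Ob[OF assms(2)] by simp
  have "(\<langle>\<alpha>, Ident C A\<rangle> \<cdot> (FAr H s \<boxplus> Ident C A)) \<cdot> e = \<langle>\<alpha> \<cdot> FAr H s, Ident C A\<rangle> \<cdot> e"
    using True assms by (simp add: Hom_iff cplus_def)
  then show ?thesis using True by (simp only: is_solution_def)
qed (simp add: is_solution_def)

lemma bullet_eq:
  assumes "e \<in> flat A" "h \<in> Hom C A Z"
  shows "h \<bullet> e = \<langle>inl S (FOb H (Dom C e)) Z, inr S (FOb H (Dom C e)) Z \<cdot> h\<rangle> \<cdot> e"
  using assms Hom_Ob[OF assms(2)] by (simp add: bullet_def cplus_def Hom_iff)

lemma bullet_flat: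
  assumes "e \<in> flat A" "h \<in> Hom C A Z"
  shows "h \<bullet> e \<in> flat Z" "Dom C (h \<bullet> e) = Dom C e"
proof -
  show *: "Dom C (h \<bullet> e) = Dom C e"
    using assms Hom_Ob[OF assms(2)] by (simp add: bullet_eq[OF assms] Hom_iff)
  show "h \<bullet> e \<in> flat Z"
    by (rule flatI) (use assms Hom_Ob[OF assms(2)] in \<open>simp_all add: bullet_eq[OF assms] Hom_iff\<close>)
qed

lemma bullet_bullet:
  assumes "e \<in> flat A" "h \<in> Hom C A Z" "g \<in> Hom C Z W"
  shows "g \<bullet> (h \<bullet> e) = (g \<cdot> h) \<bullet> e"
proof -
  have "g \<cdot> h \<in> Hom C A W" using assms by (simp add: Hom_iff)
  then show ?thesis
    using bullet_eq[OF bullet_flat(1)[OF assms(1,2)] assms(3)] bullet_flat[OF assms(1,2)]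
      assms Hom_Ob[OF assms(2)] Hom_Ob[OF assms(3)]
    by (simp add: bullet_eq Hom_iff)
qed

lemma bullet_Ident:
  assumes "e \<in> flat A" "A \<in> Ob C"
  shows "Ident C A \<bullet> e = e"
proof -
  have "Ident C A \<in> Hom C A A" using assms by (simp add: Hom_iff)
  then show ?thesis using assms by (simp add: bullet_eq)
qed

text \<open>In this form the combined system becomes visible: variables of \<open>f\<close> keep
  their equations, and a parameter of \<open>e\<close>, being a variable of \<open>f\<close>, is
  replaced by its right-hand side in \<open>f\<close>.\<close>

lemma oplus_eq:
  assumes "f \<in> flat A" "e \<in> flat (Dom C f)" "A \<in> Ob C"
  defines "X \<equiv> Dom C e" and "Y \<equiv> Dom C f"
  defines "Z \<equiv> FOb H (X \<oplus> Y)"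
  shows "flat_oplus A f e =
    \<langle>\<langle>inl S Z A \<cdot> FAr H (inl S X Y), \<langle>inl S Z A \<cdot> FAr H (inr S X Y), inr S Z A\<rangle> \<cdot> f\<rangle> \<cdot> e,
     \<langle>inl S Z A \<cdot> FAr H (inr S X Y), inr S Z A\<rangle> \<cdot> f\<rangle>"
  using assms(1-3) unfolding X_def Y_def Z_def by (simp add: oplus_def Let_def cplus_def cassoc_def)

lemma oplus_flat:
  assumes "f \<in> flat A" "e \<in> flat (Dom C f)" "A \<in> Ob C"
  shows "flat_oplus A f e \<in> flat A" "Dom C (flat_oplus A f e) = Dom C e \<oplus> Dom C f"
proof -
  show "Dom C (flat_oplus A f e) = Dom C e \<oplus> Dom C f"
    using assms by (simp add: oplus_eq[OF assms])
  show "flat_oplus A f e \<in> flat A"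
    by (rule flatI) (use assms in \<open>simp_all add: oplus_eq[OF assms] fp_cop\<close>)
qed

text \<open>Only the parameters of \<open>f\<close> survive in the combined system, and
  \<open>g\<close> acts on nothing else.\<close>

lemma bullet_oplus:
  assumes "f \<in> flat A" "e \<in> flat (Dom C f)" "A \<in> Ob C" and g: "g \<in> Hom C A B"
  shows "g \<bullet> flat_oplus A f e = flat_oplus B (g \<bullet> f) e"
  using bullet_eq[OF oplus_flat(1)[OF assms(1-3)] g] oplus_flat(2)[OF assms(1-3)]
    bullet_flat[OF assms(1) g] oplus_eq[OF bullet_flat(1)[OF assms(1) g], of e] assms Hom_Ob[OF g]
  by (simp add: oplus_eq bullet_eq Hom_iff)

text \<open>The shape of the equations below is common to solutions in an algebra \<open>(A, \<alpha>)\<close>, where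
  \<open>\<theta>\<close> is the identity, and to coalgebra morphisms into a fixpoint of \<open>H(-) + A\<close>.\<close>

lemma copair_oplus:
  assumes f: "f \<in> flat A" and e: "e \<in> flat (Dom C f)" and A: "A \<in> Ob C"
    and \<alpha>: "\<alpha> \<in> Hom C (FOb H B) B" and \<theta>: "\<theta> \<in> Hom C A B" and t: "t \<in> Hom C (Dom C e \<oplus> Dom C f) B"
  defines "l \<equiv> t \<cdot> inl S (Dom C e) (Dom C f)" and "r \<equiv> t \<cdot> inr S (Dom C e) (Dom C f)"
  shows "t = \<langle>\<alpha> \<cdot> FAr H t, \<theta>\<rangle> \<cdot> flat_oplus A f e \<longleftrightarrow>
    l = \<langle>\<alpha> \<cdot> FAr H l, r\<rangle> \<cdot> e \<and> r = \<langle>\<alpha> \<cdot> FAr H r, \<theta>\<rangle> \<cdot> f"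
proof -
  let ?X = "Dom C e" and ?Y = "Dom C f"
  let ?r = "\<langle>\<alpha> \<cdot> FAr H r, \<theta>\<rangle> \<cdot> f"
  have [simp]: "?X \<in> Ob C" "?Y \<in> Ob C" using e f by auto
  note [simp] = flatD[OF e] flatD[OF f] A Hom_Ob[OF \<theta>]
  have [simp]: "l \<in> Ar C" "Dom C l = ?X" "Cod C l = B" "r \<in> Ar C" "Dom C r = ?Y" "Cod C r = B"
    "\<alpha> \<in> Ar C" "Dom C \<alpha> = FOb H B" "Cod C \<alpha> = B" "\<theta> \<in> Ar C" "Dom C \<theta> = A" "Cod C \<theta> = B"
    using t \<alpha> \<theta> by (simp_all add: l_def r_def Hom_iff)
  have Hlr: "FAr H t \<cdot> FAr H (inl S ?X ?Y) = FAr H l" "FAr H t \<cdot> FAr H (inr S ?X ?Y) = FAr H r"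
    using t by (simp_all add: l_def r_def Hom_iff)
  have c: "\<langle>\<alpha> \<cdot> FAr H t, \<theta>\<rangle> \<cdot> flat_oplus A f e = \<langle>\<langle>\<alpha> \<cdot> FAr H l, ?r\<rangle> \<cdot> e, ?r\<rangle>"
    unfolding oplus_eq[OF f e A] using t by (simp add: Hlr Hom_iff)
  have lr: "t = \<langle>l, r\<rangle>" unfolding l_def r_def using t by (simp add: Hom_iff)
  have "t = \<langle>\<langle>\<alpha> \<cdot> FAr H l, ?r\<rangle> \<cdot> e, ?r\<rangle> \<longleftrightarrow> l = \<langle>\<alpha> \<cdot> FAr H l, ?r\<rangle> \<cdot> e \<and> r = ?r"
  proof
    assume "t = \<langle>\<langle>\<alpha> \<cdot> FAr H l, ?r\<rangle> \<cdot> e, ?r\<rangle>"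
    then have *: "\<langle>l, r\<rangle> = \<langle>\<langle>\<alpha> \<cdot> FAr H l, ?r\<rangle> \<cdot> e, ?r\<rangle>" using lr by simp
    show "l = \<langle>\<alpha> \<cdot> FAr H l, ?r\<rangle> \<cdot> e \<and> r = ?r"
      using arg_cong[OF *, of "\<lambda>x. x \<cdot> inl S ?X ?Y"] arg_cong[OF *, of "\<lambda>x. x \<cdot> inr S ?X ?Y"] by simp
  next
    assume "l = \<langle>\<alpha> \<cdot> FAr H l, ?r\<rangle> \<cdot> e \<and> r = ?r"
    then show "t = \<langle>\<langle>\<alpha> \<cdot> FAr H l, ?r\<rangle> \<cdot> e, ?r\<rangle>" using lr by metis
  qed
  then show ?thesis unfolding c by metis
qed

text \<open>The case of \<open>copair_oplus\<close> with \<open>\<theta>\<close> the identity: a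
  simultaneous solution consists of a solution of \<open>f\<close> and a solution of
  \<open>e\<close> with the former inserted for its parameters.\<close>

lemma solves_oplus:
  assumes f: "f \<in> flat A" and e: "e \<in> flat (Dom C f)" and \<alpha>: "\<alpha> \<in> Hom C (FOb H A) A"
    and t: "solves A \<alpha> (flat_oplus A f e) t"
  shows "solves A \<alpha> f (t \<cdot> inr S (Dom C e) (Dom C f))"
    "solves A \<alpha> ((t \<cdot> inr S (Dom C e) (Dom C f)) \<bullet> e) (t \<cdot> inl S (Dom C e) (Dom C f))"
proof -
  have A [simp]: "A \<in> Ob C" using Hom_Ob[OF \<alpha>] by simp
  have [simp]: "Dom C e \<in> Ob C" "Dom C f \<in> Ob C" using e f by auto
  note cf = oplus_flat[OF f e A]
  have t1: "t \<in> Hom C (Dom C e \<oplus> Dom C f) A" "t = \<langle>\<alpha> \<cdot> FAr H t, Ident C A\<rangle> \<cdot> flat_oplus A f e"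
    using t solves_iff[OF cf(1) \<alpha>] cf(2) by auto
  define l where "l = t \<cdot> inl S (Dom C e) (Dom C f)"
  define r where "r = t \<cdot> inr S (Dom C e) (Dom C f)"
  have id: "Ident C A \<in> Hom C A A" by (simp add: Hom_iff)
  have lr: "l = \<langle>\<alpha> \<cdot> FAr H l, r\<rangle> \<cdot> e" "r = \<langle>\<alpha> \<cdot> FAr H r, Ident C A\<rangle> \<cdot> f"
    using copair_oplus[OF f e A \<alpha> id t1(1)] t1(2) unfolding l_def r_def by blast+
  have h: "r \<in> Hom C (Dom C f) A" "l \<in> Hom C (Dom C e) A" using t1(1) by (simp_all add: l_def r_def Hom_iff)
  then show "solves A \<alpha> f (t \<cdot> inr S (Dom C e) (Dom C f))"
    using lr(2) solves_iff[OF f \<alpha>] by (simp only: r_def)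
  have "\<langle>\<alpha> \<cdot> FAr H l, Ident C A\<rangle> \<cdot> (r \<bullet> e) = \<langle>\<alpha> \<cdot> FAr H l, r\<rangle> \<cdot> e"
    unfolding bullet_eq[OF e h(1)] using e h \<alpha> by (simp add: Hom_iff)
  then have "solves A \<alpha> (r \<bullet> e) l"
    using lr(1) h(2) solves_iff[OF bullet_flat(1)[OF e h(1)] \<alpha>] bullet_flat(2)[OF e h(1)] by simp
  then show "solves A \<alpha> ((t \<cdot> inr S (Dom C e) (Dom C f)) \<bullet> e) (t \<cdot> inl S (Dom C e) (Dom C f))"
    by (simp only: l_def r_def)
qed

lemma solves_bullet:
  assumes e: "e \<in> flat A" and \<alpha>: "\<alpha> \<in> Hom C (FOb H A) A" and \<beta>: "\<beta> \<in> Hom C (FOb H B) B"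
    and h: "h \<in> algebra_homs C H A \<alpha> B \<beta>" and s: "solves A \<alpha> e s"
  shows "solves B \<beta> (h \<bullet> e) (h \<cdot> s)"
proof -
  have hh: "h \<in> Hom C A B" "h \<cdot> \<alpha> = \<beta> \<cdot> FAr H h" using h by (auto simp: algebra_homs_def)
  have [simp]: "A \<in> Ob C" "B \<in> Ob C" using Hom_Ob[OF hh(1)] by auto
  have s': "s \<in> Hom C (Dom C e) A" "s = \<langle>\<alpha> \<cdot> FAr H s, Ident C A\<rangle> \<cdot> e"
    using s solves_iff[OF e \<alpha>] by auto
  note [simp] = flatD[OF e]
  have [simp]: "s \<in> Ar C" "Dom C s = Dom C e" "Cod C s = A" "h \<in> Ar C" "Dom C h = A" "Cod C h = B"
    "\<alpha> \<in> Ar C" "Dom C \<alpha> = FOb H A" "Cod C \<alpha> = A" "\<beta> \<in> Ar C" "Dom C \<beta> = FOb H B" "Cod C \<beta> = B"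
    using s'(1) hh(1) \<alpha> \<beta> by (simp_all add: Hom_iff)
  have "h \<cdot> s = h \<cdot> (\<langle>\<alpha> \<cdot> FAr H s, Ident C A\<rangle> \<cdot> e)" using s'(2) by simp
  also have "\<dots> = \<langle>h \<cdot> (\<alpha> \<cdot> FAr H s), h\<rangle> \<cdot> e" by simp
  also have "h \<cdot> (\<alpha> \<cdot> FAr H s) = \<beta> \<cdot> FAr H (h \<cdot> s)" using cmp_reassoc[OF hh(2), of "FAr H s"] by simp
  also have "\<langle>\<beta> \<cdot> FAr H (h \<cdot> s), h\<rangle> \<cdot> e = \<langle>\<beta> \<cdot> FAr H (h \<cdot> s), Ident C B\<rangle> \<cdot> (h \<bullet> e)"
    unfolding bullet_eq[OF e hh(1)] by simp
  finally have eq: "h \<cdot> s = \<langle>\<beta> \<cdot> FAr H (h \<cdot> s), Ident C B\<rangle> \<cdot> (h \<bullet> e)" .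
  have "h \<cdot> s \<in> Hom C (Dom C e) B" by (simp add: Hom_iff)
  then show ?thesis
    unfolding solves_iff[OF bullet_flat(1)[OF e hh(1)] \<beta>] bullet_flat(2)[OF e hh(1)]
    using eq by (rule conjI)
qed

text \<open>These are the coalgebra morphisms for \<open>H(-) + A\<close>, and the condition is the
  premise of functoriality in the definition of Elgot algebras.\<close>

definition flat_hom :: "'o \<Rightarrow> 'm \<Rightarrow> 'm \<Rightarrow> 'm \<Rightarrow> bool" where
  "flat_hom A e f h \<longleftrightarrow> h \<in> Hom C (Dom C e) (Dom C f) \<and> (FAr H h \<boxplus> Ident C A) \<cdot> e = f \<cdot> h"

lemma flat_hom_bullet:
  assumes "e \<in> flat A" "f \<in> flat A" "flat_hom A e f h" and g: "g \<in> Hom C A B"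
  shows "flat_hom B (g \<bullet> e) (g \<bullet> f) h"
proof -
  have h: "h \<in> Hom C (Dom C e) (Dom C f)" "(FAr H h \<boxplus> Ident C A) \<cdot> e = f \<cdot> h"
    using assms(3) by (auto simp: flat_hom_def)
  have [simp]: "A \<in> Ob C" "B \<in> Ob C" using Hom_Ob[OF g] by auto
  have "(FAr H h \<boxplus> Ident C B) \<cdot> (g \<bullet> e) =
    \<langle>inl S (FOb H (Dom C f)) B, inr S (FOb H (Dom C f)) B \<cdot> g\<rangle> \<cdot> ((FAr H h \<boxplus> Ident C A) \<cdot> e)"
    unfolding bullet_eq[OF assms(1) g] using assms(1,2) h(1) g by (simp add: Hom_iff cplus_def)
  also have "\<dots> = (g \<bullet> f) \<cdot> h"
    unfolding h(2) bullet_eq[OF assms(2) g] using assms(1,2) h(1) g by (simp add: Hom_iff)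
  finally show ?thesis
    using h(1) bullet_flat(2)[OF assms(1) g] bullet_flat(2)[OF assms(2) g] by (simp add: flat_hom_def)
qed

lemma solves_flat_hom:
  assumes e: "e \<in> flat A" and f: "f \<in> flat A" and \<alpha>: "\<alpha> \<in> Hom C (FOb H A) A"
    and h: "flat_hom A e f h" and s: "solves A \<alpha> f s"
  shows "solves A \<alpha> e (s \<cdot> h)"
proof -
  have hh: "h \<in> Hom C (Dom C e) (Dom C f)" "(FAr H h \<boxplus> Ident C A) \<cdot> e = f \<cdot> h"
    using h by (auto simp: flat_hom_def)
  have [simp]: "A \<in> Ob C" using Hom_Ob[OF \<alpha>] by simp
  have s': "s \<in> Hom C (Dom C f) A" "s = \<langle>\<alpha> \<cdot> FAr H s, Ident C A\<rangle> \<cdot> f"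
    using s solves_iff[OF f \<alpha>] by auto
  note [simp] = flatD[OF e] flatD[OF f]
  have [simp]: "s \<in> Ar C" "Dom C s = Dom C f" "Cod C s = A" "h \<in> Ar C" "Dom C h = Dom C e" "Cod C h = Dom C f"
    "\<alpha> \<in> Ar C" "Dom C \<alpha> = FOb H A" "Cod C \<alpha> = A"
    using s'(1) hh(1) \<alpha> by (simp_all add: Hom_iff)
  have "s \<cdot> h = \<langle>\<alpha> \<cdot> FAr H s, Ident C A\<rangle> \<cdot> (f \<cdot> h)" using cmp_reassoc[OF s'(2)[symmetric], of h] by simp
  also have "\<dots> = \<langle>\<alpha> \<cdot> FAr H (s \<cdot> h), Ident C A\<rangle> \<cdot> e"
    unfolding hh(2)[symmetric] by (simp add: cplus_def)
  finally have eq: "s \<cdot> h = \<langle>\<alpha> \<cdot> FAr H (s \<cdot> h), Ident C A\<rangle> \<cdot> e" .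
  have "s \<cdot> h \<in> Hom C (Dom C e) A" by (simp add: Hom_iff)
  then show ?thesis unfolding solves_iff[OF e \<alpha>] using eq by (rule conjI)
qed

lemma elgotD:
  assumes "elgot A \<alpha> d"
  shows "A \<in> Ob C" "\<alpha> \<in> Hom C (FOb H A) A" "d \<in> extensional (flat A)"
    "e \<in> flat A \<Longrightarrow> solves A \<alpha> e (d e)"
    "e \<in> flat A \<Longrightarrow> f \<in> flat A \<Longrightarrow> flat_hom A e f h \<Longrightarrow> d e = d f \<cdot> h"
    "f \<in> flat A \<Longrightarrow> e \<in> flat (Dom C f) \<Longrightarrow>
       d (d f \<bullet> e) = d (flat_oplus A f e) \<cdot> inl S (Dom C e) (Dom C f)"
  using assms unfolding elgot_algebra_def is_algebra_def flat_hom_def by blast+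

lemma elgotI:
  assumes "A \<in> Ob C" "\<alpha> \<in> Hom C (FOb H A) A" "d \<in> extensional (flat A)"
    "\<And>e. e \<in> flat A \<Longrightarrow> solves A \<alpha> e (d e)"
    "\<And>e f h. e \<in> flat A \<Longrightarrow> f \<in> flat A \<Longrightarrow> flat_hom A e f h \<Longrightarrow> d e = d f \<cdot> h"
    "\<And>e f. f \<in> flat A \<Longrightarrow> e \<in> flat (Dom C f) \<Longrightarrow>
       d (d f \<bullet> e) = d (flat_oplus A f e) \<cdot> inl S (Dom C e) (Dom C f)"
  shows "elgot A \<alpha> d"
  using assms unfolding elgot_algebra_def is_algebra_def flat_hom_def by blast

lemma elgot_Hom: "elgot A \<alpha> d \<Longrightarrow> e \<in> flat A \<Longrightarrow> d e \<in> Hom C (Dom C e) A"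
  using elgotD(4) by (auto simp: is_solution_def)

section \<open>Iterative algebras\<close>

definition isol :: "'o \<Rightarrow> 'm \<Rightarrow> 'm \<Rightarrow> 'm" where
  "isol A \<alpha> e = (THE s. solves A \<alpha> e s)"

lemma iterativeD:
  assumes "iterative A \<alpha>"
  shows "A \<in> Ob C" "\<alpha> \<in> Hom C (FOb H A) A" "e \<in> flat A \<Longrightarrow> solves A \<alpha> e (isol A \<alpha> e)"
    "e \<in> flat A \<Longrightarrow> solves A \<alpha> e s \<Longrightarrow> isol A \<alpha> e = s"
    "e \<in> flat A \<Longrightarrow> isol A \<alpha> e \<in> Hom C (Dom C e) A"
proof -
  have ex1: "\<exists>!s. solves A \<alpha> e s" if "e \<in> flat A"
    using assms that by (simp add: iterative_algebra_def)
  show "A \<in> Ob C" "\<alpha> \<in> Hom C (FOb H A) A"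
    using assms by (auto simp: iterative_algebra_def is_algebra_def)
  show sol: "solves A \<alpha> e (isol A \<alpha> e)" if "e \<in> flat A"
    unfolding isol_def using ex1[OF that] by (rule theI')
  show "isol A \<alpha> e = s" if "e \<in> flat A" "solves A \<alpha> e s"
    using ex1[OF that(1)] sol[OF that(1)] that(2) by blast
  show "isol A \<alpha> e \<in> Hom C (Dom C e) A" if "e \<in> flat A"
    using sol[OF that] by (simp add: is_solution_def)
qed

lemma isol_flat_hom:
  assumes "iterative A \<alpha>" "e \<in> flat A" "f \<in> flat A" "flat_hom A e f h"
  shows "isol A \<alpha> e = isol A \<alpha> f \<cdot> h"
  by (rule iterativeD(4)[OF assms(1,2) solves_flat_hom[OF assms(2,3) iterativeD(2)[OF assms(1)] assms(4)
        iterativeD(3)[OF assms(1,3)]]])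

lemma isol_oplus:
  assumes it: "iterative A \<alpha>" and f: "f \<in> flat A" and e: "e \<in> flat (Dom C f)"
  shows "isol A \<alpha> (isol A \<alpha> f \<bullet> e) = isol A \<alpha> (flat_oplus A f e) \<cdot> inl S (Dom C e) (Dom C f)"
proof -
  note cf = oplus_flat[OF f e iterativeD(1)[OF it]]
  note s = solves_oplus[OF f e iterativeD(2)[OF it] iterativeD(3)[OF it cf(1)]]
  have "isol A \<alpha> f = isol A \<alpha> (flat_oplus A f e) \<cdot> inr S (Dom C e) (Dom C f)"
    by (rule iterativeD(4)[OF it f s(1)])
  then show ?thesis
    using iterativeD(4)[OF it bullet_flat(1)[OF e iterativeD(5)[OF it f]]] s(2) by simp
qed

lemma isol_bullet:
  assumes "iterative A \<alpha>" "iterative B \<beta>" "h \<in> algebra_homs C H A \<alpha> B \<beta>" "e \<in> flat A"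
  shows "h \<cdot> isol A \<alpha> e = isol B \<beta> (h \<bullet> e)"
proof -
  have h: "h \<in> Hom C A B" using assms(3) by (simp add: algebra_homs_def)
  show ?thesis
    using iterativeD(4)[OF assms(2) bullet_flat(1)[OF assms(4) h]
        solves_bullet[OF assms(4) iterativeD(2)[OF assms(1)] iterativeD(2)[OF assms(2)] assms(3)
          iterativeD(3)[OF assms(1,4)]]] by simp
qed

text \<open>Uniqueness forces both axioms: a solution composed with a morphism of equations solves
  the source, and the components of a solution of a combined system solve its two parts.\<close>

lemma iterative_elgot:
  assumes it: "iterative A \<alpha>"
  shows "elgot A \<alpha> (restrict (isol A \<alpha>) (flat A))"
proof (rule elgotI)
  show "restrict (isol A \<alpha>) (flat A) (restrict (isol A \<alpha>) (flat A) f \<bullet> e) =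
      restrict (isol A \<alpha>) (flat A) (flat_oplus A f e) \<cdot> inl S (Dom C e) (Dom C f)"
    if "f \<in> flat A" "e \<in> flat (Dom C f)" for f e
    using isol_oplus[OF it that] oplus_flat(1)[OF that iterativeD(1)[OF it]]
      bullet_flat(1)[OF that(2) iterativeD(5)[OF it that(1)]] that by simp
qed (use iterativeD[OF it] isol_flat_hom[OF it] in auto)

end

section \<open>The rational fixpoint as a free Elgot algebra\<close>

context elgot_setting
begin

definition flat_functor :: "'o \<Rightarrow> ('o, 'm, 'o, 'm) func" where
  "flat_functor Y = sum_func H (const_func Y (Ident C Y))"

lemma flat_functor_simps [simp]:
  "FOb (flat_functor Y) X = FOb H X \<oplus> Y" "FAr (flat_functor Y) f = FAr H f \<boxplus> Ident C Y"
  by (simp_all add: flat_functor_def)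

text \<open>Coproducts commute with colimits, and the constant summand preserves filtered colimits
  because filtered shapes are connected.\<close>

lemma finitary_flat_functor:
  assumes Y: "Y \<in> Ob C"
  shows "finitary \<kappa> C C (flat_functor Y)"
  unfolding finitary_def
proof (intro conjI allI impI)
  show "is_functor C C (flat_functor Y)"
    unfolding flat_functor_def
    by (intro is_functor_sum_func H_functor is_functor_const_func category_axioms Y)
  fix J :: "('k, 'k) cat" and E L c
  assume "small_category \<kappa> J \<and> filtered J \<and> is_functor J C E \<and> is_colimit J C E L c"
  then have J: "small_category \<kappa> J" "filtered J" "is_functor J C E" "is_colimit J C E L c" by auto
  have cat: "category J" using J(3) by (rule is_functorD)
  have "is_colimit J C (sum_func (func_comp H E) (const_func Y (Ident C Y))) (FOb H L \<oplus> Y)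
      (\<lambda>i. FAr H (c i) \<boxplus> Ident C Y)"
    by (rule is_colimit_sum_func[OF is_functor_func_comp[OF J(3) H_functor] finitaryD[OF finitary_H J]
          is_functor_const_func[OF cat Y] is_colimit_const_func[OF cat J(2) Y]])
  moreover have "func_comp (flat_functor Y) E = sum_func (func_comp H E) (const_func Y (Ident C Y))"
    by (simp add: flat_functor_def func_comp_def sum_func_def const_func_def comp_def)
  ultimately show "is_colimit J C (func_comp (flat_functor Y) E) (FOb (flat_functor Y) L) (\<lambda>i. FAr (flat_functor Y) (c i))"
    by simp
qed

end

text \<open>The fixpoint of \<open>H(-) + Y\<close> restated for flat equations. The assumptions on
  \<open>J\<close>, \<open>D\<close> and \<open>c\<close> keep \<open>R\<close> as a small filtered
  colimit with legs among the \<open>sol w\<close>, so that the parameters of an equation in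
  \<open>R\<close> can be traced to one stage.\<close>

locale rational_object = elgot_setting C S \<kappa> H for C :: "('o, 'm) cat" (structure) and S and \<kappa> :: "'k rel" and H +
  fixes Y R :: 'o and i j :: 'm and sol :: "'m \<Rightarrow> 'm"
    and J :: "('i, 'j) cat" and D :: "('i, 'j, 'o, 'm) func" and c :: "'i \<Rightarrow> 'm"
  assumes Y: "Y \<in> Ob C"
    and i: "i \<in> Hom C R (FOb H R \<oplus> Y)" and j: "j \<in> Hom C (FOb H R \<oplus> Y) R"
    and ij: "i \<cdot> j = Ident C (FOb H R \<oplus> Y)" and ji: "j \<cdot> i = Ident C R"
    and sol: "w \<in> flat Y \<Longrightarrow> sol w \<in> Hom C (Dom C w) R"
    and sol_hom: "w \<in> flat Y \<Longrightarrow> i \<cdot> sol w = (FAr H (sol w) \<boxplus> Ident C Y) \<cdot> w"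
    and sol_unique: "w \<in> flat Y \<Longrightarrow> t \<in> Hom C (Dom C w) R \<Longrightarrow> i \<cdot> t = (FAr H t \<boxplus> Ident C Y) \<cdot> w \<Longrightarrow> t = sol w"
    and universal: "Z \<in> Ob C \<Longrightarrow> (\<And>e. e \<in> flat Y \<Longrightarrow> s e \<in> Hom C (Dom C e) Z) \<Longrightarrow>
      (\<And>e f h. e \<in> flat Y \<Longrightarrow> f \<in> flat Y \<Longrightarrow> flat_hom Y e f h \<Longrightarrow> s f \<cdot> h = s e) \<Longrightarrow>
      \<exists>!k. k \<in> Hom C R Z \<and> (\<forall>e\<in>flat Y. k \<cdot> sol e = s e)"
    and J: "small_category \<kappa> J" "filtered J" "is_functor J C D" "is_colimit J C D R c"
    and J_flat: "k \<in> Ob J \<Longrightarrow> \<exists>w\<in>flat Y. FOb D k = Dom C w \<and> c k = sol w"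

lemma (in elgot_setting) ex_rational_object:
  assumes Y: "Y \<in> Ob C"
  shows "\<exists>R i j sol (J :: ('m, 'm \<times> 'm \<times> 'm) cat) D c. rational_object C S \<kappa> H Y R i j sol J D c"
proof -
  interpret T: finitary_endofunctor C S \<kappa> "flat_functor Y"
    using finitary_flat_functor[OF Y] by unfold_locales
  have co: "T.coalgebra e \<longleftrightarrow> e \<in> flat Y" for e
    unfolding T.coalgebra_def flat_equations_def by simp
  have hom: "T.coalgebra_hom e f h \<longleftrightarrow> flat_hom Y e f h" for e f h
    unfolding T.coalgebra_hom_def flat_hom_def by (simp add: Hom_iff conj_assoc)
  obtain J D R i j sol where "T.rational_fixpoint J D R i j sol"
    using T.ex_rational_fixpoint by blast
  note * = this[unfolded T.rational_fixpoint_def co hom flat_functor_simps]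
  have "rational_object C S \<kappa> H Y R i j sol J D sol"
  proof
    fix Z s
    assume "Z \<in> Ob C" "\<And>e. e \<in> flat Y \<Longrightarrow> s e \<in> Hom C (Dom C e) Z"
      "\<And>e f h. e \<in> flat Y \<Longrightarrow> f \<in> flat Y \<Longrightarrow> flat_hom Y e f h \<Longrightarrow> s f \<cdot> h = s e"
    with * have "\<exists>!k. k \<in> Hom C R Z \<and> (\<forall>e. e \<in> flat Y \<longrightarrow> k \<cdot> sol e = s e)" by blast
    then show "\<exists>!k. k \<in> Hom C R Z \<and> (\<forall>e\<in>flat Y. k \<cdot> sol e = s e)" by (simp only: Ball_def)
  qed (use * Y in auto)
  then show ?thesis by blast
qed

context elgot_setting
begin

definition preserves :: "'o \<Rightarrow> 'm \<Rightarrow> ('m \<Rightarrow> 'm) \<Rightarrow> 'm \<Rightarrow> bool" where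
  "preserves R \<rho> d h \<longleftrightarrow> (\<forall>e\<in>flat R. h \<cdot> isol R \<rho> e = d (h \<bullet> e))"

text \<open>Freeness of an iterative algebra among Elgot algebras. Extensions exist as homomorphisms
  that also preserve solutions, whereas uniqueness is demanded among all solution-preserving maps:
  Elgot morphisms are given without the homomorphism law.\<close>

definition elgot_free :: "'o \<Rightarrow> 'o \<Rightarrow> 'm \<Rightarrow> 'm \<Rightarrow> bool" where
  "elgot_free Y R \<rho> \<eta> \<longleftrightarrow> iterative R \<rho> \<and> \<eta> \<in> Hom C Y R \<and>
    (\<forall>A \<alpha> d f. elgot A \<alpha> d \<and> f \<in> Hom C Y A \<longrightarrow>
       (\<exists>h\<in>algebra_homs C H R \<rho> A \<alpha>. h \<cdot> \<eta> = f \<and> preserves R \<rho> d h)) \<and>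
    (\<forall>A \<alpha> d h h'. elgot A \<alpha> d \<and> h \<in> Hom C R A \<and> h' \<in> Hom C R A \<and> preserves R \<rho> d h \<and> preserves R \<rho> d h' \<and>
       h \<cdot> \<eta> = h' \<cdot> \<eta> \<longrightarrow> h = h')"

lemma elgot_freeD:
  assumes "elgot_free Y R \<rho> \<eta>"
  shows "iterative R \<rho>" "\<eta> \<in> Hom C Y R"
    "elgot A \<alpha> d \<Longrightarrow> f \<in> Hom C Y A \<Longrightarrow> \<exists>h\<in>algebra_homs C H R \<rho> A \<alpha>. h \<cdot> \<eta> = f \<and> preserves R \<rho> d h"
    "elgot A \<alpha> d \<Longrightarrow> h \<in> Hom C R A \<Longrightarrow> h' \<in> Hom C R A \<Longrightarrow> preserves R \<rho> d h \<Longrightarrow> preserves R \<rho> d h' \<Longrightarrow>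
       h \<cdot> \<eta> = h' \<cdot> \<eta> \<Longrightarrow> h = h'"
  using assms unfolding elgot_free_def by blast+

end

section \<open>Iterativity and freeness of the fixpoint\<close>

context rational_object
begin

text \<open>The inverse \<open>j\<close> of the coalgebra structure is the copair of
  \<open>\<rho>\<close> and \<open>\<eta>\<close>, an algebra structure on \<open>R\<close> and the
  insertion of parameters.\<close>

definition \<rho> where "\<rho> = j \<cdot> inl S (FOb H R) Y"
definition \<eta> where "\<eta> = j \<cdot> inr S (FOb H R) Y"

lemma R_Ob [simp]: "R \<in> Ob C" "Y \<in> Ob C"
  using Hom_Ob[OF i] Y by auto

lemma ij_simps [simp]: "i \<in> Ar C" "Dom C i = R" "Cod C i = FOb H R \<oplus> Y"
  "j \<in> Ar C" "Dom C j = FOb H R \<oplus> Y" "Cod C j = R"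
  using i j by (auto simp: Hom_iff)

lemma \<rho>\<eta>_simps [simp]: "\<rho> \<in> Ar C" "Dom C \<rho> = FOb H R" "Cod C \<rho> = R" "\<eta> \<in> Ar C" "Dom C \<eta> = Y" "Cod C \<eta> = R"
  by (simp_all add: \<rho>_def \<eta>_def)

lemma sol_simps [simp]:
  assumes "w \<in> flat Y"
  shows "sol w \<in> Ar C" "Dom C (sol w) = Dom C w" "Cod C (sol w) = R"
  using sol[OF assms] by (auto simp: Hom_iff)

text \<open>As \<open>i\<close> and \<open>j\<close> are mutually inverse, coalgebra morphisms from
  \<open>w\<close> into \<open>R\<close> are the same as fixpoints of the equation read through the
  algebra structure.\<close>

lemma sol_iff:
  assumes w: "w \<in> flat Y" and t: "t \<in> Hom C (Dom C w) R"
  shows "t = \<langle>\<rho> \<cdot> FAr H t, \<eta>\<rangle> \<cdot> w \<longleftrightarrow> t = sol w"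
proof -
  note [simp] = flatD[OF w]
  have tt: "t \<in> Ar C" "Dom C t = Dom C w" "Cod C t = R" using t by (auto simp: Hom_iff)
  let ?x = "(FAr H t \<boxplus> Ident C Y) \<cdot> w"
  have x: "?x \<in> Ar C" "Cod C ?x = FOb H R \<oplus> Y" using tt by simp_all
  have jx: "j \<cdot> ?x = \<langle>\<rho> \<cdot> FAr H t, \<eta>\<rangle> \<cdot> w"
    using tt by (simp add: cplus_def \<rho>_def \<eta>_def)
  have "t = j \<cdot> ?x \<longleftrightarrow> i \<cdot> t = ?x"
  proof
    assume "t = j \<cdot> ?x"
    then have "i \<cdot> t = i \<cdot> (j \<cdot> ?x)" by simp
    also have "\<dots> = ?x" using cmp_reassoc[OF ij] x by simp
    finally show "i \<cdot> t = ?x" .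
  next
    assume "i \<cdot> t = ?x"
    then have "j \<cdot> ?x = j \<cdot> (i \<cdot> t)" by simp
    also have "\<dots> = t" using cmp_reassoc[OF ji, of t] tt by simp
    finally show "t = j \<cdot> ?x" by simp
  qed
  moreover have "i \<cdot> t = ?x \<longleftrightarrow> t = sol w" using sol_hom[OF w] sol_unique[OF w t] by blast
  ultimately show ?thesis by (simp only: jx)
qed

text \<open>With \<open>X\<close> the domain of \<open>g\<close>, \<open>HX + R\<close> is the
  filtered colimit of the objects \<open>HX + Z\<close> over the stages \<open>Z\<close>, the first
  summand being constant. Finite presentability of \<open>X\<close> factors \<open>g\<close> through
  one of them.\<close>

lemma bullet_sol_factor:
  assumes g: "g \<in> flat R"
  obtains e g0 where "e \<in> flat Y" "g0 \<in> flat (Dom C e)" "g = sol e \<bullet> g0"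
proof -
  note [simp] = flatD[OF g]
  let ?X = "Dom C g" and ?B = "FOb H (Dom C g)"
  have B: "?B \<in> Ob C" by simp
  have cat: "category J" using J(3) by (rule is_functorD)
  let ?F = "sum_func (const_func ?B (Ident C ?B)) D"
  have F: "is_functor J C ?F" by (intro is_functor_sum_func is_functor_const_func cat J B)
  have colim: "is_colimit J C ?F (?B \<oplus> R) (\<lambda>k. Ident C ?B \<boxplus> c k)"
    by (rule is_colimit_sum_func[OF is_functor_const_func[OF cat B] is_colimit_const_func[OF cat J(2) B] J(3,4)])
  have hp: "hom_preserves J C ?F (?B \<oplus> R) (\<lambda>k. Ident C ?B \<boxplus> c k) ?X"
    by (rule finitely_presentable_hom_preserves[OF \<kappa> _ J(1,2) F colim]) simp
  have gH: "g \<in> Hom C ?X (?B \<oplus> R)" by (simp add: Hom_iff)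
  obtain k g0 where k: "k \<in> Ob J" "g0 \<in> Hom C ?X (FOb ?F k)" "(Ident C ?B \<boxplus> c k) \<cdot> g0 = g"
    by (rule hom_preserves_factor[OF hp gH])
  obtain e where e: "e \<in> flat Y" "FOb D k = Dom C e" "c k = sol e" using J_flat[OF k(1)] by blast
  have g0: "g0 \<in> flat (Dom C e)" "Dom C g0 = ?X"
    using k(2) e(2) by (auto simp: Hom_iff intro: flatI)
  have "g = sol e \<bullet> g0" unfolding bullet_def g0(2) using k(3) e(3) by simp
  then show ?thesis using that e(1) g0(1) by blast
qed

text \<open>Copairing a solution \<open>s\<close> with \<open>sol e\<close> gives a coalgebra
  morphism from the combined equation into \<open>R\<close>, and there is only one. So existence and
  uniqueness of solutions in \<open>R\<close> are inherited from coalgebra morphisms.\<close>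

lemma solves_bullet_sol:
  assumes e: "e \<in> flat Y" and g: "g \<in> flat (Dom C e)"
  shows "solves R \<rho> (sol e \<bullet> g) s \<longleftrightarrow> s = sol (flat_oplus Y e g) \<cdot> inl S (Dom C g) (Dom C e)"
proof -
  let ?X = "Dom C g" and ?Z = "Dom C e"
  note [simp] = flatD[OF e] flatD[OF g] sol_simps[OF e]
  have [simp]: "?X \<in> Ob C" "?Z \<in> Ob C" by simp_all
  note og = oplus_flat[OF e g R_Ob(2)]
  note [simp] = sol_simps[OF og(1)] og(2)
  have \<rho>: "\<rho> \<in> Hom C (FOb H R) R" and \<eta>: "\<eta> \<in> Hom C Y R" and se: "sol e \<in> Hom C ?Z R" by (simp_all add: Hom_iff)
  have b: "sol e \<bullet> g \<in> flat R" "Dom C (sol e \<bullet> g) = ?X" using bullet_flat[OF g se] by auto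
  have eq: "\<langle>\<rho> \<cdot> FAr H s, Ident C R\<rangle> \<cdot> (sol e \<bullet> g) = \<langle>\<rho> \<cdot> FAr H s, sol e\<rangle> \<cdot> g" if "s \<in> Hom C ?X R" for s
    unfolding bullet_eq[OF g se] using that by (simp add: Hom_iff)
  have sol_e: "sol e = \<langle>\<rho> \<cdot> FAr H (sol e), \<eta>\<rangle> \<cdot> e" using sol_iff[OF e se] by blast
  have key: "t = sol (flat_oplus Y e g) \<longleftrightarrow>
      t \<cdot> inl S ?X ?Z = \<langle>\<rho> \<cdot> FAr H (t \<cdot> inl S ?X ?Z), t \<cdot> inr S ?X ?Z\<rangle> \<cdot> g \<and> t \<cdot> inr S ?X ?Z = sol e"
    if t: "t \<in> Hom C (?X \<oplus> ?Z) R" for t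
  proof -
    have tr: "t \<cdot> inr S ?X ?Z \<in> Hom C ?Z R" using t by (simp add: Hom_iff)
    show ?thesis
      using copair_oplus[OF e g R_Ob(2) \<rho> \<eta> t] sol_iff[OF og(1), of t] t sol_iff[OF e tr] by simp
  qed
  show ?thesis
  proof
    assume "solves R \<rho> (sol e \<bullet> g) s"
    then have s: "s \<in> Hom C ?X R" "s = \<langle>\<rho> \<cdot> FAr H s, sol e\<rangle> \<cdot> g"
      using solves_iff[OF b(1) \<rho>, of s] b(2) eq by auto
    have [simp]: "s \<in> Ar C" "Dom C s = ?X" "Cod C s = R" using s(1) by (auto simp: Hom_iff)
    have "\<langle>s, sol e\<rangle> = sol (flat_oplus Y e g)"
      by (rule iffD2[OF key]) (use s(2) in \<open>simp_all add: Hom_iff\<close>)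
    from arg_cong[OF this, of "\<lambda>t. t \<cdot> inl S ?X ?Z"]
    show "s = sol (flat_oplus Y e g) \<cdot> inl S ?X ?Z" by simp
  next
    assume s: "s = sol (flat_oplus Y e g) \<cdot> inl S ?X ?Z"
    have sH: "s \<in> Hom C ?X R" by (simp add: s Hom_iff)
    have "sol (flat_oplus Y e g) \<in> Hom C (?X \<oplus> ?Z) R" by (simp add: Hom_iff)
    from key[OF this] have "s = \<langle>\<rho> \<cdot> FAr H s, sol e\<rangle> \<cdot> g" unfolding s by metis
    then show "solves R \<rho> (sol e \<bullet> g) s"
      unfolding solves_iff[OF b(1) \<rho>] b(2) eq[OF sH] using sH by blast
  qed
qed

lemma iterative_R: "iterative R \<rho>"
  unfolding iterative_algebra_def
proof (intro conjI ballI)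
  show "is_algebra C H R \<rho>" by (simp add: is_algebra_def Hom_iff)
  fix g assume "g \<in> flat R"
  then obtain e g0 where "e \<in> flat Y" "g0 \<in> flat (Dom C e)" "g = sol e \<bullet> g0" by (rule bullet_sol_factor)
  then show "\<exists>!s. solves R \<rho> g s" using solves_bullet_sol by simp
qed

lemma isol_bullet_sol:
  assumes e: "e \<in> flat Y" and g: "g \<in> flat (Dom C e)"
  shows "isol R \<rho> (sol e \<bullet> g) = sol (flat_oplus Y e g) \<cdot> inl S (Dom C g) (Dom C e)"
  using iterativeD(4)[OF iterative_R bullet_flat(1)[OF g sol[OF e]]] solves_bullet_sol[OF e g] by blast

text \<open>Coalgebra morphisms into \<open>R\<close> are thereby solutions in \<open>R\<close> of
  equations whose parameters are inserted by \<open>\<eta>\<close>; this ties solution-preserving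
  maps to the colimit cocone.\<close>

lemma isol_\<eta>:
  assumes e: "e \<in> flat Y"
  shows "isol R \<rho> (\<eta> \<bullet> e) = sol e"
proof -
  note [simp] = flatD[OF e] sol_simps[OF e]
  have \<rho>: "\<rho> \<in> Hom C (FOb H R) R" and \<eta>: "\<eta> \<in> Hom C Y R" by (simp_all add: Hom_iff)
  have "\<langle>\<rho> \<cdot> FAr H (sol e), Ident C R\<rangle> \<cdot> (\<eta> \<bullet> e) = \<langle>\<rho> \<cdot> FAr H (sol e), \<eta>\<rangle> \<cdot> e"
    unfolding bullet_eq[OF e \<eta>] by simp
  also have "\<dots> = sol e" using sol_iff[OF e sol[OF e]] by simp
  finally have "solves R \<rho> (\<eta> \<bullet> e) (sol e)"
    unfolding solves_iff[OF bullet_flat(1)[OF e \<eta>] \<rho>] bullet_flat(2)[OF e \<eta>] using sol[OF e] by simp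
  then show ?thesis by (rule iterativeD(4)[OF iterative_R bullet_flat(1)[OF e \<eta>]])
qed

lemma extension_ex1:
  assumes A: "elgot A \<alpha> d" and f: "f \<in> Hom C Y A"
  shows "\<exists>!k. k \<in> Hom C R A \<and> (\<forall>e\<in>flat Y. k \<cdot> sol e = d (f \<bullet> e))"
proof (rule universal)
  show "d (f \<bullet> e) \<in> Hom C (Dom C e) A" if "e \<in> flat Y" for e
    using elgot_Hom[OF A bullet_flat(1)[OF that f]] bullet_flat(2)[OF that f] by simp
  show "d (f \<bullet> e') \<cdot> h = d (f \<bullet> e)" if "e \<in> flat Y" "e' \<in> flat Y" "flat_hom Y e e' h" for e e' h
    using elgotD(5)[OF A bullet_flat(1)[OF that(1) f] bullet_flat(1)[OF that(2) f] flat_hom_bullet[OF that f]] ..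
qed (rule elgotD(1)[OF A])

text \<open>On the colimit cocone a solution-preserving map is determined by its composite with
  \<open>\<eta>\<close>, which yields uniqueness of extensions.\<close>

lemma preserves_sol:
  assumes h: "h \<in> Hom C R A" and "preserves R \<rho> d h" and e: "e \<in> flat Y"
  shows "h \<cdot> sol e = d ((h \<cdot> \<eta>) \<bullet> e)"
proof -
  have \<eta>: "\<eta> \<in> Hom C Y R" by (simp add: Hom_iff)
  have "h \<cdot> isol R \<rho> (\<eta> \<bullet> e) = d (h \<bullet> (\<eta> \<bullet> e))"
    using assms(2) bullet_flat(1)[OF e \<eta>] by (simp add: preserves_def)
  then show ?thesis by (simp only: isol_\<eta>[OF e] bullet_bullet[OF e \<eta> h])
qed

lemma extension:
  assumes A: "elgot A \<alpha> d" and f: "f \<in> Hom C Y A"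
  shows "\<exists>h\<in>algebra_homs C H R \<rho> A \<alpha>. h \<cdot> \<eta> = f \<and> preserves R \<rho> d h"
proof -
  note AD = elgotD[OF A]
  obtain h where h: "h \<in> Hom C R A" "\<And>e. e \<in> flat Y \<Longrightarrow> h \<cdot> sol e = d (f \<bullet> e)"
    using extension_ex1[OF A f] by blast
  have [simp]: "A \<in> Ob C" "h \<in> Ar C" "Dom C h = R" "Cod C h = A" "\<alpha> \<in> Ar C" "Dom C \<alpha> = FOb H A" "Cod C \<alpha> = A"
    "f \<in> Ar C" "Dom C f = Y" "Cod C f = A"
    using AD(1,2) h(1) f by (auto simp: Hom_iff)
  \<comment> \<open>The map \<open>h\<close> unfolded once along \<open>i\<close>. Its composites
    with all \<open>sol e\<close> are those of \<open>h\<close>, because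
    \<open>d (f \<bullet> e)\<close> is a solution, so it equals \<open>h\<close>. Composing with
    \<open>j\<close> then gives both the homomorphism law and
    \<open>h \<cdot> \<eta> = f\<close>.\<close>
  let ?k = "\<langle>\<alpha> \<cdot> FAr H h, f\<rangle> \<cdot> i"
  have "?k \<cdot> sol e = d (f \<bullet> e)" if e: "e \<in> flat Y" for e
  proof -
    note [simp] = flatD[OF e] sol_simps[OF e]
    have de: "d (f \<bullet> e) \<in> Hom C (Dom C e) A" "d (f \<bullet> e) = \<langle>\<alpha> \<cdot> FAr H (d (f \<bullet> e)), Ident C A\<rangle> \<cdot> (f \<bullet> e)"
      using AD(4)[OF bullet_flat(1)[OF e f]] solves_iff[OF bullet_flat(1)[OF e f] AD(2)] bullet_flat(2)[OF e f]
      by auto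
    have bullet_step: "\<langle>\<alpha> \<cdot> FAr H t, f\<rangle> \<cdot> e = \<langle>\<alpha> \<cdot> FAr H t, Ident C A\<rangle> \<cdot> (f \<bullet> e)" if "t \<in> Hom C (Dom C e) A" for t
      unfolding bullet_eq[OF e f] using that by (simp add: Hom_iff)
    have "?k \<cdot> sol e = \<langle>\<alpha> \<cdot> FAr H h, f\<rangle> \<cdot> (i \<cdot> sol e)" by simp
    also have "\<dots> = \<langle>\<alpha> \<cdot> FAr H (h \<cdot> sol e), f\<rangle> \<cdot> e"
      unfolding sol_hom[OF e] by (simp add: cplus_def)
    also have "\<dots> = \<langle>\<alpha> \<cdot> FAr H (d (f \<bullet> e)), Ident C A\<rangle> \<cdot> (f \<bullet> e)"
      unfolding h(2)[OF e] by (rule bullet_step[OF de(1)])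
    finally show ?thesis using de(2) by simp
  qed
  moreover have "?k \<in> Hom C R A" by (simp add: Hom_iff)
  ultimately have k: "?k = h" using extension_ex1[OF A f] h by blast
  have "h \<cdot> j = \<langle>\<alpha> \<cdot> FAr H h, f\<rangle> \<cdot> (i \<cdot> j)"
    by (subst k[symmetric]) simp
  then have hj: "h \<cdot> j = \<langle>\<alpha> \<cdot> FAr H h, f\<rangle>" unfolding ij by simp
  have "h \<cdot> \<rho> = (h \<cdot> j) \<cdot> inl S (FOb H R) Y" "h \<cdot> \<eta> = (h \<cdot> j) \<cdot> inr S (FOb H R) Y"
    by (simp_all add: \<rho>_def \<eta>_def)
  then have hom: "h \<cdot> \<rho> = \<alpha> \<cdot> FAr H h" "h \<cdot> \<eta> = f" unfolding hj by simp_all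
  have "preserves R \<rho> d h"
    unfolding preserves_def
  proof
    fix g assume "g \<in> flat R"
    then obtain e g0 where e: "e \<in> flat Y" and g0: "g0 \<in> flat (Dom C e)" and g: "g = sol e \<bullet> g0"
      by (rule bullet_sol_factor)
    note og = oplus_flat[OF e g0 R_Ob(2)]
    note fe = bullet_flat[OF e f]
    note [simp] = sol_simps[OF og(1)] flatD[OF e] flatD[OF g0]
    have [simp]: "Dom C g0 \<in> Ob C" "Dom C e \<in> Ob C" by simp_all
    have "h \<cdot> isol R \<rho> g = (h \<cdot> sol (flat_oplus Y e g0)) \<cdot> inl S (Dom C g0) (Dom C e)"
      unfolding g isol_bullet_sol[OF e g0] using og(2) by simp
    also have "\<dots> = d (flat_oplus A (f \<bullet> e) g0) \<cdot> inl S (Dom C g0) (Dom C e)"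
      unfolding h(2)[OF og(1)] bullet_oplus[OF e g0 R_Ob(2) f] ..
    \<comment> \<open>Compositionality of \<open>d\<close> turns the combined system back into
      \<open>g0\<close> with its parameters already solved in \<open>A\<close>.\<close>
    also have "\<dots> = d (d (f \<bullet> e) \<bullet> g0)"
      using AD(6)[OF fe(1), of g0] g0 fe(2) by simp
    also have "\<dots> = d (h \<bullet> g)"
      unfolding g h(2)[OF e, symmetric] bullet_bullet[OF g0 sol[OF e] h(1)] ..
    finally show "h \<cdot> isol R \<rho> g = d (h \<bullet> g)" .
  qed
  then show ?thesis using h(1) hom by (auto simp: algebra_homs_def)
qed

theorem elgot_free: "elgot_free Y R \<rho> \<eta>"
proof -
  have "h = h'" if "elgot A \<alpha> d" "h \<in> Hom C R A" "h' \<in> Hom C R A" "preserves R \<rho> d h" "preserves R \<rho> d h'"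
      "h \<cdot> \<eta> = h' \<cdot> \<eta>" for A \<alpha> d h h'
  proof -
    have f: "h' \<cdot> \<eta> \<in> Hom C Y A" using that(3) by (simp add: Hom_iff)
    have "\<forall>e\<in>flat Y. h \<cdot> sol e = d ((h' \<cdot> \<eta>) \<bullet> e)" "\<forall>e\<in>flat Y. h' \<cdot> sol e = d ((h' \<cdot> \<eta>) \<bullet> e)"
      using preserves_sol[OF that(2,4)] preserves_sol[OF that(3,5)] that(6) by simp_all
    then show ?thesis using extension_ex1[OF that(1) f] that(2,3) by blast
  qed
  moreover have "\<eta> \<in> Hom C Y R" by (simp add: Hom_iff)
  ultimately show ?thesis
    unfolding elgot_free_def using iterative_R extension by blast
qed

end

section \<open>Transfer to arbitrary free iterative algebras\<close>

context elgot_setting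
begin

lemma algebra_homs_cmp:
  assumes "A \<in> Ob C" "\<alpha> \<in> Hom C (FOb H A) A" "\<beta> \<in> Hom C (FOb H B) B" "\<gamma> \<in> Hom C (FOb H D) D"
    and f: "f \<in> algebra_homs C H A \<alpha> B \<beta>" and g: "g \<in> algebra_homs C H B \<beta> D \<gamma>"
  shows "g \<cdot> f \<in> algebra_homs C H A \<alpha> D \<gamma>"
proof -
  have fg: "f \<in> Hom C A B" "f \<cdot> \<alpha> = \<beta> \<cdot> FAr H f" "g \<in> Hom C B D" "g \<cdot> \<beta> = \<gamma> \<cdot> FAr H g"
    using f g by (auto simp: algebra_homs_def)
  have "(g \<cdot> f) \<cdot> \<alpha> = g \<cdot> (\<beta> \<cdot> FAr H f)" using fg(1,3) assms(2) by (simp add: Hom_iff fg(2))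
  also have "\<dots> = \<gamma> \<cdot> FAr H (g \<cdot> f)"
    using cmp_reassoc[OF fg(4), of "FAr H f"] fg(1,3) assms(3,4) by (simp add: Hom_iff)
  finally show ?thesis using fg(1,3) by (simp add: algebra_homs_def Hom_iff)
qed

lemma Ident_algebra_hom:
  "A \<in> Ob C \<Longrightarrow> \<alpha> \<in> Hom C (FOb H A) A \<Longrightarrow> Ident C A \<in> algebra_homs C H A \<alpha> A \<alpha>"
  by (simp add: algebra_homs_def Hom_iff)

lemma preserves_cmp:
  assumes "iterative A \<alpha>" "iterative B \<beta>" "h \<in> Hom C B Z" "preserves B \<beta> d h" and k: "k \<in> algebra_homs C H A \<alpha> B \<beta>"
  shows "preserves A \<alpha> d (h \<cdot> k)"
  unfolding preserves_def
proof
  fix e assume e: "e \<in> flat A"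
  have kH: "k \<in> Hom C A B" using k by (simp add: algebra_homs_def)
  have "(h \<cdot> k) \<cdot> isol A \<alpha> e = h \<cdot> isol B \<beta> (k \<bullet> e)"
    unfolding isol_bullet[OF assms(1,2) k e, symmetric]
    using kH assms(3) iterativeD(5)[OF assms(1) e] by (simp add: Hom_iff)
  also have "\<dots> = d (h \<bullet> (k \<bullet> e))"
    using assms(4) bullet_flat(1)[OF e kH] by (simp add: preserves_def)
  finally show "(h \<cdot> k) \<cdot> isol A \<alpha> e = d ((h \<cdot> k) \<bullet> e)" by (simp only: bullet_bullet[OF e kH assms(3)])
qed

lemma preserves_algebra_hom:
  assumes "iterative A \<alpha>" "iterative B \<beta>" "k \<in> algebra_homs C H A \<alpha> B \<beta>"
  shows "preserves A \<alpha> (restrict (isol B \<beta>) (flat B)) k"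
proof -
  have "k \<in> Hom C A B" using assms(3) by (simp add: algebra_homs_def)
  then show ?thesis
    using isol_bullet[OF assms] bullet_flat(1) by (simp add: preserves_def)
qed

text \<open>Homomorphisms between iterative algebras preserve solutions, so the uniqueness clause
  for solution-preserving maps covers them.\<close>

lemma elgot_free_unique:
  assumes R: "elgot_free Y R \<rho> \<eta>" and A: "iterative A \<alpha>"
    and "h \<in> algebra_homs C H R \<rho> A \<alpha>" "h' \<in> algebra_homs C H R \<rho> A \<alpha>" "h \<cdot> \<eta> = h' \<cdot> \<eta>"
  shows "h = h'"
proof (rule elgot_freeD(4)[OF R iterative_elgot[OF A]])
  show "preserves R \<rho> (restrict (isol A \<alpha>) (flat A)) h" "preserves R \<rho> (restrict (isol A \<alpha>) (flat A)) h'"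
    by (intro preserves_algebra_hom elgot_freeD(1)[OF R] A assms)+
qed (use assms in \<open>auto simp: algebra_homs_def\<close>)

text \<open>Freeness of \<open>R'\<close> gives \<open>\<phi>\<close> from \<open>R'\<close> to
  \<open>R\<close>; as the iterative algebra \<open>R'\<close> is an Elgot algebra, freeness of
  \<open>R\<close> gives \<open>\<psi>\<close> back, and \<open>\<psi> \<cdot> \<phi>\<close> is the
  identity by uniqueness for \<open>R'\<close>. Extensions out of \<open>R'\<close> arise by
  composing with \<open>\<phi>\<close> and are compared by composing with
  \<open>\<psi>\<close>.\<close>

lemma elgot_free_if_free_iterative:
  assumes R: "elgot_free Y R \<rho> \<eta>" and R': "free_iterative_algebra \<kappa> C H S Y R' \<rho>' \<eta>'"
  shows "elgot_free Y R' \<rho>' \<eta>'"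
proof -
  note RD = elgot_freeD(1,2)[OF R]
  have R'D: "iterative R' \<rho>'" "\<eta>' \<in> Hom C Y R'"
    and free: "\<And>A \<alpha> f. iterative A \<alpha> \<Longrightarrow> f \<in> Hom C Y A \<Longrightarrow> \<exists>!h. h \<in> algebra_homs C H R' \<rho>' A \<alpha> \<and> h \<cdot> \<eta>' = f"
    using R' unfolding free_iterative_algebra_def by auto
  note RA = iterativeD(1,2)[OF RD(1)] and R'A = iterativeD(1,2)[OF R'D(1)]
  obtain \<phi> where \<phi>: "\<phi> \<in> algebra_homs C H R' \<rho>' R \<rho>" "\<phi> \<cdot> \<eta>' = \<eta>" using free[OF RD] by blast
  obtain \<psi> where \<psi>: "\<psi> \<in> algebra_homs C H R \<rho> R' \<rho>'" "\<psi> \<cdot> \<eta> = \<eta>'"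
    using elgot_freeD(3)[OF R iterative_elgot[OF R'D(1)] R'D(2)] by blast
  have [simp]: "\<phi> \<in> Ar C" "Dom C \<phi> = R'" "Cod C \<phi> = R" "\<psi> \<in> Ar C" "Dom C \<psi> = R" "Cod C \<psi> = R'"
    "\<eta> \<in> Ar C" "Dom C \<eta> = Y" "Cod C \<eta> = R" "\<eta>' \<in> Ar C" "Dom C \<eta>' = Y" "Cod C \<eta>' = R'"
    using \<phi>(1) \<psi>(1) RD(2) R'D(2) by (auto simp: algebra_homs_def Hom_iff)
  have "\<psi> \<cdot> \<phi> \<in> algebra_homs C H R' \<rho>' R' \<rho>'" "Ident C R' \<in> algebra_homs C H R' \<rho>' R' \<rho>'"
    using algebra_homs_cmp[OF R'A RA(2) R'A(2) \<phi>(1) \<psi>(1)] Ident_algebra_hom[OF R'A] by auto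
  moreover have "(\<psi> \<cdot> \<phi>) \<cdot> \<eta>' = \<eta>'" "Ident C R' \<cdot> \<eta>' = \<eta>'" by (simp_all add: \<phi> \<psi>)
  ultimately have \<psi>\<phi>: "\<psi> \<cdot> \<phi> = Ident C R'" using free[OF R'D] by blast
  show ?thesis
    unfolding elgot_free_def
  proof (intro conjI allI impI R'D)
    fix A \<alpha> d f assume "elgot A \<alpha> d \<and> f \<in> Hom C Y A"
    then have A: "elgot A \<alpha> d" and f: "f \<in> Hom C Y A" by auto
    obtain h where h: "h \<in> algebra_homs C H R \<rho> A \<alpha>" "h \<cdot> \<eta> = f" "preserves R \<rho> d h"
      using elgot_freeD(3)[OF R A f] by blast
    have hH: "h \<in> Hom C R A" using h(1) by (simp add: algebra_homs_def)
    then have "(h \<cdot> \<phi>) \<cdot> \<eta>' = f" by (simp add: Hom_iff \<phi> h)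
    then show "\<exists>h\<in>algebra_homs C H R' \<rho>' A \<alpha>. h \<cdot> \<eta>' = f \<and> preserves R' \<rho>' d h"
      using algebra_homs_cmp[OF R'A RA(2) elgotD(2)[OF A] \<phi>(1) h(1)]
        preserves_cmp[OF R'D(1) RD(1) hH h(3) \<phi>(1)] by blast
  next
    fix A \<alpha> d h h'
    assume "elgot A \<alpha> d \<and> h \<in> Hom C R' A \<and> h' \<in> Hom C R' A \<and> preserves R' \<rho>' d h \<and> preserves R' \<rho>' d h' \<and>
      h \<cdot> \<eta>' = h' \<cdot> \<eta>'"
    then have A: "elgot A \<alpha> d" and h: "h \<in> Hom C R' A" "h' \<in> Hom C R' A" "preserves R' \<rho>' d h" "preserves R' \<rho>' d h'"
      and eq: "h \<cdot> \<eta>' = h' \<cdot> \<eta>'" by auto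
    have [simp]: "h \<in> Ar C" "Dom C h = R'" "Cod C h = A" "h' \<in> Ar C" "Dom C h' = R'" "Cod C h' = A"
      using h(1,2) by (auto simp: Hom_iff)
    have "h \<cdot> \<psi> = h' \<cdot> \<psi>"
    proof (rule elgot_freeD(4)[OF R A])
      show "preserves R \<rho> d (h \<cdot> \<psi>)" "preserves R \<rho> d (h' \<cdot> \<psi>)"
        by (rule preserves_cmp[OF RD(1) R'D(1) _ _ \<psi>(1)], rule h, rule h)+
      show "(h \<cdot> \<psi>) \<cdot> \<eta> = (h' \<cdot> \<psi>) \<cdot> \<eta>" using eq by (simp add: \<psi>)
    qed (simp_all add: Hom_iff)
    then have "(h \<cdot> \<psi>) \<cdot> \<phi> = (h' \<cdot> \<psi>) \<cdot> \<phi>" by simp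
    then show "h = h'" by (simp add: \<psi>\<phi>)
  qed
qed

theorem free_iterative_elgot_free:
  assumes "Y \<in> Ob C" "free_iterative_algebra \<kappa> C H S Y R \<rho> \<eta>"
  shows "elgot_free Y R \<rho> \<eta>"
proof -
  obtain R' i j sol and J :: "('m, 'm \<times> 'm \<times> 'm) cat" and D c where "rational_object C S \<kappa> H Y R' i j sol J D c"
    using ex_rational_object[OF assms(1)] by blast
  then interpret rational_object C S \<kappa> H Y R' i j sol J D c .
  show ?thesis by (rule elgot_free_if_free_iterative[OF elgot_free assms(2)])
qed

end

section \<open>Elgot algebras and Eilenberg--Moore algebras\<close>

lemma structured_cat_simps [simp]:
  "Ob (structured_cat C Obs U P) = Obs"
  "(a, h, b) \<in> Ar (structured_cat C Obs U P) \<longleftrightarrow>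
     a \<in> Obs \<and> b \<in> Obs \<and> h \<in> Hom C (U a) (U b) \<and> P a h b"
  "Dom (structured_cat C Obs U P) (a, h, b) = a" "Cod (structured_cat C Obs U P) (a, h, b) = b"
  "Ident (structured_cat C Obs U P) a = (a, Ident C (U a), a)"
  "(b', g, e) \<cdot>\<^bsub>structured_cat C Obs U P\<^esub> (a, h, b) = (a, g \<cdot>\<^bsub>C\<^esub> h, e)"
  by (simp_all add: structured_cat_def)

lemma is_functor_structured_cat:
  assumes "category (structured_cat C Obs U P)" "category (structured_cat C Obs' U' P')"
    and F: "\<And>a. a \<in> Obs \<Longrightarrow> F a \<in> Obs'" "\<And>a. a \<in> Obs \<Longrightarrow> U' (F a) = U a"
    and P: "\<And>a b h. a \<in> Obs \<Longrightarrow> b \<in> Obs \<Longrightarrow> h \<in> Hom C (U a) (U b) \<Longrightarrow> P a h b \<Longrightarrow> P' (F a) h (F b)"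
  shows "is_functor (structured_cat C Obs U P) (structured_cat C Obs' U' P')
    \<lparr>FOb = F, FAr = (\<lambda>(a, h, b). (F a, h, F b))\<rparr>"
  unfolding is_functor_def
proof (intro conjI ballI impI assms(1,2))
  fix f assume "f \<in> Ar (structured_cat C Obs U P)"
  then show "FAr \<lparr>FOb = F, FAr = (\<lambda>(a, h, b). (F a, h, F b))\<rparr> f \<in>
    Hom (structured_cat C Obs' U' P')
      (FOb \<lparr>FOb = F, FAr = (\<lambda>(a, h, b). (F a, h, F b))\<rparr> (Dom (structured_cat C Obs U P) f))
      (FOb \<lparr>FOb = F, FAr = (\<lambda>(a, h, b). (F a, h, F b))\<rparr> (Cod (structured_cat C Obs U P) f))"
    using F P by (cases f) (simp add: Hom_iff[of _ "structured_cat C Obs' U' P'"])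
next
  fix f g assume "f \<in> Ar (structured_cat C Obs U P)" "g \<in> Ar (structured_cat C Obs U P)"
  then show "FAr \<lparr>FOb = F, FAr = (\<lambda>(a, h, b). (F a, h, F b))\<rparr> (g \<cdot>\<^bsub>structured_cat C Obs U P\<^esub> f) =
    FAr \<lparr>FOb = F, FAr = (\<lambda>(a, h, b). (F a, h, F b))\<rparr> g \<cdot>\<^bsub>structured_cat C Obs' U' P'\<^esub>
    FAr \<lparr>FOb = F, FAr = (\<lambda>(a, h, b). (F a, h, F b))\<rparr> f"
    by (cases f; cases g) simp
qed (use F in auto)

text \<open>The functors keep underlying morphisms, so mutually inverse object maps that respect
  carriers and morphism conditions are enough.\<close>

lemma isomorphic_structured_cats:
  assumes "category (structured_cat C Obs U P)" "category (structured_cat C Obs' U' P')"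
    and F: "\<And>a. a \<in> Obs \<Longrightarrow> F a \<in> Obs'" "\<And>a. a \<in> Obs \<Longrightarrow> U' (F a) = U a"
    "\<And>a b h. a \<in> Obs \<Longrightarrow> b \<in> Obs \<Longrightarrow> h \<in> Hom C (U a) (U b) \<Longrightarrow> P a h b \<Longrightarrow> P' (F a) h (F b)"
    and G: "\<And>a. a \<in> Obs' \<Longrightarrow> G a \<in> Obs" "\<And>a. a \<in> Obs' \<Longrightarrow> U (G a) = U' a"
    "\<And>a b h. a \<in> Obs' \<Longrightarrow> b \<in> Obs' \<Longrightarrow> h \<in> Hom C (U' a) (U' b) \<Longrightarrow> P' a h b \<Longrightarrow> P (G a) h (G b)"
    and GF: "\<And>a. a \<in> Obs \<Longrightarrow> G (F a) = a" and FG: "\<And>a. a \<in> Obs' \<Longrightarrow> F (G a) = a"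
  shows "isomorphic_categories (structured_cat C Obs U P) (structured_cat C Obs' U' P')"
  unfolding isomorphic_categories_def
proof (intro exI conjI)
  show "is_functor (structured_cat C Obs U P) (structured_cat C Obs' U' P')
      \<lparr>FOb = F, FAr = (\<lambda>(a, h, b). (F a, h, F b))\<rparr>"
    by (rule is_functor_structured_cat[OF assms(1,2) F])
  show "is_functor (structured_cat C Obs' U' P') (structured_cat C Obs U P)
      \<lparr>FOb = G, FAr = (\<lambda>(a, h, b). (G a, h, G b))\<rparr>"
    by (rule is_functor_structured_cat[OF assms(2,1) G])
qed (use GF FG in auto)

context elgot_setting
begin

lemma category_Elgot: "category (Elgot \<kappa> C H S)"
  unfolding Elgot_def
proof (rule category_structured_cat; clarsimp)
  show "A \<in> Ob C" if "elgot A \<alpha> d" for A \<alpha> d using elgotD(1)[OF that] .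
  show "Ident C A \<cdot> d e = d (Ident C A \<bullet> e)" if "elgot A \<alpha> d" "e \<in> flat A" for A \<alpha> d e
    using elgot_Hom[OF that] bullet_Ident[OF that(2) elgotD(1)[OF that(1)]] by (simp add: Hom_iff)
  fix A \<alpha> d B \<beta> d' D \<gamma> d'' f g e
  assume A: "elgot A \<alpha> d" and f: "f \<in> Hom C A B" and g: "g \<in> Hom C B D" and e: "e \<in> flat A"
    and pf: "\<forall>e\<in>flat A. f \<cdot> d e = d' (f \<bullet> e)" and pg: "\<forall>e\<in>flat B. g \<cdot> d' e = d'' (g \<bullet> e)"
  have "(g \<cdot> f) \<cdot> d e = g \<cdot> (f \<cdot> d e)"
    using elgot_Hom[OF A e] f g by (simp add: Hom_iff)
  also have "\<dots> = d'' (g \<bullet> (f \<bullet> e))"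
    using pf pg e bullet_flat(1)[OF e f] by simp
  finally show "(g \<cdot> f) \<cdot> d e = d'' ((g \<cdot> f) \<bullet> e)"
    by (simp only: bullet_bullet[OF e f g])
qed

end

text \<open>The rational monad, with the freeness of its algebras already upgraded from iterative to
  Elgot algebras. \<open>FAr (MFun M)\<close> and \<open>mult M\<close> are described by their
  universal equations alone; the functor laws are derived from uniqueness.\<close>

locale rational_setting = elgot_setting C S \<kappa> H for C :: "('o, 'm) cat" (structure) and S and \<kappa> :: "'k rel" and H +
  fixes M :: "('o, 'm) monad" and \<rho> :: "'o \<Rightarrow> 'm"
  assumes free: "Y \<in> Ob C \<Longrightarrow> elgot_free Y (FOb (MFun M) Y) (\<rho> Y) (unit M Y)"
    and Rar: "f \<in> Hom C Y Z \<Longrightarrow>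
      FAr (MFun M) f \<in> algebra_homs C H (FOb (MFun M) Y) (\<rho> Y) (FOb (MFun M) Z) (\<rho> Z)"
      "f \<in> Hom C Y Z \<Longrightarrow> FAr (MFun M) f \<cdot> unit M Y = unit M Z \<cdot> f"
    and mult: "Y \<in> Ob C \<Longrightarrow> mult M Y \<in>
        algebra_homs C H (FOb (MFun M) (FOb (MFun M) Y)) (\<rho> (FOb (MFun M) Y)) (FOb (MFun M) Y) (\<rho> Y)"
      "Y \<in> Ob C \<Longrightarrow> mult M Y \<cdot> unit M (FOb (MFun M) Y) = Ident C (FOb (MFun M) Y)"
begin

abbreviation "R \<equiv> FOb (MFun M)"
abbreviation "Rar \<equiv> FAr (MFun M)"
abbreviation "\<eta> \<equiv> unit M"
abbreviation "\<mu> \<equiv> mult M"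

lemma iterative: "Y \<in> Ob C \<Longrightarrow> iterative (R Y) (\<rho> Y)"
  using elgot_freeD(1)[OF free] .

lemma R_Ob [simp]: "Y \<in> Ob C \<Longrightarrow> R Y \<in> Ob C"
  using iterativeD(1)[OF iterative] .

lemma \<rho>_Hom: "Y \<in> Ob C \<Longrightarrow> \<rho> Y \<in> Hom C (FOb H (R Y)) (R Y)"
  using iterativeD(2)[OF iterative] .

lemma \<eta>_Hom: "Y \<in> Ob C \<Longrightarrow> \<eta> Y \<in> Hom C Y (R Y)"
  using elgot_freeD(2)[OF free] .

lemma \<mu>_Hom: "Y \<in> Ob C \<Longrightarrow> \<mu> Y \<in> Hom C (R (R Y)) (R Y)"
  using mult(1) by (simp add: algebra_homs_def)

lemma monad_simps [simp]:
  assumes "Y \<in> Ob C"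
  shows "\<rho> Y \<in> Ar C" "Dom C (\<rho> Y) = FOb H (R Y)" "Cod C (\<rho> Y) = R Y"
    "\<eta> Y \<in> Ar C" "Dom C (\<eta> Y) = Y" "Cod C (\<eta> Y) = R Y"
    "\<mu> Y \<in> Ar C" "Dom C (\<mu> Y) = R (R Y)" "Cod C (\<mu> Y) = R Y"
  using \<rho>_Hom[OF assms] \<eta>_Hom[OF assms] \<mu>_Hom[OF assms] by (auto simp: Hom_iff)

lemma Rar_simps [simp]:
  assumes "f \<in> Ar C"
  shows "Rar f \<in> Ar C" "Dom C (Rar f) = R (Dom C f)" "Cod C (Rar f) = R (Cod C f)"
  using Rar(1)[of f "Dom C f" "Cod C f"] assms by (auto simp: algebra_homs_def Hom_iff)

lemma Rar_Ident:
  assumes A: "A \<in> Ob C"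
  shows "Rar (Ident C A) = Ident C (R A)"
proof (rule elgot_free_unique[OF free[OF A] iterative[OF A]])
  have id: "Ident C A \<in> Hom C A A" using A by (simp add: Hom_iff)
  show "Rar (Ident C A) \<in> algebra_homs C H (R A) (\<rho> A) (R A) (\<rho> A)" by (rule Rar(1)[OF id])
  show "Ident C (R A) \<in> algebra_homs C H (R A) (\<rho> A) (R A) (\<rho> A)"
    using A by (intro Ident_algebra_hom R_Ob \<rho>_Hom)
  show "Rar (Ident C A) \<cdot> \<eta> A = Ident C (R A) \<cdot> \<eta> A" using A Rar(2)[OF id] by simp
qed

lemma Rar_cmp:
  assumes f: "f \<in> Hom C X Y" and g: "g \<in> Hom C Y Z"
  shows "Rar (g \<cdot> f) = Rar g \<cdot> Rar f"
proof -
  have [simp]: "X \<in> Ob C" "Y \<in> Ob C" "Z \<in> Ob C" using Hom_Ob[OF f] Hom_Ob[OF g] by auto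
  have gf: "g \<cdot> f \<in> Hom C X Z" using f g by (simp add: Hom_iff)
  have fg: "f \<in> Ar C" "Dom C f = X" "Cod C f = Y" "g \<in> Ar C" "Dom C g = Y" "Cod C g = Z"
    using f g by (auto simp: Hom_iff)
  show ?thesis
  proof (rule elgot_free_unique[OF free iterative])
    show "Rar (g \<cdot> f) \<in> algebra_homs C H (R X) (\<rho> X) (R Z) (\<rho> Z)" by (rule Rar(1)[OF gf])
    show "Rar g \<cdot> Rar f \<in> algebra_homs C H (R X) (\<rho> X) (R Z) (\<rho> Z)"
      by (rule algebra_homs_cmp[OF _ _ _ _ Rar(1)[OF f] Rar(1)[OF g]]) (simp_all add: \<rho>_Hom)
    have "(Rar g \<cdot> Rar f) \<cdot> \<eta> X = Rar g \<cdot> (\<eta> Y \<cdot> f)" using fg by (simp add: Rar(2)[OF f])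
    also have "\<dots> = \<eta> Z \<cdot> (g \<cdot> f)" using cmp_reassoc[OF Rar(2)[OF g], of f] fg by simp
    finally show "Rar (g \<cdot> f) \<cdot> \<eta> X = (Rar g \<cdot> Rar f) \<cdot> \<eta> X" using Rar(2)[OF gf] by simp
  qed simp_all
qed

definition em_algebra :: "'o \<Rightarrow> 'm \<Rightarrow> bool" where
  "em_algebra A a \<longleftrightarrow> A \<in> Ob C \<and> a \<in> Hom C (R A) A \<and> a \<cdot> \<eta> A = Ident C A \<and> a \<cdot> \<mu> A = a \<cdot> Rar a"

lemma em_algebraD:
  assumes "em_algebra A a"
  shows "A \<in> Ob C" "a \<in> Hom C (R A) A" "a \<cdot> \<eta> A = Ident C A" "a \<cdot> \<mu> A = a \<cdot> Rar a"
    "a \<in> Ar C" "Dom C a = R A" "Cod C a = A"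
  using assms by (auto simp: em_algebra_def Hom_iff)

lemma category_Eilenberg_Moore: "category (Eilenberg_Moore C M)"
  unfolding Eilenberg_Moore_def
proof (rule category_structured_cat; clarsimp)
  show "Ident C A \<cdot> a = a \<cdot> Rar (Ident C A)" if "A \<in> Ob C" "a \<in> Hom C (R A) A" for A a
    using that by (simp add: Rar_Ident Hom_iff)
  fix A a B b D d f g
  assume AB: "A \<in> Ob C" "B \<in> Ob C" "D \<in> Ob C" "a \<in> Hom C (R A) A" "b \<in> Hom C (R B) B" "d \<in> Hom C (R D) D"
    and f: "f \<in> Hom C A B" and g: "g \<in> Hom C B D" and fa: "f \<cdot> a = b \<cdot> Rar f" and gb: "g \<cdot> b = d \<cdot> Rar g"
  have [simp]: "a \<in> Ar C" "Dom C a = R A" "Cod C a = A" "b \<in> Ar C" "Dom C b = R B" "Cod C b = B"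
    "d \<in> Ar C" "Dom C d = R D" "Cod C d = D" "f \<in> Ar C" "Dom C f = A" "Cod C f = B"
    "g \<in> Ar C" "Dom C g = B" "Cod C g = D" using AB f g by (auto simp: Hom_iff)
  have "(g \<cdot> f) \<cdot> a = g \<cdot> (b \<cdot> Rar f)" using AB by (simp add: fa)
  also have "\<dots> = d \<cdot> (Rar g \<cdot> Rar f)" using cmp_reassoc[OF gb, of "Rar f"] AB by simp
  finally show "(g \<cdot> f) \<cdot> a = d \<cdot> Rar (g \<cdot> f)" by (simp only: Rar_cmp[OF f g])
qed

text \<open>The generic solution of \<open>e\<close>, formed in the free algebra after inserting the
  parameters. A map from \<open>R A\<close> to \<open>A\<close> evaluates it to a morphism into
  \<open>A\<close>.\<close>

definition rsol :: "'o \<Rightarrow> 'm \<Rightarrow> 'm" where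
  "rsol A e = isol (R A) (\<rho> A) (\<eta> A \<bullet> e)"

lemma rsol_Hom:
  assumes "A \<in> Ob C" "e \<in> flat A"
  shows "rsol A e \<in> Hom C (Dom C e) (R A)"
  using iterativeD(5)[OF iterative[OF assms(1)] bullet_flat(1)[OF assms(2) \<eta>_Hom[OF assms(1)]]]
    bullet_flat(2)[OF assms(2) \<eta>_Hom[OF assms(1)]] by (simp add: rsol_def)

lemma rsol_natural:
  assumes h: "h \<in> Hom C A B" and e: "e \<in> flat A"
  shows "Rar h \<cdot> rsol A e = rsol B (h \<bullet> e)"
proof -
  have [simp]: "A \<in> Ob C" "B \<in> Ob C" using Hom_Ob[OF h] by auto
  have RH: "Rar h \<in> Hom C (R A) (R B)" using h by (simp add: Hom_iff)
  have "Rar h \<cdot> rsol A e = isol (R B) (\<rho> B) (Rar h \<bullet> (\<eta> A \<bullet> e))"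
    unfolding rsol_def by (rule isol_bullet[OF _ _ Rar(1)[OF h] bullet_flat(1)[OF e]]) (simp_all add: iterative \<eta>_Hom)
  also have "Rar h \<bullet> (\<eta> A \<bullet> e) = \<eta> B \<bullet> (h \<bullet> e)"
    using bullet_bullet[OF e \<eta>_Hom RH] bullet_bullet[OF e h \<eta>_Hom] Rar(2)[OF h] by simp
  finally show ?thesis by (simp only: rsol_def)
qed

text \<open>\<open>\<rho> A \<cdot> FAr H (\<eta> A)\<close> is the component at \<open>A\<close> of
  the canonical transformation from \<open>H\<close> to the rational monad; the algebra
  \<open>a\<close> is restricted along it.\<close>

definition structure_of :: "'o \<Rightarrow> 'm \<Rightarrow> 'm" where
  "structure_of A a = a \<cdot> (\<rho> A \<cdot> FAr H (\<eta> A))"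

definition solutions_of :: "'o \<Rightarrow> 'm \<Rightarrow> 'm \<Rightarrow> 'm" where
  "solutions_of A a = restrict (\<lambda>e. a \<cdot> rsol A e) (flat A)"

section \<open>From Eilenberg-Moore algebras to Elgot algebras\<close>

context
  fixes A a
  assumes em: "em_algebra A a"
begin

lemmas em_simps [simp] = em_algebraD(1,5-7)[OF em]

lemma structure_of_Hom: "structure_of A a \<in> Hom C (FOb H A) A"
  by (simp add: structure_of_def Hom_iff)

text \<open>Naturality of \<open>\<eta>\<close> turns \<open>a\<close> into \<open>Rar a\<close>,
  which commutes with the algebra structures; the associativity law replaces
  \<open>a \<cdot> Rar a\<close> by \<open>a \<cdot> \<mu> A\<close>, and the unit law for
  \<open>\<mu> A\<close> leaves \<open>a \<cdot> \<rho> A\<close>.\<close>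

lemma em_algebra_hom: "a \<in> algebra_homs C H (R A) (\<rho> A) A (structure_of A a)"
proof -
  have Rh: "Rar a \<in> algebra_homs C H (R (R A)) (\<rho> (R A)) (R A) (\<rho> A)" "Rar a \<cdot> \<eta> (R A) = \<eta> A \<cdot> a"
    using Rar[OF em_algebraD(2)[OF em]] by auto
  then have Rh': "Rar a \<cdot> \<rho> (R A) = \<rho> A \<cdot> FAr H (Rar a)" by (simp add: algebra_homs_def)
  have \<mu>': "\<mu> A \<cdot> \<rho> (R A) = \<rho> A \<cdot> FAr H (\<mu> A)" using mult(1)[of A] by (simp add: algebra_homs_def)
  have "structure_of A a \<cdot> FAr H a = a \<cdot> (\<rho> A \<cdot> FAr H (\<eta> A \<cdot> a))" by (simp add: structure_of_def)
  also have "\<dots> = a \<cdot> ((\<rho> A \<cdot> FAr H (Rar a)) \<cdot> FAr H (\<eta> (R A)))" unfolding Rh(2)[symmetric] by simp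
  also have "\<dots> = (a \<cdot> Rar a) \<cdot> (\<rho> (R A) \<cdot> FAr H (\<eta> (R A)))" unfolding Rh'[symmetric] by simp
  also have "\<dots> = a \<cdot> ((\<mu> A \<cdot> \<rho> (R A)) \<cdot> FAr H (\<eta> (R A)))"
    unfolding em_algebraD(4)[OF em, symmetric] by simp
  also have "\<dots> = a \<cdot> (\<rho> A \<cdot> FAr H (\<mu> A \<cdot> \<eta> (R A)))" unfolding \<mu>' by simp
  also have "\<dots> = a \<cdot> \<rho> A" by (simp add: mult(2))
  finally show ?thesis using em_algebraD(2)[OF em] by (simp add: algebra_homs_def)
qed

text \<open>The reason is \<open>a \<cdot> Rar a = a \<cdot> \<mu> A\<close>: \<open>Rar a\<close>
  evaluates the parameters of the generic solution of \<open>g\<close>, while the homomorphism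
  \<open>\<mu> A\<close> sends that generic solution to the solution of \<open>g\<close> in
  \<open>R A\<close>. So \<open>a\<close> sees an equation in \<open>R A\<close> only through its
  parameters evaluated in \<open>A\<close>.\<close>

lemma em_isol:
  assumes g: "g \<in> flat (R A)"
  shows "a \<cdot> isol (R A) (\<rho> A) g = a \<cdot> rsol A (a \<bullet> g)"
proof -
  note aH = em_algebraD(2)[OF em]
  note [simp] = flatD[OF g]
  have R: "rsol (R A) g \<in> Hom C (Dom C g) (R (R A))" using rsol_Hom[OF _ g] by simp
  have b: "\<eta> (R A) \<bullet> g \<in> flat (R (R A))" using bullet_flat(1)[OF g \<eta>_Hom] by simp
  have "a \<cdot> rsol A (a \<bullet> g) = a \<cdot> (Rar a \<cdot> rsol (R A) g)" by (simp only: rsol_natural[OF aH g])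
  also have "\<dots> = (a \<cdot> Rar a) \<cdot> rsol (R A) g" using R by (simp add: Hom_iff)
  also have "\<dots> = (a \<cdot> \<mu> A) \<cdot> rsol (R A) g" by (simp only: em_algebraD(4)[OF em])
  also have "\<dots> = a \<cdot> (\<mu> A \<cdot> rsol (R A) g)" using R by (simp add: Hom_iff)
  also have "\<mu> A \<cdot> rsol (R A) g = isol (R A) (\<rho> A) (\<mu> A \<bullet> (\<eta> (R A) \<bullet> g))"
    unfolding rsol_def by (rule isol_bullet[OF _ _ mult(1) b]) (simp_all add: iterative)
  also have "\<mu> A \<bullet> (\<eta> (R A) \<bullet> g) = g"
    using bullet_bullet[OF g \<eta>_Hom \<mu>_Hom] bullet_Ident[OF g] by (simp add: mult(2))
  finally show ?thesis by (rule sym)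
qed

lemma em_preserves: "preserves (R A) (\<rho> A) (solutions_of A a) a"
  unfolding preserves_def
proof
  fix g assume g: "g \<in> flat (R A)"
  show "a \<cdot> isol (R A) (\<rho> A) g = solutions_of A a (a \<bullet> g)"
    using em_isol[OF g] bullet_flat(1)[OF g em_algebraD(2)[OF em]] by (simp add: solutions_of_def)
qed

lemma em_elgot: "elgot A (structure_of A a) (solutions_of A a)"
proof (rule elgotI)
  note aH = em_algebraD(2)[OF em] and \<eta>H = \<eta>_Hom[OF em_simps(1)]
  show "structure_of A a \<in> Hom C (FOb H A) A" by (rule structure_of_Hom)
  show "solutions_of A a \<in> extensional (flat A)" by (simp add: solutions_of_def)
  fix f assume f: "f \<in> flat A"
  have af: "a \<bullet> (\<eta> A \<bullet> f) = f"
    using bullet_bullet[OF f \<eta>H aH] bullet_Ident[OF f] em_algebraD(3)[OF em] by simp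
  have "solves A (structure_of A a) (a \<bullet> (\<eta> A \<bullet> f)) (a \<cdot> rsol A f)"
    unfolding rsol_def
    by (rule solves_bullet[OF bullet_flat(1)[OF f \<eta>H] _ structure_of_Hom em_algebra_hom
          iterativeD(3)[OF _ bullet_flat(1)[OF f \<eta>H]]]) (simp_all add: \<rho>_Hom iterative)
  then show "solves A (structure_of A a) f (solutions_of A a f)"
    using f by (simp add: af solutions_of_def)
  show "solutions_of A a e = solutions_of A a f \<cdot> h" if e: "e \<in> flat A" and h: "flat_hom A e f h" for e h
  proof -
    have "rsol A e = rsol A f \<cdot> h"
      unfolding rsol_def
      by (rule isol_flat_hom[OF iterative bullet_flat(1)[OF e \<eta>H] bullet_flat(1)[OF f \<eta>H]
            flat_hom_bullet[OF e f h \<eta>H]]) simp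
    moreover have "h \<in> Hom C (Dom C e) (Dom C f)" using h by (simp add: flat_hom_def)
    ultimately show ?thesis
      using e f rsol_Hom[OF em_simps(1) f] by (simp add: solutions_of_def Hom_iff)
  qed
  show "solutions_of A a (solutions_of A a f \<bullet> e) =
      solutions_of A a (flat_oplus A f e) \<cdot> inl S (Dom C e) (Dom C f)" if e: "e \<in> flat (Dom C f)" for e
  proof -
    note rH = rsol_Hom[OF em_simps(1) f]
    note og = oplus_flat[OF f e em_simps(1)]
    have af: "a \<cdot> rsol A f \<in> Hom C (Dom C f) A" using rH by (simp add: Hom_iff)
    have eta_f: "\<eta> A \<bullet> f \<in> flat (R A)" "Dom C (\<eta> A \<bullet> f) = Dom C f" using bullet_flat[OF f \<eta>H] by auto
    note [simp] = flatD[OF e] flatD[OF f]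
    have [simp]: "Dom C e \<in> Ob C" "Dom C f \<in> Ob C" by simp_all
    have "solutions_of A a (solutions_of A a f \<bullet> e) = a \<cdot> rsol A ((a \<cdot> rsol A f) \<bullet> e)"
      using f bullet_flat(1)[OF e af] by (simp add: solutions_of_def)
    also have "\<dots> = a \<cdot> rsol A (a \<bullet> (rsol A f \<bullet> e))" by (simp only: bullet_bullet[OF e rH aH])
    \<comment> \<open>Evaluation of the parameters is traded for a solution formed in
      \<open>R A\<close>, where compositionality holds by uniqueness of solutions.\<close>
    also have "\<dots> = a \<cdot> isol (R A) (\<rho> A) (rsol A f \<bullet> e)" by (simp only: em_isol[OF bullet_flat(1)[OF e rH]])
    also have "isol (R A) (\<rho> A) (rsol A f \<bullet> e) =
        isol (R A) (\<rho> A) (flat_oplus (R A) (\<eta> A \<bullet> f) e) \<cdot> inl S (Dom C e) (Dom C f)"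
      using isol_oplus[OF iterative eta_f(1), of e] e eta_f(2) by (simp add: rsol_def)
    also have "flat_oplus (R A) (\<eta> A \<bullet> f) e = \<eta> A \<bullet> flat_oplus A f e"
      by (simp only: bullet_oplus[OF f e em_simps(1) \<eta>H])
    also have "a \<cdot> (isol (R A) (\<rho> A) (\<eta> A \<bullet> flat_oplus A f e) \<cdot> inl S (Dom C e) (Dom C f)) =
        (a \<cdot> rsol A (flat_oplus A f e)) \<cdot> inl S (Dom C e) (Dom C f)"
      using rsol_Hom[OF em_simps(1) og(1)] og(2) by (simp add: rsol_def[symmetric] Hom_iff)
    finally show ?thesis using og(1) by (simp add: solutions_of_def)
  qed
qed simp

end

section \<open>From Elgot algebras to Eilenberg-Moore algebras, and the isomorphism\<close>

definition extend :: "'o \<Rightarrow> 'm \<Rightarrow> ('m \<Rightarrow> 'm) \<Rightarrow> 'm" where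
  "extend A \<alpha> d = (SOME h. h \<in> algebra_homs C H (R A) (\<rho> A) A \<alpha> \<and> h \<cdot> \<eta> A = Ident C A \<and> preserves (R A) (\<rho> A) d h)"

context
  fixes A \<alpha> d
  assumes el: "elgot A \<alpha> d"
begin

lemmas A_Ob [simp] = elgotD(1)[OF el]

lemma extend:
  "extend A \<alpha> d \<in> algebra_homs C H (R A) (\<rho> A) A \<alpha>" "extend A \<alpha> d \<cdot> \<eta> A = Ident C A"
  "preserves (R A) (\<rho> A) d (extend A \<alpha> d)"
proof -
  have "Ident C A \<in> Hom C A A" by (simp add: Hom_iff)
  from elgot_freeD(3)[OF free el this]
  have "\<exists>h. h \<in> algebra_homs C H (R A) (\<rho> A) A \<alpha> \<and> h \<cdot> \<eta> A = Ident C A \<and> preserves (R A) (\<rho> A) d h"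
    by auto
  from someI_ex[OF this]
  show "extend A \<alpha> d \<in> algebra_homs C H (R A) (\<rho> A) A \<alpha>" "extend A \<alpha> d \<cdot> \<eta> A = Ident C A"
    "preserves (R A) (\<rho> A) d (extend A \<alpha> d)"
    unfolding extend_def by auto
qed

lemma extend_Hom: "extend A \<alpha> d \<in> Hom C (R A) A"
  using extend(1) by (simp add: algebra_homs_def)

lemma extend_simps [simp]:
  "extend A \<alpha> d \<in> Ar C" "Dom C (extend A \<alpha> d) = R A" "Cod C (extend A \<alpha> d) = A"
  using extend_Hom by (auto simp: Hom_iff)

lemma extend_unique:
  assumes "h \<in> Hom C (R A) A" "h \<cdot> \<eta> A = Ident C A" "preserves (R A) (\<rho> A) d h"
  shows "extend A \<alpha> d = h"
  using elgot_freeD(4)[OF free el extend_Hom assms(1) extend(3) assms(3)] extend(2) assms(2) by simp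

text \<open>Both sides of the associativity law are composites of a solution-preserving map with
  homomorphisms of iterative algebras, hence preserve solutions, and both restrict along
  \<open>\<eta> (R A)\<close> to \<open>extend A \<alpha> d\<close>.\<close>

lemma extend_em_algebra: "em_algebra A (extend A \<alpha> d)"
proof -
  let ?a = "extend A \<alpha> d"
  have R: "Rar ?a \<in> algebra_homs C H (R (R A)) (\<rho> (R A)) (R A) (\<rho> A)" "Rar ?a \<cdot> \<eta> (R A) = \<eta> A \<cdot> ?a"
    using Rar[OF extend_Hom] by auto
  have "?a \<cdot> \<mu> A = ?a \<cdot> Rar ?a"
  proof (rule elgot_freeD(4)[OF free el])
    show "preserves (R (R A)) (\<rho> (R A)) d (?a \<cdot> \<mu> A)"
      by (rule preserves_cmp[OF _ _ extend_Hom extend(3) mult(1)]) (simp_all add: iterative)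
    show "preserves (R (R A)) (\<rho> (R A)) d (?a \<cdot> Rar ?a)"
      by (rule preserves_cmp[OF _ _ extend_Hom extend(3) R(1)]) (simp_all add: iterative)
    have "(?a \<cdot> \<mu> A) \<cdot> \<eta> (R A) = ?a \<cdot> (\<mu> A \<cdot> \<eta> (R A))" by simp
    also have "\<dots> = ?a" by (simp add: mult(2))
    also have "\<dots> = (?a \<cdot> \<eta> A) \<cdot> ?a" by (simp only: extend(2)) simp
    also have "\<dots> = ?a \<cdot> (Rar ?a \<cdot> \<eta> (R A))" by (simp add: R(2))
    finally show "(?a \<cdot> \<mu> A) \<cdot> \<eta> (R A) = (?a \<cdot> Rar ?a) \<cdot> \<eta> (R A)" by simp
  qed (simp_all add: Hom_iff)
  then show ?thesis using extend(2) extend_Hom by (simp add: em_algebra_def)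
qed

lemma structure_of_extend: "structure_of A (extend A \<alpha> d) = \<alpha>"
proof -
  have \<alpha>: "\<alpha> \<in> Ar C" "Dom C \<alpha> = FOb H A" "Cod C \<alpha> = A" using elgotD(2)[OF el] by (auto simp: Hom_iff)
  have e: "extend A \<alpha> d \<cdot> \<rho> A = \<alpha> \<cdot> FAr H (extend A \<alpha> d)" using extend(1) by (simp add: algebra_homs_def)
  have "structure_of A (extend A \<alpha> d) = (extend A \<alpha> d \<cdot> \<rho> A) \<cdot> FAr H (\<eta> A)" by (simp add: structure_of_def)
  also have "\<dots> = \<alpha> \<cdot> FAr H (extend A \<alpha> d \<cdot> \<eta> A)" unfolding e using \<alpha> by simp
  also have "\<dots> = \<alpha>" unfolding extend(2) using \<alpha> by simp
  finally show ?thesis .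
qed

lemma extend_rsol:
  assumes e: "e \<in> flat A"
  shows "extend A \<alpha> d \<cdot> rsol A e = d e"
proof -
  have \<eta>H: "\<eta> A \<in> Hom C A (R A)" by (rule \<eta>_Hom) simp
  have "extend A \<alpha> d \<cdot> rsol A e = d (extend A \<alpha> d \<bullet> (\<eta> A \<bullet> e))"
    using extend(3) bullet_flat(1)[OF e \<eta>H] by (simp add: preserves_def rsol_def)
  then show ?thesis by (simp add: bullet_bullet[OF e \<eta>H extend_Hom] extend(2) bullet_Ident[OF e])
qed

text \<open>Both assignments are extensional on the finitary flat equations, so agreement there is
  equality of functions, as an isomorphism of categories demands.\<close>

lemma solutions_of_extend: "solutions_of A (extend A \<alpha> d) = d"
  using elgotD(3)[OF el] extend_rsol by (auto simp: solutions_of_def fun_eq_iff extensional_def)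

end

lemma extend_of:
  assumes em: "em_algebra A a"
  shows "extend A (structure_of A a) (solutions_of A a) = a"
  by (rule extend_unique[OF em_elgot[OF em] em_algebraD(2,3)[OF em] em_preserves[OF em]])

text \<open>Of \<open>h\<close> only preservation of solutions is known. Both sides preserve
  solutions and restrict along \<open>\<eta> A\<close> to \<open>h\<close>, so the uniqueness clause
  of \<open>elgot_free\<close>, stated for arbitrary solution-preserving maps, applies.\<close>

lemma em_hom_if_preserves:
  assumes A: "elgot A \<alpha> d" and B: "elgot B \<beta> d'" and h: "h \<in> Hom C A B"
    and ph: "\<And>e. e \<in> flat A \<Longrightarrow> h \<cdot> d e = d' (h \<bullet> e)"
  shows "h \<cdot> extend A \<alpha> d = extend B \<beta> d' \<cdot> Rar h"
proof (rule elgot_freeD(4)[OF free B])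
  let ?a = "extend A \<alpha> d" and ?b = "extend B \<beta> d'"
  note [simp] = A_Ob[OF A] A_Ob[OF B] extend_simps[OF A] extend_simps[OF B]
  have hh [simp]: "h \<in> Ar C" "Dom C h = A" "Cod C h = B" using h by (auto simp: Hom_iff)
  show "A \<in> Ob C" "h \<cdot> ?a \<in> Hom C (R A) B" "?b \<cdot> Rar h \<in> Hom C (R A) B" by (simp_all add: Hom_iff)
  show "preserves (R A) (\<rho> A) d' (h \<cdot> ?a)"
    unfolding preserves_def
  proof
    fix g assume g: "g \<in> flat (R A)"
    note ag = bullet_flat[OF g extend_Hom[OF A]]
    have "(h \<cdot> ?a) \<cdot> isol (R A) (\<rho> A) g = h \<cdot> (?a \<cdot> isol (R A) (\<rho> A) g)"
      using iterativeD(5)[OF iterative g] by (simp add: Hom_iff)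
    also have "?a \<cdot> isol (R A) (\<rho> A) g = d (?a \<bullet> g)" using extend(3)[OF A] g by (simp add: preserves_def)
    also have "h \<cdot> d (?a \<bullet> g) = d' (h \<bullet> (?a \<bullet> g))" by (rule ph[OF ag(1)])
    finally show "(h \<cdot> ?a) \<cdot> isol (R A) (\<rho> A) g = d' ((h \<cdot> ?a) \<bullet> g)"
      by (simp only: bullet_bullet[OF g extend_Hom[OF A] h])
  qed
  show "preserves (R A) (\<rho> A) d' (?b \<cdot> Rar h)"
    by (rule preserves_cmp[OF _ _ extend_Hom[OF B] extend(3)[OF B] Rar(1)[OF h]]) (simp_all add: iterative)
  have "(h \<cdot> ?a) \<cdot> \<eta> A = h" by (simp add: extend(2)[OF A])
  moreover have "(?b \<cdot> Rar h) \<cdot> \<eta> A = (?b \<cdot> \<eta> B) \<cdot> h" by (simp add: Rar(2)[OF h])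
  ultimately show "(h \<cdot> ?a) \<cdot> \<eta> A = (?b \<cdot> Rar h) \<cdot> \<eta> A" unfolding extend(2)[OF B] by simp
qed

text \<open>Generic solutions are natural in \<open>A\<close>, so \<open>h\<close> carries their
  evaluation by \<open>a\<close> to evaluation by \<open>b\<close>.\<close>

lemma preserves_if_em_hom:
  assumes A: "em_algebra A a" and B: "em_algebra B b" and h: "h \<in> Hom C A B"
    and ha: "h \<cdot> a = b \<cdot> Rar h" and e: "e \<in> flat A"
  shows "h \<cdot> solutions_of A a e = solutions_of B b (h \<bullet> e)"
proof -
  note [simp] = em_simps[OF A] em_simps[OF B]
  have hh [simp]: "h \<in> Ar C" "Dom C h = A" "Cod C h = B" using h by (auto simp: Hom_iff)
  have r: "rsol A e \<in> Ar C" "Cod C (rsol A e) = R A" using rsol_Hom[OF _ e] by (auto simp: Hom_iff)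
  have "h \<cdot> (a \<cdot> rsol A e) = (b \<cdot> Rar h) \<cdot> rsol A e" using cmp_reassoc[OF ha, of "rsol A e"] r by simp
  also have "\<dots> = b \<cdot> (Rar h \<cdot> rsol A e)" using r by simp
  finally show ?thesis
    using e bullet_flat(1)[OF e h] by (simp add: solutions_of_def rsol_natural[OF h e])
qed

theorem isomorphic_Elgot_Eilenberg_Moore: "isomorphic_categories (Elgot \<kappa> C H S) (Eilenberg_Moore C M)"
  unfolding Elgot_def Eilenberg_Moore_def
proof (rule isomorphic_structured_cats[where F = "\<lambda>(A, \<alpha>, d). (A, extend A \<alpha> d)"
      and G = "\<lambda>(A, a). (A, structure_of A a, solutions_of A a)"], fold Elgot_def Eilenberg_Moore_def)
  show "category (Elgot \<kappa> C H S)" by (rule category_Elgot)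
  show "category (Eilenberg_Moore C M)" by (rule category_Eilenberg_Moore)
qed (use extend_em_algebra em_elgot em_hom_if_preserves preserves_if_em_hom structure_of_extend
    solutions_of_extend extend_of in \<open>auto simp: em_algebra_def\<close>)

end

theorem theorem4p6:
  fixes \<kappa> :: "'k rel"
    and C :: "('o, 'm) cat"
    and H :: "('o, 'm, 'o, 'm) func"
    and S :: "('o, 'm) coproducts"
    and M :: "('o, 'm) monad"
  assumes "uncountable_regular \<kappa>"
    and "locally_finitely_presentable \<kappa> C"
    and "binary_coproducts C S"
    and "finitary \<kappa> C C H"
    and "rational_monad \<kappa> C H S M"
  shows "isomorphic_categories (Elgot \<kappa> C H S) (Eilenberg_Moore C M)"
proof -
  interpret category C using assms(2) by (simp add: locally_finitely_presentable_def)
  interpret elgot_setting C S \<kappa> H using assms(1-4) by unfold_locales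
  obtain \<rho> where \<rho>:
    "\<And>Y. Y \<in> Ob C \<Longrightarrow> free_iterative_algebra \<kappa> C H S Y (FOb (MFun M) Y) (\<rho> Y) (unit M Y)"
    "\<And>f. f \<in> Ar C \<Longrightarrow> FAr (MFun M) f \<in> algebra_homs C H (FOb (MFun M) (Dom C f)) (\<rho> (Dom C f))
       (FOb (MFun M) (Cod C f)) (\<rho> (Cod C f)) \<and> FAr (MFun M) f \<cdot>\<^bsub>C\<^esub> unit M (Dom C f) = unit M (Cod C f) \<cdot>\<^bsub>C\<^esub> f"
    "\<And>Y. Y \<in> Ob C \<Longrightarrow> mult M Y \<in> algebra_homs C H (FOb (MFun M) (FOb (MFun M) Y)) (\<rho> (FOb (MFun M) Y))
       (FOb (MFun M) Y) (\<rho> Y) \<and> mult M Y \<cdot>\<^bsub>C\<^esub> unit M (FOb (MFun M) Y) = Ident C (FOb (MFun M) Y)"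
    using assms(5) unfolding rational_monad_def Let_def by blast
  interpret rational_setting C S \<kappa> H M \<rho>
  proof
    fix f Y Z assume "f \<in> Hom C Y Z"
    then have "f \<in> Ar C" "Dom C f = Y" "Cod C f = Z" by (auto simp: Hom_iff)
    with \<rho>(2)[of f] show
      "FAr (MFun M) f \<in> algebra_homs C H (FOb (MFun M) Y) (\<rho> Y) (FOb (MFun M) Z) (\<rho> Z)"
      "FAr (MFun M) f \<cdot>\<^bsub>C\<^esub> unit M Y = unit M Z \<cdot>\<^bsub>C\<^esub> f" by auto
  \<comment> \<open>\<open>free_iterative_elgot_free\<close> replaces freeness among iterative
    algebras by freeness among Elgot algebras, for exactly the algebras chosen by the given
    monad.\<close>
  qed (use \<rho>(1,3) free_iterative_elgot_free in auto)
  show ?thesis by (rule isomorphic_Elgot_Eilenberg_Moore)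
qed

end
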